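(* Let $f:X\to Y$ be a quasi-isometry between proper geodesic metric spaces. Then the induced homeomorphism $f_*:\partial X\to\partial Y$ of Morse boundaries and its inverse are $2$-stable and quasi-möbius.
   Context: **Quasi-geodesics, Morse.** $f:X\to Y$ is a $(\lambda,\varepsilon)$-quasi-isometric embedding ($\lambda\ge1,\varepsilon\ge0$) if $\frac1\lambda d_X(x,y)-\varepsilon\le d_Y(f(x),f(y))\le\lambda d_X(x,y)+\varepsilon$ for all $x,y$; it is a quasi-isometry if moreover there are $\hat f:Y\to X$ and $D\ge0$ with $d_X(\hat f f(x),x)\le D$, $d_Y(f\hat f(y),y)\le D$ for all $x,y$. A $(\lambda,\varepsilon)$-quasi-geodesic is a $(\lambda,\varepsilon)$-quasi-isometric embedding of a closed interval $I\subseteq\mathbb R$. A Morse gauge is a function $N:[1,\infty)\times[0,\infty)\to[0,\infty)$; a quasi-geodesic $\gamma$ is $N$-Morse if every $(\lambda,\varepsilon)$-quasi-geodesic with endpoints on $\gamma$ lies in the $N(\lambda,\varepsilon)$-neighborhood of $\gamma$. Convention: when a geodesic is said to be $N$-Morse, $N$ is assumed large enough that all its subgeodesics are also $N$-Morse. **Morse boundary.** Let $X$ be a proper geodesic metric space, $p\in X$. Rays are asymptotic if their images have finite Hausdorff distance. $\partial_vX_p$ is the set of asymptotism classes of geodesic rays based at $p$; $B\subseteq\partial_vX_p$ is closed iff: whenever $(b_n)$ is a sequence in $B$, $\beta_n$ are rays based at $p$ with $[\beta_n]=b_n$, $b\in\partial_vX_p$, and every subsequence of $(\beta_n)$ has a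 further subsequence converging uniformly on compact sets to a ray in $b$, then $b\in B$. For a Morse gauge $N$, $\partial^NX_p\subseteq\partial_vX_p$ is the set of classes containing an $N$-Morse geodesic ray based at $p$, with the subspace topology. Gauges are partially ordered pointwise, and the Morse boundary is $\partial X=\partial_MX_p=\varinjlim_N\partial^NX_p=\bigcup_N\partial^NX_p$ with the direct limit topology. Changing the basepoint gives canonically homeomorphic boundaries (asymptotic rays correspond). A quasi-isometry $f:X\to Y$ induces a homeomorphism $f_*:\partial X\to\partial Y$ (known result of Cordes) sending $[\gamma]$ to the class of geodesic rays at finite Hausdorff distance from $f(\gamma)$. A bi-infinite (quasi-)geodesic $\gamma$ is from $a$ to $b$ ($a,b\in\partial X$) if $\gamma|_{(-\infty,0]}$ is asymptotic to a representative of $a$ and $\gamma|_{[0,\infty)}$ to a representative of $b$. **Centers, cross-ratio.** $\partial X^{(n,N)}$ is the set of $n$-tuples of pairwise distinct points of $\partial X$ such that every geodesic between any two of them is $N$-Morse. For $K>0$ and $(a,b,c)\in\partial X^{(3,N)}$, $m_X^{N,K}(a,b,c)$ is the set of $x\in X$ within $K$ of all three sides of some geodesic triangle with vertices $a,b,c$. For each gauge $N$, $K_N$ denotes a fixed constant such that every geodesic triangle (with vertices in the space or its Morse boundary) in either of the spaces all of whose sides are $N$-Morse has points $q_1,q_2,q_3$, one on each side, pairwise at distance at most $K_N$ (such constants exist); so $m_X^{N,K}$ takes non-empty values for $K\ge K_N$. The $N$-cross-ratio of $(a,b,c,d)\in\partial X^{(4,N)}$ is $[a,b,c,d]_N=\operatorname{diam}\big(m_X^{N,K_N}(a,b,c)\cup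 m_X^{N,K_N}(a,d,c)\big)$. **2-stable, quasi-möbius.** $h:\partial X\to\partial Y$ is $2$-stable if for every $N$ there is $N'$ with $h(\partial X^{(2,N)})\subseteq\partial Y^{(2,N')}$. A $2$-stable $h$ is quasi-möbius if for every pair of gauges $N,N'$ with $h(\partial X^{(2,N)})\subseteq\partial Y^{(2,N')}$ there is a continuous increasing $\psi:[0,\infty)\to[0,\infty)$ with $[h(a),h(b),h(c),h(d)]_{N'}\le\psi([a,b,c,d]_N)$ for all $(a,b,c,d)\in\partial X^{(4,N)}$. *)

theory Defs
  imports "HOL-Analysis.Analysis"
begin

text \<open>A metric space is a type of class \<open>metric_space\<close>; proper metric spaces are those of class
  \<open>heine_borel\<close>. A path is a function on all reals together with the interval \<open>I\<close> on which it is
  considered; its values outside \<open>I\<close> play no role.\<close>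

definition qi_embedding_on ::
    "real \<Rightarrow> real \<Rightarrow> 'a::metric_space set \<Rightarrow> ('a \<Rightarrow> 'b::metric_space) \<Rightarrow> bool" where
  "qi_embedding_on L e A f \<longleftrightarrow> L \<ge> 1 \<and> e \<ge> 0 \<and>
     (\<forall>x\<in>A. \<forall>y\<in>A. (1 / L) * dist x y - e \<le> dist (f x) (f y) \<and> dist (f x) (f y) \<le> L * dist x y + e)"

definition quasi_isometry :: "('a::metric_space \<Rightarrow> 'b::metric_space) \<Rightarrow> bool" where
  "quasi_isometry f \<longleftrightarrow> (\<exists>L e. qi_embedding_on L e UNIV f) \<and>
     (\<exists>g D. D \<ge> 0 \<and> (\<forall>x. dist (g (f x)) x \<le> D) \<and> (\<forall>y. dist (f (g y)) y \<le> D))"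

definition closed_interval :: "real set \<Rightarrow> bool" where
  "closed_interval I \<longleftrightarrow> I \<noteq> {} \<and> closed I \<and> is_interval I"

definition quasi_geodesic :: "real \<Rightarrow> real \<Rightarrow> real set \<Rightarrow> (real \<Rightarrow> 'a::metric_space) \<Rightarrow> bool" where
  "quasi_geodesic L e I \<gamma> \<longleftrightarrow> closed_interval I \<and> qi_embedding_on L e I \<gamma>"

definition geodesic :: "real set \<Rightarrow> (real \<Rightarrow> 'a::metric_space) \<Rightarrow> bool" where
  "geodesic I \<gamma> \<longleftrightarrow> closed_interval I \<and> (\<forall>s\<in>I. \<forall>t\<in>I. dist (\<gamma> s) (\<gamma> t) = \<bar>s - t\<bar>)"

definition geodesic_space :: "'a::metric_space itself \<Rightarrow> bool" where
  "geodesic_space _ \<longleftrightarrow>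
     (\<forall>x y :: 'a. \<exists>s t \<gamma>. s \<le> t \<and> geodesic {s..t} \<gamma> \<and> \<gamma> s = x \<and> \<gamma> t = y)"

text \<open>Values of a gauge outside \<open>[1,\<infinity>) \<times> [0,\<infinity>)\<close> are never used.\<close>

type_synonym gauge_fun = "real \<Rightarrow> real \<Rightarrow> real"

definition morse_gauge :: "gauge_fun \<Rightarrow> bool" where
  "morse_gauge N \<longleftrightarrow> (\<forall>L\<ge>1. \<forall>e\<ge>0. N L e \<ge> 0)"

definition morse_quasi_geodesic :: "gauge_fun \<Rightarrow> real set \<Rightarrow> (real \<Rightarrow> 'a::metric_space) \<Rightarrow> bool" where
  "morse_quasi_geodesic N I \<gamma> \<longleftrightarrow> (\<exists>L e. quasi_geodesic L e I \<gamma>) \<and>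
     (\<forall>L e s t \<beta>. s \<le> t \<and> quasi_geodesic L e {s..t} \<beta> \<and> \<beta> s \<in> \<gamma> ` I \<and> \<beta> t \<in> \<gamma> ` I \<longrightarrow>
        (\<forall>u\<in>{s..t}. infdist (\<beta> u) (\<gamma> ` I) \<le> N L e))"

text \<open>For geodesics we follow the convention that the gauge also serves all subgeodesics.\<close>

definition morse_geodesic :: "gauge_fun \<Rightarrow> real set \<Rightarrow> (real \<Rightarrow> 'a::metric_space) \<Rightarrow> bool" where
  "morse_geodesic N I \<gamma> \<longleftrightarrow> geodesic I \<gamma> \<and>
     (\<forall>J. closed_interval J \<and> J \<subseteq> I \<longrightarrow> morse_quasi_geodesic N J \<gamma>)"

definition finite_hausdorff_dist :: "'a::metric_space set \<Rightarrow> 'a set \<Rightarrow> bool" where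
  "finite_hausdorff_dist A B \<longleftrightarrow>
     (\<exists>r. A \<subseteq> (\<Union>b\<in>B. cball b r) \<and> B \<subseteq> (\<Union>a\<in>A. cball a r))"

definition geodesic_ray :: "'a::metric_space \<Rightarrow> (real \<Rightarrow> 'a) \<Rightarrow> bool" where
  "geodesic_ray p \<gamma> \<longleftrightarrow> geodesic {0..} \<gamma> \<and> \<gamma> 0 = p"

definition asymptotic :: "'a::metric_space \<Rightarrow> ((real \<Rightarrow> 'a) \<times> (real \<Rightarrow> 'a)) set" where
  "asymptotic p = {(\<alpha>, \<beta>). geodesic_ray p \<alpha> \<and> geodesic_ray p \<beta> \<and>
     finite_hausdorff_dist (\<alpha> ` {0..}) (\<beta> ` {0..})}"

lemma finite_hausdorff_dist_refl: "finite_hausdorff_dist A A"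
  unfolding finite_hausdorff_dist_def by (rule exI[of _ 0]) auto

lemma finite_hausdorff_dist_sym: "finite_hausdorff_dist A B \<Longrightarrow> finite_hausdorff_dist B A"
  unfolding finite_hausdorff_dist_def by blast

lemma finite_hausdorff_dist_trans:
  assumes "finite_hausdorff_dist A B" "finite_hausdorff_dist B C"
  shows "finite_hausdorff_dist A C"
proof -
  obtain r where r: "A \<subseteq> (\<Union>b\<in>B. cball b r)" "B \<subseteq> (\<Union>a\<in>A. cball a r)"
    using assms(1) unfolding finite_hausdorff_dist_def by blast
  obtain s where s: "B \<subseteq> (\<Union>c\<in>C. cball c s)" "C \<subseteq> (\<Union>b\<in>B. cball b s)"
    using assms(2) unfolding finite_hausdorff_dist_def by blast
  have "\<exists>c\<in>C. dist c a \<le> r + s" if a: "a \<in> A" for a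
  proof -
    obtain b where b: "b \<in> B" "dist b a \<le> r" using r(1) a by (auto simp: subset_iff)
    obtain c where c: "c \<in> C" "dist c b \<le> s" using s(1) b by (auto simp: subset_iff)
    have "dist c a \<le> r + s" using b(2) c(2) dist_triangle[of c a b] by linarith
    then show ?thesis using c(1) by blast
  qed
  moreover have "\<exists>a\<in>A. dist a c \<le> r + s" if c: "c \<in> C" for c
  proof -
    obtain b where b: "b \<in> B" "dist b c \<le> s" using s(2) c by (auto simp: subset_iff)
    obtain a where a: "a \<in> A" "dist a b \<le> r" using r(2) b by (auto simp: subset_iff)
    have "dist a c \<le> r + s" using b(2) a(2) dist_triangle[of a c b] by linarith
    then show ?thesis using a(1) by blast
  qed
  ultimately show ?thesis
    unfolding finite_hausdorff_dist_def by (intro exI[of _ "r + s"]) auto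
qed

lemma equiv_asymptotic: "equiv {\<gamma>. geodesic_ray p \<gamma>} (asymptotic p)"
  by (intro equivI refl_onI symI transI)
    (auto simp: asymptotic_def finite_hausdorff_dist_refl
      intro: finite_hausdorff_dist_sym finite_hausdorff_dist_trans)

type_synonym 'a boundary_point = "(real \<Rightarrow> 'a) set"

definition visual_boundary :: "'a::metric_space \<Rightarrow> 'a boundary_point set" where
  "visual_boundary p = {\<gamma>. geodesic_ray p \<gamma>} // asymptotic p"

definition rays_converge_to :: "(nat \<Rightarrow> real \<Rightarrow> 'a::metric_space) \<Rightarrow> 'a boundary_point \<Rightarrow> bool" where
  "rays_converge_to \<beta> b \<longleftrightarrow>
     (\<forall>r. strict_mono (r :: nat \<Rightarrow> nat) \<longrightarrow> (\<exists>s \<gamma>. strict_mono (s :: nat \<Rightarrow> nat) \<and> \<gamma> \<in> b \<and>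
        (\<forall>C. compact C \<and> C \<subseteq> {0..} \<longrightarrow> uniform_limit C (\<lambda>n. \<beta> (r (s n))) \<gamma> sequentially)))"

definition visual_closed :: "'a::metric_space \<Rightarrow> 'a boundary_point set \<Rightarrow> bool" where
  "visual_closed p B \<longleftrightarrow> B \<subseteq> visual_boundary p \<and>
     (\<forall>bs \<beta> b. (\<forall>n. bs n \<in> B \<and> \<beta> n \<in> bs n) \<and> b \<in> visual_boundary p \<and> rays_converge_to \<beta> b
        \<longrightarrow> b \<in> B)"

definition visual_topology :: "'a::metric_space \<Rightarrow> 'a boundary_point topology" where
  "visual_topology p =
     topology (\<lambda>U. U \<subseteq> visual_boundary p \<and> visual_closed p (visual_boundary p - U))"

lemma rays_converge_to_subseq:
  assumes "rays_converge_to \<beta> b" "strict_mono q"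
  shows "rays_converge_to (\<beta> \<circ> q) b"
  unfolding rays_converge_to_def
proof (intro allI impI)
  fix r :: "nat \<Rightarrow> nat" assume "strict_mono r"
  then have "strict_mono (q \<circ> r)" using assms(2) by (simp add: strict_mono_o)
  from assms(1)[unfolded rays_converge_to_def, rule_format, OF this]
  show "\<exists>s \<gamma>. strict_mono (s :: nat \<Rightarrow> nat) \<and> \<gamma> \<in> b \<and> (\<forall>C. compact C \<and> C \<subseteq> {0..} \<longrightarrow>
      uniform_limit C (\<lambda>n. (\<beta> \<circ> q) (r (s n))) \<gamma> sequentially)"
    by simp
qed

lemma visual_closedD:
  assumes "visual_closed p B" "\<And>n. bs n \<in> B" "\<And>n. \<beta> n \<in> bs n" "b \<in> visual_boundary p"
    "rays_converge_to \<beta> b"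
  shows "b \<in> B"
  using assms unfolding visual_closed_def by blast

lemma visual_closed_Un:
  assumes "visual_closed p B" "visual_closed p C"
  shows "visual_closed p (B \<union> C)"
  unfolding visual_closed_def
proof (intro conjI allI impI)
  show "B \<union> C \<subseteq> visual_boundary p"
    using assms unfolding visual_closed_def by blast
next
  fix bs \<beta> b
  assume A: "(\<forall>n. bs n \<in> B \<union> C \<and> \<beta> n \<in> bs n) \<and> b \<in> visual_boundary p \<and> rays_converge_to \<beta> b"
  have sub: "b \<in> D" if D: "visual_closed p D" and inf: "infinite {n. bs n \<in> D}" for D
  proof -
    obtain q :: "nat \<Rightarrow> nat" where q: "strict_mono q" "\<And>n. q n \<in> {n. bs n \<in> D}"
      using infinite_enumerate[OF inf] by auto
    show ?thesis
    proof (rule visual_closedD[OF D])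
      show "bs (q n) \<in> D" for n using q(2)[of n] by simp
      show "(\<beta> \<circ> q) n \<in> bs (q n)" for n using A by simp
      show "b \<in> visual_boundary p" using A by simp
      show "rays_converge_to (\<beta> \<circ> q) b" using A q(1) by (simp add: rays_converge_to_subseq)
    qed
  qed
  have "{n. bs n \<in> B} \<union> {n. bs n \<in> C} = UNIV" using A by auto
  then have "infinite {n. bs n \<in> B} \<or> infinite {n. bs n \<in> C}"
    by (metis finite_UnI infinite_UNIV_nat)
  then show "b \<in> B \<union> C" using sub[OF assms(1)] sub[OF assms(2)] by blast
qed

lemma visual_closed_Diff_Union:
  assumes "\<And>U. U \<in> \<U> \<Longrightarrow> visual_closed p (visual_boundary p - U)"
  shows "visual_closed p (visual_boundary p - \<Union>\<U>)"
  unfolding visual_closed_def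
proof (intro conjI allI impI)
  show "visual_boundary p - \<Union>\<U> \<subseteq> visual_boundary p" by (rule Diff_subset)
  fix bs \<beta> b
  assume A: "(\<forall>n. bs n \<in> visual_boundary p - \<Union>\<U> \<and> \<beta> n \<in> bs n) \<and> b \<in> visual_boundary p \<and>
    rays_converge_to \<beta> b"
  have "b \<in> visual_boundary p - U" if U: "U \<in> \<U>" for U
  proof (rule visual_closedD[OF assms[OF U]])
    show "bs n \<in> visual_boundary p - U" for n using A U by auto
  qed (use A in auto)
  then show "b \<in> visual_boundary p - \<Union>\<U>" using A by auto
qed

lemma istopology_visual:
  "istopology (\<lambda>U. U \<subseteq> visual_boundary p \<and> visual_closed p (visual_boundary p - U))"
  unfolding istopology_def
  by (auto simp: Diff_Int intro: visual_closed_Un visual_closed_Diff_Union)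

lemma topspace_visual: "topspace (visual_topology p) = visual_boundary p"
proof (rule antisym)
  show "topspace (visual_topology p) \<subseteq> visual_boundary p"
    using openin_topspace[of "visual_topology p"]
    unfolding visual_topology_def topology_inverse'[OF istopology_visual] by blast
  have "visual_closed p {}" by (simp add: visual_closed_def)
  then have "openin (visual_topology p) (visual_boundary p)"
    unfolding visual_topology_def topology_inverse'[OF istopology_visual] by simp
  then show "visual_boundary p \<subseteq> topspace (visual_topology p)" by (rule openin_subset)
qed

definition morse_stratum :: "'a::metric_space \<Rightarrow> gauge_fun \<Rightarrow> 'a boundary_point set" where
  "morse_stratum p N = {b \<in> visual_boundary p. \<exists>\<gamma>\<in>b. morse_geodesic N {0..} \<gamma>}"

definition morse_boundary :: "'a::metric_space \<Rightarrow> 'a boundary_point set" where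
  "morse_boundary p = (\<Union>N\<in>Collect morse_gauge. morse_stratum p N)"

definition morse_topology :: "'a::metric_space \<Rightarrow> 'a boundary_point topology" where
  "morse_topology p = topology (\<lambda>U. U \<subseteq> morse_boundary p \<and>
     (\<forall>N. morse_gauge N \<longrightarrow>
        openin (subtopology (visual_topology p) (morse_stratum p N)) (U \<inter> morse_stratum p N)))"

lemma istopology_morse:
  "istopology (\<lambda>U. U \<subseteq> morse_boundary p \<and> (\<forall>N. morse_gauge N \<longrightarrow>
     openin (subtopology (visual_topology p) (morse_stratum p N)) (U \<inter> morse_stratum p N)))"
  unfolding istopology_def
proof (intro conjI allI impI)
  fix S T N
  assume S: "S \<subseteq> morse_boundary p \<and> (\<forall>N. morse_gauge N \<longrightarrow>
     openin (subtopology (visual_topology p) (morse_stratum p N)) (S \<inter> morse_stratum p N))"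
    and T: "T \<subseteq> morse_boundary p \<and> (\<forall>N. morse_gauge N \<longrightarrow>
     openin (subtopology (visual_topology p) (morse_stratum p N)) (T \<inter> morse_stratum p N))"
  show "S \<inter> T \<subseteq> morse_boundary p" using S by blast
  assume "morse_gauge N"
  then have "openin (subtopology (visual_topology p) (morse_stratum p N))
      ((S \<inter> morse_stratum p N) \<inter> (T \<inter> morse_stratum p N))"
    using S T by blast
  moreover have "(S \<inter> morse_stratum p N) \<inter> (T \<inter> morse_stratum p N) = S \<inter> T \<inter> morse_stratum p N"
    by blast
  ultimately show "openin (subtopology (visual_topology p) (morse_stratum p N))
      (S \<inter> T \<inter> morse_stratum p N)" by simp
next
  fix \<K> :: "'a boundary_point set set" and N
  assume K: "\<forall>K\<in>\<K>. K \<subseteq> morse_boundary p \<and> (\<forall>N. morse_gauge N \<longrightarrow>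
     openin (subtopology (visual_topology p) (morse_stratum p N)) (K \<inter> morse_stratum p N))"
  then show "\<Union>\<K> \<subseteq> morse_boundary p" by blast
  assume "morse_gauge N"
  then have "openin (subtopology (visual_topology p) (morse_stratum p N))
      (\<Union>K\<in>\<K>. K \<inter> morse_stratum p N)"
    using K by blast
  moreover have "(\<Union>K\<in>\<K>. K \<inter> morse_stratum p N) = \<Union>\<K> \<inter> morse_stratum p N" by blast
  ultimately show "openin (subtopology (visual_topology p) (morse_stratum p N))
      (\<Union>\<K> \<inter> morse_stratum p N)" by (rule subst[rotated])
qed

lemma topspace_morse: "topspace (morse_topology p) = morse_boundary p"
proof (rule antisym)
  show "topspace (morse_topology p) \<subseteq> morse_boundary p"
    using openin_topspace[of "morse_topology p"]
    unfolding morse_topology_def topology_inverse'[OF istopology_morse] by blast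
  have "openin (subtopology (visual_topology p) (morse_stratum p N))
      (morse_boundary p \<inter> morse_stratum p N)" if "morse_gauge N" for N
  proof -
    have "morse_boundary p \<inter> morse_stratum p N = morse_stratum p N"
      using that by (auto simp: morse_boundary_def)
    moreover have "morse_stratum p N \<subseteq> visual_boundary p"
      by (auto simp: morse_stratum_def)
    ultimately show ?thesis
      by (metis openin_topspace topspace_subtopology_subset topspace_visual)
  qed
  then have "openin (morse_topology p) (morse_boundary p)"
    unfolding morse_topology_def topology_inverse'[OF istopology_morse] by simp
  then show "morse_boundary p \<subseteq> topspace (morse_topology p)" by (rule openin_subset)
qed

text \<open>The induced map on boundaries, with basepoint \<open>q\<close> in the target: \<open>[\<gamma>]\<close> goes to the class of rays
  at finite Hausdorff distance from \<open>f(\<gamma>)\<close>.\<close>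

definition induced_map ::
    "'b::metric_space \<Rightarrow> ('a \<Rightarrow> 'b) \<Rightarrow> 'a boundary_point \<Rightarrow> 'b boundary_point" where
  "induced_map q f b = {\<delta>. geodesic_ray q \<delta> \<and>
     (\<exists>\<gamma>\<in>b. finite_hausdorff_dist (\<delta> ` {0..}) (f ` \<gamma> ` {0..}))}"

datatype 'a vertex = Inner 'a | Ideal "'a boundary_point"

fun geodesic_between ::
    "'a::metric_space vertex \<Rightarrow> 'a vertex \<Rightarrow> real set \<Rightarrow> (real \<Rightarrow> 'a) \<Rightarrow> bool" where
  "geodesic_between (Inner x) (Inner y) I \<gamma> \<longleftrightarrow> geodesic I \<gamma> \<and>
     (\<exists>s t. s \<le> t \<and> I = {s..t} \<and> \<gamma> s = x \<and> \<gamma> t = y)"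
| "geodesic_between (Inner x) (Ideal b) I \<gamma> \<longleftrightarrow> geodesic I \<gamma> \<and>
     (\<exists>s. I = {s..} \<and> \<gamma> s = x) \<and> (\<exists>\<beta>\<in>b. finite_hausdorff_dist (\<gamma> ` I) (\<beta> ` {0..}))"
| "geodesic_between (Ideal a) (Inner y) I \<gamma> \<longleftrightarrow> geodesic I \<gamma> \<and>
     (\<exists>t. I = {..t} \<and> \<gamma> t = y) \<and> (\<exists>\<alpha>\<in>a. finite_hausdorff_dist (\<gamma> ` I) (\<alpha> ` {0..}))"
| "geodesic_between (Ideal a) (Ideal b) I \<gamma> \<longleftrightarrow> geodesic I \<gamma> \<and> I = UNIV \<and>
     (\<exists>\<alpha>\<in>a. finite_hausdorff_dist (\<gamma> ` {..0}) (\<alpha> ` {0..})) \<and>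
     (\<exists>\<beta>\<in>b. finite_hausdorff_dist (\<gamma> ` {0..}) (\<beta> ` {0..}))"

type_synonym 'a side = "real set \<times> (real \<Rightarrow> 'a)"

definition side_image :: "'a side \<Rightarrow> 'a set" where
  "side_image \<sigma> = snd \<sigma> ` fst \<sigma>"

definition geodesic_triangle :: "'a::metric_space vertex \<Rightarrow> 'a vertex \<Rightarrow> 'a vertex \<Rightarrow>
    'a side \<Rightarrow> 'a side \<Rightarrow> 'a side \<Rightarrow> bool" where
  "geodesic_triangle u v w \<sigma>\<^sub>1 \<sigma>\<^sub>2 \<sigma>\<^sub>3 \<longleftrightarrow>
     geodesic_between u v (fst \<sigma>\<^sub>1) (snd \<sigma>\<^sub>1) \<and>
     geodesic_between v w (fst \<sigma>\<^sub>2) (snd \<sigma>\<^sub>2) \<and>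
     geodesic_between w u (fst \<sigma>\<^sub>3) (snd \<sigma>\<^sub>3)"

definition vertices :: "'a::metric_space \<Rightarrow> 'a vertex set" where
  "vertices p = range Inner \<union> Ideal ` morse_boundary p"

text \<open>The defining property of the constants \<open>K\<^sub>N\<close>, for one space with basepoint \<open>p\<close>.\<close>

definition center_constants :: "'a::metric_space \<Rightarrow> (gauge_fun \<Rightarrow> real) \<Rightarrow> bool" where
  "center_constants p K \<longleftrightarrow> (\<forall>N. morse_gauge N \<longrightarrow> K N > 0 \<and>
     (\<forall>u\<in>vertices p. \<forall>v\<in>vertices p. \<forall>w\<in>vertices p. \<forall>\<sigma>\<^sub>1 \<sigma>\<^sub>2 \<sigma>\<^sub>3.
        geodesic_triangle u v w \<sigma>\<^sub>1 \<sigma>\<^sub>2 \<sigma>\<^sub>3 \<and>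
        (\<forall>\<sigma>\<in>{\<sigma>\<^sub>1, \<sigma>\<^sub>2, \<sigma>\<^sub>3}. morse_geodesic N (fst \<sigma>) (snd \<sigma>)) \<longrightarrow>
        (\<exists>x\<in>side_image \<sigma>\<^sub>1. \<exists>y\<in>side_image \<sigma>\<^sub>2. \<exists>z\<in>side_image \<sigma>\<^sub>3.
           dist x y \<le> K N \<and> dist y z \<le> K N \<and> dist x z \<le> K N)))"

definition boundary_tuples ::
    "'a::metric_space \<Rightarrow> nat \<Rightarrow> gauge_fun \<Rightarrow> 'a boundary_point list set" where
  "boundary_tuples p n N = {xs. length xs = n \<and> distinct xs \<and> set xs \<subseteq> morse_boundary p \<and>
     (\<forall>a\<in>set xs. \<forall>b\<in>set xs. a \<noteq> b \<longrightarrow>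
        (\<forall>I \<gamma>. geodesic_between (Ideal a) (Ideal b) I \<gamma> \<longrightarrow> morse_geodesic N I \<gamma>))}"

text \<open>In \<open>m\<^sup>N\<^sup>,\<^sup>K(a,b,c)\<close> the gauge only restricts the triples considered, so it is not an
  argument here.\<close>

definition centers :: "real \<Rightarrow> 'a::metric_space boundary_point \<Rightarrow> 'a boundary_point \<Rightarrow>
    'a boundary_point \<Rightarrow> 'a set" where
  "centers k a b c = {x. \<exists>\<sigma>\<^sub>1 \<sigma>\<^sub>2 \<sigma>\<^sub>3. geodesic_triangle (Ideal a) (Ideal b) (Ideal c) \<sigma>\<^sub>1 \<sigma>\<^sub>2 \<sigma>\<^sub>3 \<and>
     (\<forall>\<sigma>\<in>{\<sigma>\<^sub>1, \<sigma>\<^sub>2, \<sigma>\<^sub>3}. infdist x (side_image \<sigma>) \<le> k)}"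

definition cross_ratio :: "(gauge_fun \<Rightarrow> real) \<Rightarrow> gauge_fun \<Rightarrow> 'a::metric_space boundary_point \<Rightarrow>
    'a boundary_point \<Rightarrow> 'a boundary_point \<Rightarrow> 'a boundary_point \<Rightarrow> real" where
  "cross_ratio K N a b c d = diameter (centers (K N) a b c \<union> centers (K N) a d c)"

definition two_stable :: "'a::metric_space \<Rightarrow> 'b::metric_space \<Rightarrow>
    ('a boundary_point \<Rightarrow> 'b boundary_point) \<Rightarrow> bool" where
  "two_stable p q h \<longleftrightarrow> (\<forall>N. morse_gauge N \<longrightarrow> (\<exists>N'. morse_gauge N' \<and>
     map h ` boundary_tuples p 2 N \<subseteq> boundary_tuples q 2 N'))"

definition quasi_moebius :: "'a::metric_space \<Rightarrow> 'b::metric_space \<Rightarrow> (gauge_fun \<Rightarrow> real) \<Rightarrow>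
    ('a boundary_point \<Rightarrow> 'b boundary_point) \<Rightarrow> bool" where
  "quasi_moebius p q K h \<longleftrightarrow> two_stable p q h \<and>
     (\<forall>N N'. morse_gauge N \<and> morse_gauge N' \<and>
        map h ` boundary_tuples p 2 N \<subseteq> boundary_tuples q 2 N' \<longrightarrow>
        (\<exists>\<psi>. continuous_on {0..} \<psi> \<and> strict_mono_on {0..} \<psi> \<and> \<psi> ` {0..} \<subseteq> {0..} \<and>
           (\<forall>a b c d. [a, b, c, d] \<in> boundary_tuples p 4 N \<longrightarrow>
              cross_ratio K N' (h a) (h b) (h c) (h d) \<le> \<psi> (cross_ratio K N a b c d))))"

end

(* Quasi-geodesics may be discontinuous, so two soft facts carry the geometry: endpoints can be moved
   at the cost of the additive constant, and a (L,e)-quasi-geodesic followed by a shortest connection is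
   a quasi-geodesic whose constants depend on L and e only. Appending far-away shortest connections shows
   that a quasi-geodesic ray or line at some finite distance from a Morse geodesic is at a uniform
   distance from it. For a quasi-inverse g of f this compares g of a geodesic in Y with a Morse geodesic
   in X having the corresponding ends, with constants depending on the gauge only; this transfers
   Morseness (2-stability) and sends centers in Y to coarse centers in X. Coarse centers of an ideal
   triangle with N-Morse sides are uniformly close and exist by the choice of K, so cross-ratios are
   distorted at most affinely. Continuity is sequential: limits of images of uniformly Morse rays are
   computed by an Arzela-Ascoli argument, and every stratum lies in a closed one. The inverse
   is the map induced by g. *)

theory Submission
  imports Defs "HOL-Library.Diagonal_Subsequence"
begin

section \<open>Neighbourhoods and quasi-geodesics\<close>

text \<open>The definitions supply only finite Hausdorff distances without control, whereas
  2-stability and cross-ratios need bounds depending on the gauge. Each uncontrolled distance is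
  therefore used once, to decide how far out to go, and is absent from the resulting bound. All
  comparison is done in the space where the Morse property is known: paths of the other space are
  pushed there by \<open>g\<close>, and the conclusion is pulled back with the lower bound for
  \<open>g\<close>. Three obstacles explain the shape of the constants. Infima of distances need not
  be attained, whence the many \<open>+ 1\<close>. Crossing arguments need a coarse intermediate
  value theorem, at the price \<open>L + E\<close>. Gauges are arbitrary functions, without
  monotonicity or continuity, so passing to subgeodesics and passing to limits each require a new
  gauge. The hypotheses on \<open>f\<close> and \<open>g\<close> are made symmetric, with common
  constants, so that every result also holds with the two spaces exchanged.\<close>

definition thick :: "real \<Rightarrow> 'a::metric_space set \<Rightarrow> 'a set" where
  "thick r S = (\<Union>x\<in>S. cball x r)"

lemma mem_thick: "x \<in> thick r S \<longleftrightarrow> (\<exists>y\<in>S. dist x y \<le> r)"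
  by (auto simp: thick_def dist_commute)

lemma thickI: "y \<in> S \<Longrightarrow> dist x y \<le> r \<Longrightarrow> x \<in> thick r S"
  by (auto simp: mem_thick)

lemma thick_mono: "r \<le> s \<Longrightarrow> A \<subseteq> B \<Longrightarrow> thick r A \<subseteq> thick s B"
  by (force simp: mem_thick)

lemma thick_trans: "A \<subseteq> thick s B \<Longrightarrow> thick r A \<subseteq> thick (r + s) B"
proof
  fix x assume A: "A \<subseteq> thick s B" and "x \<in> thick r A"
  then obtain a where a: "a \<in> A" "dist x a \<le> r" by (auto simp: mem_thick)
  with A obtain b where b: "b \<in> B" "dist a b \<le> s" by (auto simp: mem_thick subset_iff)
  show "x \<in> thick (r + s) B"
    by (rule thickI[OF b(1)]) (use a b dist_triangle[of x b a] in linarith)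
qed

lemma thick_close: "x \<in> thick r S \<Longrightarrow> dist y x \<le> s \<Longrightarrow> y \<in> thick (r + s) S"
  using thick_trans[of "{x}" r S s] by (auto simp: mem_thick add.commute)

text \<open>The infimum need not be attained, so only a strictly larger radius is sure to have a
  witness. This is the source of the later \<open>+ 1\<close>.\<close>

lemma thick_infdist:
  assumes "infdist x S \<le> r" "S \<noteq> {}" "r < s"
  shows "x \<in> thick s S"
proof (rule ccontr)
  assume "x \<notin> thick s S"
  then have "\<And>y. y \<in> S \<Longrightarrow> s \<le> dist x y" by (force simp: mem_thick)
  then have "s \<le> infdist x S"
    using assms(2) by (auto simp: infdist_def intro: cINF_greatest)
  with assms show False by linarith
qed

lemma finite_hausdorff_dist_thick:
  "finite_hausdorff_dist A B \<longleftrightarrow> (\<exists>r. A \<subseteq> thick r B \<and> B \<subseteq> thick r A)"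
  by (simp add: finite_hausdorff_dist_def thick_def)

lemma finite_hausdorff_distI:
  assumes "A \<subseteq> thick r B" "B \<subseteq> thick s A"
  shows "finite_hausdorff_dist A B"
  unfolding finite_hausdorff_dist_thick
  using assms thick_mono[of r "max r s" B B] thick_mono[of s "max r s" A A]
  by (intro exI[of _ "max r s"]) auto

section \<open>Quasi-isometric embeddings and their constants\<close>

lemma qi_embedding_onI:
  assumes "L \<ge> 1" "e \<ge> 0"
    and "\<And>x y. x \<in> A \<Longrightarrow> y \<in> A \<Longrightarrow> dist x y \<le> L * (dist (f x) (f y) + e)"
    and "\<And>x y. x \<in> A \<Longrightarrow> y \<in> A \<Longrightarrow> dist (f x) (f y) \<le> L * dist x y + e"
  shows "qi_embedding_on L e A f"
  unfolding qi_embedding_on_def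
proof (intro conjI ballI)
  fix x y assume "x \<in> A" "y \<in> A"
  with assms(1) assms(3)[of x y] show "1 / L * dist x y - e \<le> dist (f x) (f y)"
    by (simp add: field_simps)
qed (use assms in auto)

text \<open>The lower bound is kept multiplied out by \<open>L\<close>, which frees all later
  estimates from division.\<close>

lemma qi_embedding_onD:
  assumes "qi_embedding_on L e A f"
  shows "L \<ge> 1" "e \<ge> 0"
    and "x \<in> A \<Longrightarrow> y \<in> A \<Longrightarrow> dist x y \<le> L * (dist (f x) (f y) + e)"
    and "x \<in> A \<Longrightarrow> y \<in> A \<Longrightarrow> dist (f x) (f y) \<le> L * dist x y + e"
proof -
  show L: "L \<ge> 1" and "e \<ge> 0" using assms by (auto simp: qi_embedding_on_def)
  show "x \<in> A \<Longrightarrow> y \<in> A \<Longrightarrow> dist (f x) (f y) \<le> L * dist x y + e"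
    using assms by (auto simp: qi_embedding_on_def)
  show "dist x y \<le> L * (dist (f x) (f y) + e)" if "x \<in> A" "y \<in> A"
  proof -
    have "1 / L * dist x y - e \<le> dist (f x) (f y)"
      using assms that by (auto simp: qi_embedding_on_def)
    then show ?thesis using L by (simp add: field_simps)
  qed
qed

lemma qi_embedding_on_subset: "qi_embedding_on L e A f \<Longrightarrow> B \<subseteq> A \<Longrightarrow> qi_embedding_on L e B f"
  by (auto simp: qi_embedding_on_def)

lemma qi_embedding_on_weaken:
  assumes "qi_embedding_on L e A f" "L \<le> L'" "e \<le> e'"
  shows "qi_embedding_on L' e' A f"
proof (rule qi_embedding_onI)
  note D = qi_embedding_onD[OF assms(1)]
  show "L' \<ge> 1" "e' \<ge> 0" using D(1,2) assms by auto
  fix x y assume xy: "x \<in> A" "y \<in> A"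
  have "L * (dist (f x) (f y) + e) \<le> L' * (dist (f x) (f y) + e')"
    using D(1,2) assms by (intro mult_mono) auto
  then show "dist x y \<le> L' * (dist (f x) (f y) + e')" using D(3)[OF xy] by linarith
  have "L * dist x y + e \<le> L' * dist x y + e'"
    using assms by (intro add_mono mult_right_mono) auto
  then show "dist (f x) (f y) \<le> L' * dist x y + e'" using D(4)[OF xy] by linarith
qed

text \<open>Each distance changes by at most \<open>2 * c\<close>. No continuity is involved, so
  single values such as endpoints may be moved alone.\<close>

lemma qi_embedding_on_perturb:
  assumes "qi_embedding_on L e A f" "c \<ge> 0" "\<And>x. x \<in> A \<Longrightarrow> dist (f x) (g x) \<le> c"
  shows "qi_embedding_on L (e + 2 * c) A g"
proof (rule qi_embedding_onI)
  note D = qi_embedding_onD[OF assms(1)]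
  show "L \<ge> 1" "e + 2 * c \<ge> 0" using D(1,2) assms by auto
  fix x y assume xy: "x \<in> A" "y \<in> A"
  have c: "\<bar>dist (f x) (f y) - dist (g x) (g y)\<bar> \<le> 2 * c"
    using assms(3)[OF xy(1)] assms(3)[OF xy(2)]
      dist_triangle[of "f x" "f y" "g x"] dist_triangle[of "g x" "f y" "g y"]
      dist_triangle[of "g x" "g y" "f x"] dist_triangle[of "f x" "g y" "f y"]
    by (simp add: dist_commute)
  have "L * (dist (f x) (f y) + e) \<le> L * (dist (g x) (g y) + (e + 2 * c))"
    using c D(1) by (intro mult_left_mono) auto
  then show "dist x y \<le> L * (dist (g x) (g y) + (e + 2 * c))" using D(3)[OF xy] by linarith
  show "dist (g x) (g y) \<le> L * dist x y + (e + 2 * c)" using c D(4)[OF xy] by linarith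
qed

lemma qi_embedding_on_comp:
  assumes "qi_embedding_on L e A f" "qi_embedding_on L' e' UNIV g"
  shows "qi_embedding_on (L' * L) (L' * e + e') A (\<lambda>x. g (f x))"
proof (rule qi_embedding_onI)
  note D = qi_embedding_onD[OF assms(1)]
  note D' = qi_embedding_onD[OF assms(2)]
  show "L' * L \<ge> 1" using D(1) D'(1) mult_mono[of 1 L' 1 L] by simp
  show "L' * e + e' \<ge> 0" using D(2) D'(1,2) by simp
  fix x y assume xy: "x \<in> A" "y \<in> A"
  let ?d = "dist (g (f x)) (g (f y))"
  have "e \<le> L' * (L' * e)"
    using D(2) D'(1) mult_mono[of 1 "L' * L'" e e] mult_mono[of 1 L' 1 L'] by (simp add: algebra_simps)
  then have "dist (f x) (f y) + e \<le> L' * (?d + (L' * e + e'))"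
    using D'(3)[of "f x" "f y"] by (simp add: algebra_simps)
  then have "L * (dist (f x) (f y) + e) \<le> L * (L' * (?d + (L' * e + e')))"
    using D(1) by (intro mult_left_mono) auto
  then show "dist x y \<le> L' * L * (?d + (L' * e + e'))"
    using D(3)[OF xy] by (simp add: algebra_simps)
  have "L' * dist (f x) (f y) \<le> L' * (L * dist x y + e)"
    using D(4)[OF xy] D'(1) by (intro mult_left_mono) auto
  then show "?d \<le> L' * L * dist x y + (L' * e + e')"
    using D'(4)[of "f x" "f y"] by (simp add: algebra_simps)
qed

section \<open>Intervals, geodesics and concatenation\<close>

lemma closed_interval_simps [simp]:
  "closed_interval {s..t::real} \<longleftrightarrow> s \<le> t" "closed_interval {s::real..}" "closed_interval {..t::real}"
  "closed_interval (UNIV :: real set)"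
  by (auto simp: closed_interval_def is_interval_1)

lemma geodesic_quasi_geodesic: "geodesic I \<gamma> \<Longrightarrow> quasi_geodesic 1 0 I \<gamma>"
  by (auto simp: geodesic_def quasi_geodesic_def qi_embedding_on_def dist_real_def)

lemma geodesicD: "geodesic I \<gamma> \<Longrightarrow> s \<in> I \<Longrightarrow> t \<in> I \<Longrightarrow> dist (\<gamma> s) (\<gamma> t) = \<bar>s - t\<bar>"
  by (simp add: geodesic_def)

lemma geodesic_subset: "geodesic I \<gamma> \<Longrightarrow> closed_interval J \<Longrightarrow> J \<subseteq> I \<Longrightarrow> geodesic J \<gamma>"
  by (auto simp: geodesic_def)

lemma quasi_geodesic_subset:
  "quasi_geodesic L e I \<gamma> \<Longrightarrow> closed_interval J \<Longrightarrow> J \<subseteq> I \<Longrightarrow> quasi_geodesic L e J \<gamma>"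
  by (auto simp: quasi_geodesic_def intro: qi_embedding_on_subset)

lemma quasi_geodesic_reverse:
  assumes "quasi_geodesic L e {s..t} \<beta>"
  shows "quasi_geodesic L e {-t..-s} (\<lambda>u. \<beta> (-u))"
proof -
  have "qi_embedding_on L e {-t..-s} (\<lambda>u. \<beta> (-u))"
  proof (rule qi_embedding_onI)
    note D = qi_embedding_onD[OF conjunct2[OF assms[unfolded quasi_geodesic_def]]]
    show "L \<ge> 1" "e \<ge> 0" by (rule D)+
    fix x y assume "x \<in> {-t..-s}" "y \<in> {-t..-s}"
    then show "dist x y \<le> L * (dist (\<beta> (-x)) (\<beta> (-y)) + e)" "dist (\<beta> (-x)) (\<beta> (-y)) \<le> L * dist x y + e"
      using D(3,4)[of "-x" "-y"] by (auto simp: dist_minus)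
  qed
  then show ?thesis using assms by (simp add: quasi_geodesic_def)
qed

text \<open>Up to 1, \<open>\<beta> t\<close> is the point of \<beta> closest to
  \<open>\<eta> l\<close>. Hence a point \<open>z\<close> of \<eta> at distance \<open>r\<close>
  from \<open>\<beta> t\<close> satisfies \<open>r \<le> d + 1\<close>, where \<open>d\<close> is
  its distance to any \<open>\<beta> x\<close>; then \<open>\<beta> x\<close> is within
  \<open>2 * d + 1\<close> of \<open>\<beta> t\<close>, so
  \<open>t - x \<le> L * (2 * d + 1 + e)\<close>. Adding the two estimates gives both new
  constants.\<close>

lemma quasi_geodesic_append:
  assumes qg: "quasi_geodesic L e {s..t} \<beta>"
    and \<eta>: "geodesic {0..l} \<eta>" "\<eta> 0 = \<beta> t"
    and near: "\<And>u. u \<in> {s..t} \<Longrightarrow> dist (\<eta> l) (\<beta> t) \<le> dist (\<eta> l) (\<beta> u) + 1"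
  shows "quasi_geodesic (2 * L + 1) (L * (1 + e) + 1) {s..t + l}
    (\<lambda>u. if u \<le> t then \<beta> u else \<eta> (u - t))"
proof -
  have st: "s \<le> t" and l: "0 \<le> l"
    using qg \<eta>(1) by (auto simp: quasi_geodesic_def geodesic_def)
  note D = qi_embedding_onD[OF conjunct2[OF qg[unfolded quasi_geodesic_def]]]
  let ?L = "2 * L + 1" and ?e = "L * (1 + e) + 1"
  let ?\<omega> = "\<lambda>u. if u \<le> t then \<beta> u else \<eta> (u - t)"
  have e1: "?e \<ge> e" and e0: "?e \<ge> 0" and L1: "?L \<ge> L" "?L \<ge> 1"
    using D(1,2) mult_mono[of 1 L e e] by (auto simp: algebra_simps)
  have eL: "?L * ?e \<ge> ?e" using mult_right_mono[OF L1(2) e0] by simp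
  have main: "\<bar>x - y\<bar> \<le> ?L * (dist (?\<omega> x) (?\<omega> y) + ?e) \<and> dist (?\<omega> x) (?\<omega> y) \<le> ?L * \<bar>x - y\<bar> + ?e"
    if xy: "x \<le> y" "x \<in> {s..t + l}" "y \<in> {s..t + l}" for x y
  proof -
    consider "y \<le> t" | "t < x" | "x \<le> t" "t < y" by linarith
    then show ?thesis
    proof cases
      case 1
      have "qi_embedding_on ?L ?e {s..t} \<beta>"
        using qg L1 e1 by (auto simp: quasi_geodesic_def intro: qi_embedding_on_weaken)
      from qi_embedding_onD(3,4)[OF this, of x y] show ?thesis
        using 1 xy by (simp add: dist_real_def)
    next
      case 2
      then have "dist (?\<omega> x) (?\<omega> y) = \<bar>x - y\<bar>"
        using xy by (simp add: geodesicD[OF \<eta>(1)])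
      moreover have "\<bar>x - y\<bar> * 1 \<le> \<bar>x - y\<bar> * ?L" by (rule mult_left_mono) (use L1 in auto)
      ultimately show ?thesis using eL e0 by (simp add: algebra_simps)
    next
      case 3
      let ?z = "\<eta> (y - t)"
      let ?d = "dist (\<beta> x) ?z"
      have z0: "dist (\<beta> t) ?z = y - t" and zl: "dist ?z (\<eta> l) = l - (y - t)" and tl: "dist (\<eta> l) (\<beta> t) = l"
        using 3 xy l geodesicD[OF \<eta>(1), of 0 "y - t"] geodesicD[OF \<eta>(1), of "y - t" l]
          geodesicD[OF \<eta>(1), of l 0] by (auto simp: \<eta>(2))
      have "y - t \<le> ?d + 1"
        using near[of x] dist_triangle[of "\<eta> l" "\<beta> x" ?z] 3 xy tl zl by (simp add: dist_commute)
      moreover have "dist (\<beta> x) (\<beta> t) \<le> ?d + (y - t)"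
        using dist_triangle[of "\<beta> x" "\<beta> t" ?z] z0 by (simp add: dist_commute)
      ultimately have "dist (\<beta> x) (\<beta> t) + e \<le> 2 * ?d + 1 + e" by linarith
      then have "L * (dist (\<beta> x) (\<beta> t) + e) \<le> L * (2 * ?d + 1 + e)"
        using D(1) by (intro mult_left_mono) auto
      then have "t - x \<le> L * (2 * ?d + 1 + e)"
        using D(3)[of x t] 3 xy by (simp add: dist_real_def)
      then have A: "y - x \<le> ?L * ?d + ?e" using \<open>y - t \<le> ?d + 1\<close> by (simp add: algebra_simps)
      have "?d \<le> L * (t - x) + e + (y - t)"
        using D(4)[of x t] 3 xy dist_triangle[of "\<beta> x" ?z "\<beta> t"] z0 by (simp add: dist_real_def)
      also have "\<dots> \<le> L * (t - x) + L * (y - t) + e"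
        using D(1) 3 mult_right_mono[of 1 L "y - t"] by simp
      also have "\<dots> = L * (y - x) + e" by (simp add: algebra_simps)
      also have "\<dots> \<le> ?L * (y - x) + ?e" using e1 L1 xy by (intro add_mono mult_right_mono) auto
      finally show ?thesis using A eL 3 xy by (simp add: distrib_left)
    qed
  qed
  have "qi_embedding_on ?L ?e {s..t + l} ?\<omega>"
  proof (rule qi_embedding_onI[OF L1(2) e0])
    fix x y assume xy: "x \<in> {s..t + l}" "y \<in> {s..t + l}"
    have "dist x y \<le> ?L * (dist (?\<omega> x) (?\<omega> y) + ?e) \<and> dist (?\<omega> x) (?\<omega> y) \<le> ?L * dist x y + ?e"
    proof (cases "x \<le> y")
      case True
      from main[OF this xy] show ?thesis unfolding dist_real_def .
    next
      case False
      then have "y \<le> x" by simp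
      from main[OF this xy(2,1)] show ?thesis
        unfolding dist_real_def dist_commute[of "?\<omega> x"] abs_minus_commute[of x] .
    qed
    then show "dist x y \<le> ?L * (dist (?\<omega> x) (?\<omega> y) + ?e)" "dist (?\<omega> x) (?\<omega> y) \<le> ?L * dist x y + ?e"
      by blast+
  qed
  then show ?thesis using st l by (simp add: quasi_geodesic_def)
qed

text \<open>Around the supremum of the points where \<rho> is at most \<open>m\<close> there are two
  points at distance at most 1 between whose values \<open>m\<close> lies; \<rho> varies by at most
  \<open>L + E\<close> between them. Decreasing crossings follow by negation.\<close>

lemma coarse_ivt:
  fixes \<rho> :: "real \<Rightarrow> real"
  assumes "u \<le> v" "L \<ge> 0" "E \<ge> 0"
    and lip: "\<And>x y. x \<in> {u..v} \<Longrightarrow> y \<in> {u..v} \<Longrightarrow> \<bar>\<rho> x - \<rho> y\<bar> \<le> L * \<bar>x - y\<bar> + E"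
    and m: "\<rho> u \<le> m \<and> m \<le> \<rho> v \<or> \<rho> v \<le> m \<and> m \<le> \<rho> u"
  obtains w where "w \<in> {u..v}" "\<bar>\<rho> w - m\<bar> \<le> L + E"
proof -
  have main: "\<exists>w\<in>{u..v}. \<bar>\<rho> w - m\<bar> \<le> L + E"
    if lip: "\<And>x y. x \<in> {u..v} \<Longrightarrow> y \<in> {u..v} \<Longrightarrow> \<bar>\<rho> x - \<rho> y\<bar> \<le> L * \<bar>x - y\<bar> + E"
      and m: "\<rho> u \<le> m" "m \<le> \<rho> v" for \<rho> :: "real \<Rightarrow> real" and m
  proof -
    let ?S = "{x \<in> {u..v}. \<rho> x \<le> m}"
    have ne: "?S \<noteq> {}" "bdd_above ?S" using assms(1) m by (auto intro: bdd_aboveI[of _ v])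
    define c where "c = Sup ?S"
    have c: "u \<le> c" "c \<le> v"
      using ne assms(1) m by (auto simp: c_def intro: cSup_upper cSup_least)
    have "c - 1/2 < Sup ?S" by (simp add: c_def)
    then obtain x where x: "x \<in> ?S" "c - 1/2 < x" using less_cSup_iff[OF ne] by auto
    have xc: "x \<le> c" unfolding c_def by (rule cSup_upper[OF x(1) ne(2)])
    define y where "y = min v (c + 1/2)"
    have y: "y \<in> {u..v}" "x \<le> y" "y - x \<le> 1" using c x xc by (auto simp: y_def)
    have "m \<le> \<rho> y"
    proof (cases "y = v")
      case False
      then have "c < y" using c by (auto simp: y_def)
      then have "y \<notin> ?S" using cSup_upper[OF _ ne(2)] unfolding c_def by force
      then show ?thesis using y by auto
    qed (use m in simp)
    moreover have "\<bar>\<rho> x - \<rho> y\<bar> \<le> L * \<bar>x - y\<bar> + E" using lip[of x y] x y by auto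
    moreover have "L * \<bar>x - y\<bar> \<le> L" using y assms(2) mult_left_mono[of "\<bar>x - y\<bar>" 1 L] by auto
    ultimately show ?thesis using x by (intro bexI[of _ x]) auto
  qed
  have lip': "\<bar>(- \<rho> x) - (- \<rho> y)\<bar> \<le> L * \<bar>x - y\<bar> + E" if "x \<in> {u..v}" "y \<in> {u..v}" for x y
    using lip[OF that] by linarith
  from m show ?thesis
  proof
    assume "\<rho> u \<le> m \<and> m \<le> \<rho> v"
    then show ?thesis using main[of \<rho> m] lip that by auto
  next
    assume *: "\<rho> v \<le> m \<and> m \<le> \<rho> u"
    obtain w where "w \<in> {u..v}" "\<bar>- \<rho> w - - m\<bar> \<le> L + E" using main[of "\<lambda>x. - \<rho> x" "- m", OF lip'] * by auto
    then show ?thesis by (intro that[of w]) auto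
  qed
qed

section \<open>Morse sets\<close>

text \<open>The Morse condition depends only on the image, and a geodesic is automatically a
  quasi-geodesic. Freed from parametrisations, the condition can be moved between spaces as a
  property of sets.\<close>

definition morse_set :: "gauge_fun \<Rightarrow> 'a::metric_space set \<Rightarrow> bool" where
  "morse_set N S \<longleftrightarrow> (\<forall>L e s t \<beta>. s \<le> t \<and> quasi_geodesic L e {s..t} \<beta> \<and> \<beta> s \<in> S \<and> \<beta> t \<in> S \<longrightarrow>
     (\<forall>u\<in>{s..t}. infdist (\<beta> u) S \<le> N L e))"

lemma morse_setD:
  assumes "morse_set N S" "quasi_geodesic L e {s..t} \<beta>" "\<beta> s \<in> S" "\<beta> t \<in> S" "u \<in> {s..t}"
  shows "\<beta> u \<in> thick (N L e + 1) S"
proof (rule thick_infdist)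
  have "s \<le> t" using assms(5) by simp
  then show "infdist (\<beta> u) S \<le> N L e" using assms unfolding morse_set_def by blast
qed (use assms in auto)

lemma morse_quasi_geodesic_geodesic:
  "geodesic I \<gamma> \<Longrightarrow> morse_quasi_geodesic N I \<gamma> \<longleftrightarrow> morse_set N (\<gamma> ` I)"
  unfolding morse_quasi_geodesic_def morse_set_def using geodesic_quasi_geodesic by blast

lemma morse_geodesic_morse_set:
  assumes "morse_geodesic N I \<gamma>" "closed_interval J" "J \<subseteq> I"
  shows "morse_set N (\<gamma> ` J)"
  using assms geodesic_subset[of I \<gamma> J] morse_quasi_geodesic_geodesic[of J \<gamma> N]
  by (auto simp: morse_geodesic_def)

text \<open>Quasi-geodesics need not be continuous, so their endpoints may be moved freely.\<close>

lemma morse_set_near_ends: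
  assumes S: "morse_set N S" and \<beta>: "quasi_geodesic L e {s..t} \<beta>"
    and ends: "\<beta> s \<in> thick c S" "\<beta> t \<in> thick c S" and u: "u \<in> {s..t}"
  shows "\<beta> u \<in> thick (max c (N L (e + 2 * c) + 1)) S"
proof -
  obtain x y where xy: "x \<in> S" "dist (\<beta> s) x \<le> c" "y \<in> S" "dist (\<beta> t) y \<le> c"
    using ends by (auto simp: mem_thick)
  have "c \<ge> 0" using xy(2) zero_le_dist order_trans by blast
  define \<beta>' where "\<beta>' = \<beta>(s := x, t := y)"
  have "quasi_geodesic L (e + 2 * c) {s..t} \<beta>'"
    using \<beta> xy \<open>c \<ge> 0\<close> unfolding quasi_geodesic_def
    by (auto simp: \<beta>'_def intro!: qi_embedding_on_perturb[of L e _ \<beta>])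
  moreover have "\<beta>' s \<in> S" "\<beta>' t \<in> S" using xy by (auto simp: \<beta>'_def)
  ultimately have *: "\<beta>' u \<in> thick (N L (e + 2 * c) + 1) S" using morse_setD[OF S] u by blast
  \<comment> \<open>At the two ends \<open>\<beta>'\<close> says nothing about \<beta>; there the
    hypothesis itself gives the bound \<open>c\<close>, whence the maximum.\<close>
  show ?thesis
  proof (cases "u = s \<or> u = t")
    case True
    then show ?thesis using ends thick_mono[of c "max c (N L (e + 2 * c) + 1)" S S] by auto
  next
    case False
    then show ?thesis using * thick_mono[of "N L (e + 2 * c) + 1" "max c (N L (e + 2 * c) + 1)" S S]
      by (auto simp: \<beta>'_def)
  qed
qed

section \<open>The Morse property under quasi-isometric embeddings and on subintervals\<close>

definition transfer_gauge :: "real \<Rightarrow> real \<Rightarrow> real \<Rightarrow> gauge_fun \<Rightarrow> gauge_fun" where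
  "transfer_gauge L0 e0 C N L e = L0 * (max C (N (L0 * L) (L0 * e + e0 + 2 * C) + 1) + C + e0)"

lemma morse_gauge_transfer_gauge:
  "L0 \<ge> 0 \<Longrightarrow> e0 \<ge> 0 \<Longrightarrow> C \<ge> 0 \<Longrightarrow> morse_gauge (transfer_gauge L0 e0 C N)"
  by (auto simp: morse_gauge_def transfer_gauge_def intro!: mult_nonneg_nonneg add_nonneg_nonneg)

lemma morse_set_qi_transfer:
  assumes S: "morse_set N S" and g: "qi_embedding_on L0 e0 UNIV g" and "C \<ge> 0"
    and near: "g ` T \<subseteq> thick C S" "S \<subseteq> thick C (g ` T)"
  shows "morse_set (transfer_gauge L0 e0 C N) T"
  unfolding morse_set_def transfer_gauge_def
proof (intro allI impI ballI, elim conjE)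
  fix L e s t \<beta> u
  assume st: "s \<le> t" and \<beta>: "quasi_geodesic L e {s..t} \<beta>" and ends: "\<beta> s \<in> T" "\<beta> t \<in> T"
    and u: "u \<in> {s..t}"
  let ?K = "max C (N (L0 * L) (L0 * e + e0 + 2 * C) + 1)"
  have q: "quasi_geodesic (L0 * L) (L0 * e + e0) {s..t} (\<lambda>u. g (\<beta> u))"
    using \<beta> g by (auto simp: quasi_geodesic_def intro: qi_embedding_on_comp)
  have "g (\<beta> u) \<in> thick ?K S"
    by (rule morse_set_near_ends[OF S q _ _ u]) (use ends near in auto)
  then have "g (\<beta> u) \<in> thick (?K + C) (g ` T)" using thick_trans[OF near(2)] by blast
  then obtain y where y: "y \<in> T" "dist (g (\<beta> u)) (g y) \<le> ?K + C" by (auto simp: mem_thick)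
  have "dist (\<beta> u) y \<le> L0 * (dist (g (\<beta> u)) (g y) + e0)" using qi_embedding_onD(3)[OF g] by auto
  also have "\<dots> \<le> L0 * (?K + C + e0)"
    using y qi_embedding_onD(1)[OF g] by (intro mult_left_mono) auto
  finally show "infdist (\<beta> u) T \<le> L0 * (?K + C + e0)" using y by (intro infdist_le2)
qed

text \<open>\<rho> is the shadow of \<beta> on the geodesic. Being coarsely Lipschitz, it is subject
  to \<open>coarse_ivt\<close> although nearest points are chosen arbitrarily.\<close>

lemma tracking_coarse_lipschitz:
  assumes \<beta>: "qi_embedding_on L e A \<beta>" and \<gamma>: "geodesic I \<gamma>"
    and \<rho>: "\<And>u. u \<in> A \<Longrightarrow> \<rho> u \<in> I \<and> dist (\<beta> u) (\<gamma> (\<rho> u)) \<le> C"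
    and "x \<in> A" "y \<in> A"
  shows "\<bar>\<rho> x - \<rho> y\<bar> \<le> L * \<bar>x - y\<bar> + (2 * C + e)"
proof -
  have "\<bar>\<rho> x - \<rho> y\<bar> = dist (\<gamma> (\<rho> x)) (\<gamma> (\<rho> y))" using geodesicD[OF \<gamma>] \<rho> assms(4,5) by simp
  also have "\<dots> \<le> dist (\<beta> x) (\<beta> y) + 2 * C"
    using \<rho>[OF assms(4)] \<rho>[OF assms(5)] dist_triangle[of "\<gamma> (\<rho> x)" "\<gamma> (\<rho> y)" "\<beta> x"]
      dist_triangle[of "\<beta> x" "\<gamma> (\<rho> y)" "\<beta> y"] by (simp add: dist_commute)
  also have "dist (\<beta> x) (\<beta> y) \<le> L * \<bar>x - y\<bar> + e"
    using qi_embedding_onD(4)[OF \<beta> assms(4,5)] by (simp add: dist_real_def)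
  finally show ?thesis by simp
qed

definition segment_gauge :: "gauge_fun \<Rightarrow> gauge_fun" where
  "segment_gauge N L e = (let D = N L e + 1 in D + L * (L * (L + 3 * D + 2 * e)) + e)"

lemma morse_gauge_segment_gauge: "morse_gauge N \<Longrightarrow> morse_gauge (segment_gauge N)"
  by (auto simp: morse_gauge_def segment_gauge_def Let_def intro!: add_nonneg_nonneg mult_nonneg_nonneg)

text \<open>If the shadow of \<open>\<beta> u\<close> has left \<open>J\<close> beyond one end of
  \<beta>, then \<beta> passed near that same end at some other time \<open>w\<close>, with
  \<open>u\<close> between \<open>w\<close> and the time at which \<beta> is exactly there. Two
  close points of a quasi-geodesic have close parameters, so \<open>u\<close> is close to that time
  and \<open>\<beta> u\<close> to that end.\<close>

lemma morse_set_subsegment: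
  assumes N: "morse_gauge N" and \<gamma>: "geodesic I \<gamma>" and S: "morse_set N (\<gamma> ` I)"
    and J: "closed_interval J" "J \<subseteq> I"
  shows "morse_set (segment_gauge N) (\<gamma> ` J)"
  unfolding morse_set_def
proof (intro allI impI ballI, elim conjE)
  fix L e s t \<beta> u
  assume st: "s \<le> t" and \<beta>: "quasi_geodesic L e {s..t} \<beta>"
    and ends: "\<beta> s \<in> \<gamma> ` J" "\<beta> t \<in> \<gamma> ` J" and u: "u \<in> {s..t}"
  note D = qi_embedding_onD[OF conjunct2[OF \<beta>[unfolded quasi_geodesic_def]]]
  define C where "C = N L e + 1"
  \<comment> \<open>\<open>L + (2 * C + e)\<close> is the crossing error of the shadow; one more
    \<open>C\<close> leads from the shadow back to \<beta>.\<close>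
  define M where "M = L + 3 * C + e"
  have C: "C \<ge> 0" using N D(1,2) by (simp add: C_def morse_gauge_def)
  have bound: "segment_gauge N L e = C + L * (L * (M + e)) + e"
    by (simp add: segment_gauge_def Let_def M_def C_def algebra_simps)
  have M: "0 \<le> L * (L * (M + e))" using C D(1,2) by (simp add: M_def)
  obtain r0 r1 where r: "r0 \<in> J" "\<beta> s = \<gamma> r0" "r1 \<in> J" "\<beta> t = \<gamma> r1" using ends by auto
  \<comment> \<open>The shadow is prescribed exactly at both ends, so that crossings of
    \<open>r0\<close> and \<open>r1\<close> can be detected. When \<open>s = t\<close> the two
    prescriptions agree because \<gamma> is injective.\<close>
  have "\<exists>v\<in>I. dist (\<beta> w) (\<gamma> v) \<le> C \<and> (w = s \<longrightarrow> v = r0) \<and> (w = t \<longrightarrow> v = r1)"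
    if w: "w \<in> {s..t}" for w
  proof -
    consider "w = s" | "w = t" "w \<noteq> s" | "w \<noteq> s" "w \<noteq> t" by blast
    then show ?thesis
    proof cases
      case 1
      have "r0 = r1" if "s = t" using geodesicD[OF \<gamma>, of r0 r1] r J that by auto
      then show ?thesis using 1 r J C by (intro bexI[of _ r0]) auto
    next
      case 2
      then show ?thesis using r J C by (intro bexI[of _ r1]) auto
    next
      case 3
      have "\<beta> w \<in> thick C (\<gamma> ` I)"
        unfolding C_def by (rule morse_setD[OF S \<beta> _ _ w]) (use r J in auto)
      then show ?thesis using 3 by (auto simp: mem_thick)
    qed
  qed
  then have "\<forall>w\<in>{s..t}. \<exists>v. v \<in> I \<and> dist (\<beta> w) (\<gamma> v) \<le> C \<and> (w = s \<longrightarrow> v = r0) \<and> (w = t \<longrightarrow> v = r1)"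
    by blast
  from bchoice[OF this] obtain \<rho> where \<rho>': "\<forall>w\<in>{s..t}. \<rho> w \<in> I \<and> dist (\<beta> w) (\<gamma> (\<rho> w)) \<le> C \<and>
    (w = s \<longrightarrow> \<rho> w = r0) \<and> (w = t \<longrightarrow> \<rho> w = r1)" by blast
  then have \<rho>: "\<And>w. w \<in> {s..t} \<Longrightarrow> \<rho> w \<in> I \<and> dist (\<beta> w) (\<gamma> (\<rho> w)) \<le> C"
    by blast
  have \<rho>_ends: "\<rho> s = r0" "\<rho> t = r1" using \<rho>' st by auto
  note lip = tracking_coarse_lipschitz[OF conjunct2[OF \<beta>[unfolded quasi_geodesic_def]] \<gamma> \<rho>]
  have key: "dist (\<beta> u) (\<beta> x) \<le> L * (L * (M + e)) + e"
    if x: "x \<in> {s..t}" and w: "w \<in> {s..t}" "\<bar>u - x\<bar> \<le> \<bar>w - x\<bar>" "\<bar>\<rho> w - \<rho> x\<bar> \<le> L + (2 * C + e)"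
      and ex: "dist (\<beta> x) (\<gamma> (\<rho> x)) = 0" for x w
  proof -
    have "dist (\<beta> w) (\<beta> x) \<le> C + \<bar>\<rho> w - \<rho> x\<bar>"
      using \<rho>[OF w(1)] \<rho>[OF x] ex geodesicD[OF \<gamma>, of "\<rho> w" "\<rho> x"] dist_triangle[of "\<beta> w" "\<beta> x" "\<gamma> (\<rho> w)"]
      by simp
    then have "L * (dist (\<beta> w) (\<beta> x) + e) \<le> L * (M + e)"
      using w(3) D(1) by (intro mult_left_mono) (auto simp: M_def)
    then have "\<bar>u - x\<bar> \<le> L * (M + e)"
      using D(3)[OF w(1) x] w(2) by (simp add: dist_real_def)
    then have "L * \<bar>u - x\<bar> \<le> L * (L * (M + e))" using D(1) by (intro mult_left_mono) auto
    then show ?thesis using D(4)[OF u x] by (simp add: dist_real_def)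
  qed
  have LC: "0 \<le> L" "0 \<le> 2 * C + e" using D C by auto
  show "infdist (\<beta> u) (\<gamma> ` J) \<le> segment_gauge N L e"
  proof (cases "\<rho> u \<in> J")
    case True
    then have "infdist (\<beta> u) (\<gamma> ` J) \<le> C" using \<rho>[OF u] by (intro infdist_le2) auto
    then show ?thesis using bound M D(2) by linarith
  next
    case False
    have Jiv: "\<And>x. r0 \<le> x \<Longrightarrow> x \<le> r1 \<Longrightarrow> x \<in> J" "\<And>x. r1 \<le> x \<Longrightarrow> x \<le> r0 \<Longrightarrow> x \<in> J"
      using J(1) r(1,3) unfolding closed_interval_def by (blast intro: mem_is_interval_1_I)+
    \<comment> \<open>Outside \<open>J\<close> the shadow lies beyond \<open>r1\<close> or beyond
      \<open>r0\<close>, for either orientation. In the first case \<open>r1\<close> is crossed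
      before \<open>u\<close> and compared with time \<open>t\<close>; in the second
      \<open>r0\<close> is crossed after \<open>u\<close> and compared with time
      \<open>s\<close>.\<close>
    have "\<rho> s \<le> r1 \<and> r1 \<le> \<rho> u \<or> \<rho> u \<le> r1 \<and> r1 \<le> \<rho> s \<or> \<rho> u \<le> r0 \<and> r0 \<le> \<rho> t \<or> \<rho> t \<le> r0 \<and> r0 \<le> \<rho> u"
      using Jiv[of "\<rho> u"] False \<rho>_ends by linarith
    then consider "\<rho> s \<le> r1 \<and> r1 \<le> \<rho> u \<or> \<rho> u \<le> r1 \<and> r1 \<le> \<rho> s"
      | "\<rho> u \<le> r0 \<and> r0 \<le> \<rho> t \<or> \<rho> t \<le> r0 \<and> r0 \<le> \<rho> u" by blast
    then have "\<exists>x\<in>{s, t}. dist (\<beta> u) (\<beta> x) \<le> L * (L * (M + e)) + e"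
    proof cases
      case 1
      obtain w where "w \<in> {s..u}" "\<bar>\<rho> w - r1\<bar> \<le> L + (2 * C + e)"
        using coarse_ivt[of s u L "2 * C + e" \<rho> r1, OF _ LC _ 1] lip u by auto
      then have "dist (\<beta> u) (\<beta> t) \<le> L * (L * (M + e)) + e"
        using u by (intro key[of t w]) (auto simp: \<rho>_ends r)
      then show ?thesis by blast
    next
      case 2
      obtain w where "w \<in> {u..t}" "\<bar>\<rho> w - r0\<bar> \<le> L + (2 * C + e)"
        using coarse_ivt[of u t L "2 * C + e" \<rho> r0, OF _ LC _ 2] lip u by auto
      then have "dist (\<beta> u) (\<beta> s) \<le> L * (L * (M + e)) + e"
        using u by (intro key[of s w]) (auto simp: \<rho>_ends r)
      then show ?thesis by blast
    qed
    then have "infdist (\<beta> u) (\<gamma> ` J) \<le> L * (L * (M + e)) + e"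
      using ends by (auto intro: infdist_le2)
    then show ?thesis using bound C by linarith
  qed
qed

text \<open>The convention on subgeodesics costs a single change of gauge, the same for all
  subintervals.\<close>

lemma morse_geodesicI:
  assumes "morse_gauge N" "geodesic I \<gamma>" "morse_set N (\<gamma> ` I)"
  shows "morse_geodesic (segment_gauge N) I \<gamma>"
  unfolding morse_geodesic_def
proof (intro conjI allI impI)
  fix J assume J: "closed_interval J \<and> J \<subseteq> I"
  then have "geodesic J \<gamma>" using assms(2) by (auto intro: geodesic_subset)
  then show "morse_quasi_geodesic (segment_gauge N) J \<gamma>"
    using morse_set_subsegment[OF assms] J by (simp add: morse_quasi_geodesic_geodesic)
qed (rule assms)

section \<open>Uniform closeness of quasi-geodesics to Morse sets\<close>

lemma append_far_end:
  fixes \<beta> :: "real \<Rightarrow> 'a::metric_space"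
  assumes "geodesic_space TYPE('a)"
    and \<beta>: "quasi_geodesic L e {s..t} \<beta>" and x: "dist (\<beta> t) x \<le> r"
    and u: "u \<in> {s..t}" "t - u > L * (2 * r + 1 + e)"
  obtains t' \<beta>' where "quasi_geodesic (2 * L + 1) (L * (1 + e) + 1) {s..t'} \<beta>'" "\<beta>' t' = x" "u \<le> t'"
    "\<And>v. v \<in> {s..u} \<Longrightarrow> \<beta>' v = \<beta> v"
proof -
  note D = qi_embedding_onD[OF conjunct2[OF \<beta>[unfolded quasi_geodesic_def]]]
  let ?d = "\<lambda>v. dist x (\<beta> v)"
  define m where "m = (INF v\<in>{s..t}. ?d v)"
  have bdd: "bdd_below (?d ` {s..t})" by (rule bdd_belowI[of _ 0]) auto
  have ne: "?d ` {s..t} \<noteq> {}" using u by auto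
  \<comment> \<open>A discontinuous \<beta> may have no point nearest to \<open>x\<close>; the slack
    1 is the one allowed by \<open>quasi_geodesic_append\<close>.\<close>
  obtain t0 where t0: "t0 \<in> {s..t}" "?d t0 < m + 1"
    using cInf_lessD[OF ne, of "m + 1"] unfolding m_def by auto
  have near: "?d t0 \<le> ?d v + 1" if "v \<in> {s..t}" for v
    using t0(2) cINF_lower[OF bdd that] unfolding m_def by simp
  obtain a b \<eta>0 where \<eta>0: "a \<le> b" "geodesic {a..b} \<eta>0" "\<eta>0 a = \<beta> t0" "\<eta>0 b = x"
    using assms(1) unfolding geodesic_space_def by meson
  define \<eta> where "\<eta> = (\<lambda>v. \<eta>0 (a + v))"
  have \<eta>: "geodesic {0..b - a} \<eta>" "\<eta> 0 = \<beta> t0" "\<eta> (b - a) = x"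
    using \<eta>0 by (auto simp: \<eta>_def geodesic_def)
  define \<beta>' where "\<beta>' = (\<lambda>v. if v \<le> t0 then \<beta> v else \<eta> (v - t0))"
  have "quasi_geodesic L e {s..t0} \<beta>" using \<beta> t0 by (auto intro: quasi_geodesic_subset)
  then have 1: "quasi_geodesic (2 * L + 1) (L * (1 + e) + 1) {s..t0 + (b - a)} \<beta>'"
    unfolding \<beta>'_def by (rule quasi_geodesic_append) (use \<eta> near t0 in auto)
  \<comment> \<open>An almost nearest point is at most \<open>r + 1\<close> from \<open>x\<close>,
    hence close to \<open>\<beta> t\<close> and parametrised after \<open>u\<close>. So \<beta> is
    unchanged up to \<open>u\<close>, and \<open>r\<close> does not enter the new quasi-geodesic
    constants.\<close>
  have "dist (\<beta> t0) (\<beta> t) \<le> 2 * r + 1"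
    using near[of t] x u dist_triangle[of "\<beta> t0" "\<beta> t" x] by (auto simp: dist_commute)
  then have "L * (dist (\<beta> t0) (\<beta> t) + e) \<le> L * (2 * r + 1 + e)" using D(1) by (intro mult_left_mono) auto
  then have "u < t0" using D(3)[of t0 t] t0(1) u by (auto simp: dist_real_def)
  show ?thesis
  proof (rule that[OF 1])
    show "\<beta>' (t0 + (b - a)) = x" using \<eta> \<eta>0(1) by (cases "a = b") (auto simp: \<beta>'_def)
    show "u \<le> t0 + (b - a)" using \<open>u < t0\<close> \<eta>0(1) by simp
    show "\<beta>' v = \<beta> v" if "v \<in> {s..u}" for v using that \<open>u < t0\<close> by (simp add: \<beta>'_def)
  qed
qed

lemma quasi_geodesic_shape:
  assumes "quasi_geodesic L e I \<beta>" shows "1 \<le> L" "0 \<le> e" "qi_embedding_on L e I \<beta>"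
  using assms by (auto simp: quasi_geodesic_def dest: qi_embedding_onD(1,2))

text \<open>A quasi-geodesic within some distance of a Morse set is within a uniform distance of it: append,
  far away, a shortest connection to the set, which is still a uniform quasi-geodesic.\<close>

lemma quasi_ray_uniformly_near:
  fixes \<beta> :: "real \<Rightarrow> 'a::metric_space"
  assumes "geodesic_space TYPE('a)" and S: "morse_set N S" and \<beta>: "quasi_geodesic L e {0..} \<beta>"
    and c: "\<beta> 0 \<in> thick c S" and r: "\<beta> ` {0..} \<subseteq> thick r S"
  shows "\<beta> ` {0..} \<subseteq> thick (max c (N (2 * L + 1) (L * (1 + e) + 1 + 2 * c) + 1)) S"
proof (rule image_subsetI)
  fix u :: real assume u: "u \<in> {0..}"
  \<comment> \<open>Far enough that the connection to \<open>S\<close> leaves \<beta> only after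
    \<open>u\<close>. This is the only use of the uncontrolled \<open>r\<close>.\<close>
  define t where "t = u + (L * (2 * max r 0 + 1 + e) + 1)"
  note L = quasi_geodesic_shape[OF \<beta>]
  have t: "u \<le> t" using L by (simp add: t_def)
  have "\<beta> t \<in> thick r S" using r u t by auto
  then obtain x where x: "x \<in> S" "dist (\<beta> t) x \<le> max r 0" by (auto simp: mem_thick)
  have "quasi_geodesic L e {0..t} \<beta>" using \<beta> u t by (auto intro: quasi_geodesic_subset)
  then obtain t' \<beta>' where *: "quasi_geodesic (2 * L + 1) (L * (1 + e) + 1) {0..t'} \<beta>'" "\<beta>' t' = x" "u \<le> t'"
    "\<And>v. v \<in> {0..u} \<Longrightarrow> \<beta>' v = \<beta> v"
    using append_far_end[OF assms(1), of L e 0 t \<beta> x "max r 0" u] x u t t_def by auto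
  have "c \<ge> 0" using c by (auto simp: mem_thick intro: order_trans[OF zero_le_dist])
  then have "\<beta>' u \<in> thick (max c (N (2 * L + 1) (L * (1 + e) + 1 + 2 * c) + 1)) S"
    using * u c x by (intro morse_set_near_ends[OF S *(1)]) (auto intro: thickI[OF x(1)])
  then show "\<beta> u \<in> thick (max c (N (2 * L + 1) (L * (1 + e) + 1 + 2 * c) + 1)) S" using *(4)[of u] u by simp
qed

definition line_bound :: "gauge_fun \<Rightarrow> real \<Rightarrow> real \<Rightarrow> real" where
  "line_bound N L e = (let L' = 2 * L + 1; e' = L * (1 + e) + 1 in N (2 * L' + 1) (L' * (1 + e') + 1) + 1)"

text \<open>A line need not meet \<open>S\<close>, so both ends are replaced by shortest
  connections, the second one after reversing. The constants of \<open>quasi_geodesic_append\<close>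
  are thus iterated twice, which is the formula of \<open>line_bound\<close>.\<close>

lemma quasi_line_uniformly_near:
  fixes \<beta> :: "real \<Rightarrow> 'a::metric_space"
  assumes "geodesic_space TYPE('a)" and S: "morse_set N S" and \<beta>: "quasi_geodesic L e UNIV \<beta>"
    and r: "range \<beta> \<subseteq> thick r S"
  shows "range \<beta> \<subseteq> thick (line_bound N L e) S"
proof (rule image_subsetI)
  fix u :: real
  note L = quasi_geodesic_shape[OF \<beta>]
  define L' where "L' = 2 * L + 1"
  define e' where "e' = L * (1 + e) + 1"
  have L': "1 \<le> L'" "0 \<le> e'" using L by (auto simp: L'_def e'_def)
  define t where "t = u + (L * (2 * max r 0 + 1 + e) + 1)"
  \<comment> \<open>The second surgery acts on a path with the worse constants \<open>L'\<close> and
    \<open>e'\<close>, so the margin on this side is computed from them.\<close>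
  define s where "s = u - (L' * (2 * max r 0 + 1 + e') + 1)"
  have "0 \<le> L * (2 * max r 0 + 1 + e)" "0 \<le> L' * (2 * max r 0 + 1 + e')"
    using L L' by (auto intro!: mult_nonneg_nonneg)
  then have st: "u \<le> t" "s \<le> u" unfolding t_def s_def by linarith+
  have "\<beta> t \<in> thick r S" "\<beta> s \<in> thick r S" using r by auto
  then obtain x y where x: "x \<in> S" "dist (\<beta> t) x \<le> max r 0" and y: "y \<in> S" "dist (\<beta> s) y \<le> max r 0"
    by (auto simp: mem_thick)
  have "quasi_geodesic L e {s..t} \<beta>" using \<beta> st by (auto intro: quasi_geodesic_subset)
  then obtain t' \<beta>' where *: "quasi_geodesic L' e' {s..t'} \<beta>'" "\<beta>' t' = x" "u \<le> t'"
    "\<And>v. v \<in> {s..u} \<Longrightarrow> \<beta>' v = \<beta> v"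
    using append_far_end[OF assms(1), of L e s t \<beta> x "max r 0" u] x st t_def L'_def e'_def by auto
  obtain s' \<beta>'' where **: "quasi_geodesic (2 * L' + 1) (L' * (1 + e') + 1) {-t'..s'} \<beta>''" "\<beta>'' s' = y" "-u \<le> s'"
    "\<And>v. v \<in> {-t'..-u} \<Longrightarrow> \<beta>'' v = \<beta>' (-v)"
    using append_far_end[OF assms(1) quasi_geodesic_reverse[OF *(1)], of y "max r 0" "-u"]
      st y *(3) *(4)[of s] s_def by auto
  have "\<beta>'' (-u) \<in> thick (N (2 * L' + 1) (L' * (1 + e') + 1) + 1) S"
    by (rule morse_setD[OF S **(1)]) (use x y * ** in auto)
  then show "\<beta> u \<in> thick (line_bound N L e) S"
    using *(3) *(4)[of u] st **(4)[of "-u"] by (simp add: line_bound_def Let_def L'_def e'_def)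
qed

text \<open>The shadow of \<beta> on \<gamma> starts at parameter at most \<open>C + c\<close> and
  tends to infinity, so by \<open>coarse_ivt\<close> it comes near every later parameter; the
  initial piece of \<gamma> stays near \<open>\<beta> 0\<close>.\<close>

lemma ray_near_quasi_ray:
  assumes \<gamma>: "geodesic {0..} \<gamma>" and \<beta>: "quasi_geodesic L e {0..} \<beta>"
    and c: "dist (\<beta> 0) (\<gamma> 0) \<le> c" and C: "\<beta> ` {0..} \<subseteq> thick C (\<gamma> ` {0..})"
  shows "\<gamma> ` {0..} \<subseteq> thick (L + 3 * C + e + c) (\<beta> ` {0..})"
proof (rule image_subsetI)
  fix r :: real assume r: "r \<in> {0..}"
  note L = quasi_geodesic_shape[OF \<beta>]
  note D = qi_embedding_onD[OF L(3)]
  have "\<forall>u\<in>{0..}. \<exists>v. v \<in> {0..} \<and> dist (\<beta> u) (\<gamma> v) \<le> C" using C by (force simp: mem_thick)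
  then obtain \<rho> where \<rho>: "\<And>u. u \<in> {0..} \<Longrightarrow> \<rho> u \<in> {0..} \<and> dist (\<beta> u) (\<gamma> (\<rho> u)) \<le> C"
    by metis
  have c0: "0 \<le> c" "0 \<le> C" using c \<rho>[of 0] by (auto intro: order_trans[OF zero_le_dist])
  note lip = tracking_coarse_lipschitz[OF L(3) \<gamma> \<rho>]
  have \<rho>0: "\<rho> 0 \<le> C + c"
    using geodesicD[OF \<gamma>, of "\<rho> 0" 0] \<rho>[of 0] c dist_triangle[of "\<gamma> (\<rho> 0)" "\<gamma> 0" "\<beta> 0"]
    by (simp add: dist_commute)
  show "\<gamma> r \<in> thick (L + 3 * C + e + c) (\<beta> ` {0..})"
  proof (cases "r \<le> \<rho> 0")
    case True
    then have "dist (\<gamma> r) (\<beta> 0) \<le> C + c + C"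
      using geodesicD[OF \<gamma>, of r "\<rho> 0"] \<rho>[of 0] r \<rho>0 dist_triangle[of "\<gamma> r" "\<beta> 0" "\<gamma> (\<rho> 0)"]
      by (simp add: dist_commute)
    then show ?thesis using L c0 by (intro thickI[of "\<beta> 0"]) auto
  next
    case False
    \<comment> \<open>By the lower bound for \<beta>, \<open>\<beta> T\<close> is at least
      \<open>r + C + c\<close> away from \<open>\<beta> 0\<close>, which forces its shadow beyond
      \<open>r\<close>.\<close>
    define T where "T = L * (r + C + c + e)"
    have T: "0 \<le> T" using L c0 r by (simp add: T_def)
    have "r + C + c + e \<le> dist (\<beta> T) (\<beta> 0) + e"
      using D(3)[of T 0] T L by (simp add: T_def dist_real_def)
    moreover have "dist (\<beta> T) (\<beta> 0) \<le> C + \<rho> T + c"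
      using \<rho>[of T] geodesicD[OF \<gamma>, of "\<rho> T" 0] T c dist_triangle[of "\<beta> T" "\<beta> 0" "\<gamma> (\<rho> T)"]
        dist_triangle[of "\<gamma> (\<rho> T)" "\<beta> 0" "\<gamma> 0"] by (simp add: dist_commute)
    ultimately have "r \<le> \<rho> T" by linarith
    then obtain w where w: "w \<in> {0..T}" "\<bar>\<rho> w - r\<bar> \<le> L + (2 * C + e)"
      using coarse_ivt[of 0 T L "2 * C + e" \<rho> r] lip T L c0 False by auto
    then have "dist (\<gamma> r) (\<beta> w) \<le> L + 3 * C + e + c"
      using \<rho>[of w] r geodesicD[OF \<gamma>, of r "\<rho> w"] dist_triangle[of "\<gamma> r" "\<beta> w" "\<gamma> (\<rho> w)"] c0
      by (auto simp: dist_commute)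
    then show ?thesis using w by (intro thickI[of "\<beta> w"]) auto
  qed
qed

text \<open>The radius \<open>r\<close> only shows that the shadow goes to the right infinity on
  each side, so that it crosses \<open>m\<close>. The crossing estimate itself involves
  \<open>C\<close> alone.\<close>

lemma line_near_quasi_line:
  assumes \<gamma>: "geodesic UNIV \<gamma>" and \<beta>: "quasi_geodesic L e UNIV \<beta>"
    and C: "range \<beta> \<subseteq> thick C (range \<gamma>)"
    and ends: "\<beta> ` {0..} \<subseteq> thick r (\<gamma> ` {0..})" "\<beta> ` {..0} \<subseteq> thick r (\<gamma> ` {..0})"
  shows "range \<gamma> \<subseteq> thick (L + 3 * C + e) (range \<beta>)"
proof (rule image_subsetI)
  fix m :: real
  note L = quasi_geodesic_shape[OF \<beta>]
  note D = qi_embedding_onD[OF L(3)]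
  have "\<forall>u. \<exists>v. dist (\<beta> u) (\<gamma> v) \<le> C" using C by (force simp: mem_thick)
  then obtain \<rho> where \<rho>: "\<And>u. dist (\<beta> u) (\<gamma> (\<rho> u)) \<le> C" by metis
  have C0: "0 \<le> C" using \<rho>[of 0] by (auto intro: order_trans[OF zero_le_dist])
  note lip = tracking_coarse_lipschitz[OF L(3) \<gamma>, of \<rho> C]
  \<comment> \<open>Large enough that points of \<gamma> within \<open>r\<close> of
    \<open>\<beta> T\<close> and \<open>\<beta> (-T)\<close> have parameters of size at least
    \<open>\<bar>m\<bar> + C + r\<close>; their signs come from \<open>ends\<close>, and the shadow
    differs from them by at most \<open>C + r\<close>.\<close>
  define T where "T = L * (\<bar>m\<bar> + C + 2 * \<bar>r\<bar> + dist (\<beta> 0) (\<gamma> 0) + e)"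
  have T: "0 \<le> T" using L C0 by (simp add: T_def)
  have far: "\<bar>m\<bar> + C + r \<le> \<bar>v\<bar>"
    if t: "\<bar>t\<bar> = T" and v: "dist (\<beta> t) (\<gamma> v) \<le> r" for t v
  proof -
    have "\<bar>m\<bar> + C + 2 * \<bar>r\<bar> + dist (\<beta> 0) (\<gamma> 0) + e \<le> dist (\<beta> t) (\<beta> 0) + e"
      using D(3)[of t 0] t L by (simp add: T_def dist_real_def)
    moreover have "dist (\<beta> t) (\<beta> 0) \<le> r + \<bar>v\<bar> + dist (\<beta> 0) (\<gamma> 0)"
      using v geodesicD[OF \<gamma>, of v 0] dist_triangle[of "\<beta> t" "\<beta> 0" "\<gamma> v"]
        dist_triangle[of "\<gamma> v" "\<beta> 0" "\<gamma> 0"] by (simp add: dist_commute)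
    ultimately show ?thesis by linarith
  qed
  have cl: "\<bar>\<rho> t - v\<bar> \<le> C + r" if "dist (\<beta> t) (\<gamma> v) \<le> r" for t v
    using that \<rho>[of t] geodesicD[OF \<gamma>, of "\<rho> t" v] dist_triangle[of "\<gamma> (\<rho> t)" "\<gamma> v" "\<beta> t"]
    by (simp add: dist_commute)
  have "\<beta> T \<in> thick r (\<gamma> ` {0..})" "\<beta> (-T) \<in> thick r (\<gamma> ` {..0})" using ends T by auto
  then obtain v v' where v: "v \<ge> 0" "dist (\<beta> T) (\<gamma> v) \<le> r" "v' \<le> 0" "dist (\<beta> (-T)) (\<gamma> v') \<le> r"
    by (auto simp: mem_thick)
  have "m \<le> \<rho> T" "\<rho> (-T) \<le> m"
    using far[OF _ v(2)] far[OF _ v(4)] cl[OF v(2)] cl[OF v(4)] v T by auto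
  note m = this
  have "\<exists>w. \<bar>\<rho> w - m\<bar> \<le> L + (2 * C + e)"
  proof (rule coarse_ivt[of "-T" T L "2 * C + e" \<rho> m])
    show "\<bar>\<rho> x - \<rho> y\<bar> \<le> L * \<bar>x - y\<bar> + (2 * C + e)" for x y using lip \<rho> by simp
  qed (use T L C0 m in auto)
  then obtain w where w: "\<bar>\<rho> w - m\<bar> \<le> L + (2 * C + e)" by blast
  then have "dist (\<gamma> m) (\<beta> w) \<le> L + 3 * C + e"
    using \<rho>[of w] geodesicD[OF \<gamma>, of m "\<rho> w"] dist_triangle[of "\<gamma> m" "\<beta> w" "\<gamma> (\<rho> w)"]
    by (auto simp: dist_commute)
  then show "\<gamma> m \<in> thick (L + 3 * C + e) (range \<beta>)" by (intro thickI[of "\<beta> w"]) auto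
qed

section \<open>Limits of geodesics and existence of lines\<close>

text \<open>Arzela-Ascoli for 1-Lipschitz maps from the line to a proper space: a diagonal
  subsequence converges at all rationals, and the Lipschitz bound spreads convergence to all reals
  and makes it uniform on compact sets.\<close>

lemma lipschitz_subsequence:
  fixes F :: "nat \<Rightarrow> real \<Rightarrow> 'a::heine_borel"
  assumes lip: "\<And>n x y. dist (F n x) (F n y) \<le> \<bar>x - y\<bar>"
    and bd: "bounded (range (\<lambda>n. F n 0))"
  obtains s G where "strict_mono (s :: nat \<Rightarrow> nat)"
    "\<And>C. compact C \<Longrightarrow> uniform_limit C (\<lambda>n. F (s n)) G sequentially"
    "\<And>x. (\<lambda>n. F (s n) x) \<longlonglongrightarrow> G x"
proof -
  have bdx: "bounded (range (\<lambda>n. F n x))" for x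
  proof -
    obtain z B where B: "\<And>n. dist z (F n 0) \<le> B" using bd unfolding bounded_def by blast
    have "dist z (F n x) \<le> B + \<bar>x\<bar>" for n
      using B[of n] lip[of n 0 x] dist_triangle[of z "F n x" "F n 0"] by simp
    then show ?thesis unfolding bounded_def by blast
  qed
  define q :: "nat \<Rightarrow> real" where "q = (\<lambda>n. of_rat (from_nat n))"
  interpret subseqs "\<lambda>n s. convergent (\<lambda>k. F (s k) (q n))"
  proof
    fix n s assume "strict_mono (s :: nat \<Rightarrow> nat)"
    have "bounded (range (\<lambda>k. F (s k) (q n)))" by (rule bounded_subset[OF bdx[of "q n"]]) auto
    then obtain l r where "strict_mono (r :: nat \<Rightarrow> nat)" "((\<lambda>k. F (s k) (q n)) \<circ> r) \<longlonglongrightarrow> l"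
      using bounded_imp_convergent_subsequence by blast
    then show "\<exists>r'. strict_mono r' \<and> convergent (\<lambda>k. F ((s \<circ> r') k) (q n))"
      by (auto simp: o_def convergent_def)
  qed
  define d where "d = diagseq"
  have d: "strict_mono d" unfolding d_def by (rule subseq_diagseq)
  have qconv: "convergent (\<lambda>k. F (d k) (q n))" for n
  proof -
    have "convergent (\<lambda>k. F ((diagseq \<circ> (+) (Suc n)) k) (q n))"
    proof (rule diagseq_holds)
      fix r s :: "nat \<Rightarrow> nat" and n
      assume "strict_mono r" "convergent (\<lambda>k. F (s k) (q n))"
      then show "convergent (\<lambda>k. F ((s \<circ> r) k) (q n))"
        using convergent_subseq_convergent[of "\<lambda>k. F (s k) (q n)" r] by (simp add: o_def)
    qed
    then have "convergent (\<lambda>k. F (d (k + Suc n)) (q n))" by (simp add: d_def o_def add.commute)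
    then show ?thesis using convergent_ignore_initial_segment[of "\<lambda>k. F (d k) (q n)" "Suc n"] by simp
  qed
  have "convergent (\<lambda>k. F (d k) x)" for x
  proof (rule Cauchy_convergent, rule metric_CauchyI)
    fix \<epsilon> :: real assume "0 < \<epsilon>"
    then obtain y where y: "x < real_of_rat y" "real_of_rat y < x + \<epsilon> / 3"
      using of_rat_dense[of x "x + \<epsilon> / 3"] by auto
    obtain n where n: "q n = of_rat y" by (metis q_def from_nat_to_nat)
    obtain M where M: "\<And>i j. M \<le> i \<Longrightarrow> M \<le> j \<Longrightarrow> dist (F (d i) (q n)) (F (d j) (q n)) < \<epsilon> / 3"
      using metric_CauchyD[OF convergent_Cauchy[OF qconv[of n]], of "\<epsilon> / 3"] \<open>0 < \<epsilon>\<close> by auto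
    have "dist (F (d i) x) (F (d j) x) < \<epsilon>" if "M \<le> i" "M \<le> j" for i j
      using M[OF that] lip[of "d i" x "q n"] lip[of "d j" "q n" x] y
        dist_triangle[of "F (d i) x" "F (d j) x" "F (d i) (q n)"]
        dist_triangle[of "F (d i) (q n)" "F (d j) x" "F (d j) (q n)"] unfolding n by linarith
    then show "\<exists>M. \<forall>i\<ge>M. \<forall>j\<ge>M. dist (F (d i) x) (F (d j) x) < \<epsilon>" by blast
  qed
  then have "\<forall>x. \<exists>l. (\<lambda>k. F (d k) x) \<longlonglongrightarrow> l" by (simp add: convergent_def)
  then obtain G where G: "\<And>x. (\<lambda>k. F (d k) x) \<longlonglongrightarrow> G x" by metis
  have Glip: "dist (G x) (G y) \<le> \<bar>x - y\<bar>" for x y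
    by (rule tendsto_upperbound[OF tendsto_dist[OF G G] always_eventually]) (use lip in auto)
  have "uniform_limit C (\<lambda>n. F (d n)) G sequentially" if C: "compact C" for C
  proof (rule uniform_limitI)
    fix \<epsilon> :: real assume \<epsilon>: "0 < \<epsilon>"
    then obtain k where k: "finite k" "C \<subseteq> (\<Union>x\<in>k. ball x (\<epsilon> / 3))"
      using conjunct2[OF C[unfolded compact_eq_totally_bounded], rule_format, of "\<epsilon> / 3"] by auto
    have "\<forall>\<^sub>F n in sequentially. dist (F (d n) y) (G y) < \<epsilon> / 3" for y
      using tendstoD[OF G, of "\<epsilon> / 3" y] \<epsilon> by simp
    then have "\<forall>\<^sub>F n in sequentially. \<forall>y\<in>k. dist (F (d n) y) (G y) < \<epsilon> / 3"
      using k(1) by (simp add: eventually_ball_finite)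
    then show "\<forall>\<^sub>F n in sequentially. \<forall>x\<in>C. dist (F (d n) x) (G x) < \<epsilon>"
    proof eventually_elim
      case (elim n)
      show ?case
      proof
        fix x assume "x \<in> C"
        then obtain y where y: "y \<in> k" "dist y x < \<epsilon> / 3" using k(2) by auto
        have "dist (F (d n) y) (G y) < \<epsilon> / 3" using elim y by blast
        then show "dist (F (d n) x) (G x) < \<epsilon>"
          using y(2) lip[of "d n" x y] Glip[of y x] dist_triangle[of "F (d n) x" "G x" "F (d n) y"]
            dist_triangle[of "F (d n) y" "G x" "G y"] by (simp add: dist_real_def abs_minus_commute)
      qed
    qed
  qed
  then show ?thesis using that d G by blast
qed

lemma geodesic_subsequence:
  fixes \<sigma> :: "nat \<Rightarrow> real \<Rightarrow> 'a::heine_borel"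
  assumes \<sigma>: "\<And>n. geodesic {a n..b n} (\<sigma> n)" and ab: "\<And>n. a n \<le> 0 \<and> 0 \<le> b n"
    and bd: "bounded (range (\<lambda>n. \<sigma> n 0))"
    and I: "closed_interval I" "\<And>u. u \<in> I \<Longrightarrow> \<forall>\<^sub>F n in sequentially. u \<in> {a n..b n}"
  obtains s G where "strict_mono (s :: nat \<Rightarrow> nat)" "geodesic I G" "\<And>u. u \<in> I \<Longrightarrow> (\<lambda>n. \<sigma> (s n) u) \<longlonglongrightarrow> G u"
proof -
  \<comment> \<open>Segments are extended by their endpoint values, which keeps them 1-Lipschitz on
    the whole line. Each parameter of \<open>I\<close> eventually lies in the true domain, so the
    limit is isometric on \<open>I\<close>.\<close>
  define F where "F = (\<lambda>n u. \<sigma> n (max (a n) (min (b n) u)))"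
  have Flip: "dist (F n x) (F n y) \<le> \<bar>x - y\<bar>" for n x y
    unfolding F_def using ab[of n] by (subst geodesicD[OF \<sigma>]) auto
  have F0: "F n 0 = \<sigma> n 0" for n using ab[of n] by (simp add: F_def)
  have bd': "bounded (range (\<lambda>n. F n 0))" using bd F0 by simp
  obtain s G where s: "strict_mono (s :: nat \<Rightarrow> nat)" and G: "\<And>x. (\<lambda>n. F (s n) x) \<longlonglongrightarrow> G x"
    by (rule lipschitz_subsequence[OF Flip bd']) (rule that)
  have ev: "\<forall>\<^sub>F n in sequentially. u \<in> {a (s n)..b (s n)}" if "u \<in> I" for u
    by (rule eventually_subseq[OF s I(2)[OF that]])
  have conv: "(\<lambda>n. \<sigma> (s n) u) \<longlonglongrightarrow> G u" if "u \<in> I" for u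
    by (rule Lim_transform_eventually[OF G])
      (use ev[OF that] in eventually_elim, auto simp: F_def)
  have "dist (G u) (G v) = \<bar>u - v\<bar>" if "u \<in> I" "v \<in> I" for u v
  proof -
    have "(\<lambda>n. dist (\<sigma> (s n) u) (\<sigma> (s n) v)) \<longlonglongrightarrow> dist (G u) (G v)"
      by (intro tendsto_dist conv that)
    moreover have "\<forall>\<^sub>F n in sequentially. dist (\<sigma> (s n) u) (\<sigma> (s n) v) = \<bar>u - v\<bar>"
      using ev[OF that(1)] ev[OF that(2)] by eventually_elim (simp add: geodesicD[OF \<sigma>])
    ultimately show ?thesis by (intro LIMSEQ_unique[OF _ tendsto_eventually])
  qed
  then have "geodesic I G" using I(1) by (simp add: geodesic_def)
  then show ?thesis using that s conv by blast
qed

lemma thick_limit: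
  assumes "x \<longlonglongrightarrow> y" "\<forall>\<^sub>F n in sequentially. x n \<in> thick C S"
  shows "y \<in> thick (C + 1) S"
proof -
  have "\<forall>\<^sub>F n in sequentially. dist (x n) y < 1" using tendstoD[OF assms(1), of 1] by simp
  with assms(2) have "\<forall>\<^sub>F n in sequentially. x n \<in> thick C S \<and> dist (x n) y < 1" by (rule eventually_conj)
  then obtain n where "x n \<in> thick C S" "dist (x n) y < 1"
    using eventually_happens'[OF sequentially_bot] by blast
  then show ?thesis using thick_close[of "x n" C S y 1] by (simp add: dist_commute)
qed

section \<open>Joining Morse rays by a line\<close>

lemma finite_hausdorff_dist_rays_pointwise:
  assumes "\<And>t. t \<ge> 0 \<Longrightarrow> dist (\<alpha> t) (\<beta> t) \<le> C"
  shows "finite_hausdorff_dist (\<alpha> ` {0::real..}) (\<beta> ` {0..})"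
proof (rule finite_hausdorff_distI)
  show "\<alpha> ` {0..} \<subseteq> thick C (\<beta> ` {0..})" "\<beta> ` {0..} \<subseteq> thick C (\<alpha> ` {0..})"
    using assms by (force simp: mem_thick dist_commute)+
qed

text \<open>One half of a segment followed by a shortest connection has both ends in
  \<open>S\<close>. Appending to a geodesic turns \<open>(1, 0)\<close> into \<open>(3, 2)\<close>,
  whence \<open>N 3 2\<close>.\<close>

lemma shortest_connection_near:
  assumes S: "morse_set N S" and \<omega>: "geodesic {a..0} \<omega>" "\<omega> a \<in> S"
    and \<eta>: "geodesic {0..l} \<eta>" "\<eta> 0 = \<omega> 0" "\<eta> l \<in> S"
    and near: "\<And>u. u \<in> {a..0} \<Longrightarrow> dist (\<eta> l) (\<omega> 0) \<le> dist (\<eta> l) (\<omega> u)"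
  shows "\<omega> ` {a..0} \<subseteq> thick (N 3 2 + 1) S" "\<eta> ` {0..l} \<subseteq> thick (N 3 2 + 1) S"
proof -
  let ?\<beta> = "\<lambda>u. if u \<le> 0 then \<omega> u else \<eta> (u - 0)"
  have al: "a \<le> 0" "0 \<le> l" using \<omega>(1) \<eta>(1) by (auto simp: geodesic_def)
  have "quasi_geodesic (2 * 1 + 1) (1 * (1 + 0) + 1) {a..0 + l} ?\<beta>"
    by (rule quasi_geodesic_append[OF geodesic_quasi_geodesic[OF \<omega>(1)] \<eta>(1,2)])
      (use near \<omega> \<eta> in \<open>auto intro!: add_increasing2\<close>)
  then have q: "quasi_geodesic 3 2 {a..l} ?\<beta>" by simp
  have ends: "?\<beta> a \<in> S" "?\<beta> l \<in> S" using al \<omega> \<eta> by (cases "l = 0"; simp)+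
  note near = morse_setD[OF S q ends]
  show "\<omega> ` {a..0} \<subseteq> thick (N 3 2 + 1) S" using near al by force
  show "\<eta> ` {0..l} \<subseteq> thick (N 3 2 + 1) S"
  proof (rule image_subsetI)
    fix u assume "u \<in> {0..l}"
    then show "\<eta> u \<in> thick (N 3 2 + 1) S"
      using near[of u] al \<eta>(2) by (cases "u = 0") auto
  qed
qed

lemma geodesic_reverse: "geodesic {a..b} \<gamma> \<Longrightarrow> geodesic {-b..-a} (\<lambda>u. \<gamma> (-u))"
  by (auto simp: geodesic_def)

lemma ray_near_parameter:
  assumes "geodesic {0..} \<alpha>" "x \<in> thick D (\<alpha> ` {0..})" "dist (\<alpha> 0) x = u"
  shows "dist x (\<alpha> u) \<le> 2 * D"
proof -
  obtain v where v: "v \<ge> 0" "dist x (\<alpha> v) \<le> D" using assms(2) by (auto simp: mem_thick)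
  have "dist (\<alpha> 0) (\<alpha> v) = v" using geodesicD[OF assms(1), of 0 v] v by simp
  then have "\<bar>v - u\<bar> \<le> D"
    using assms(3) v dist_triangle[of "\<alpha> 0" "\<alpha> v" x] dist_triangle[of "\<alpha> 0" x "\<alpha> v"]
    by (auto simp: dist_commute)
  then show ?thesis
    using geodesicD[OF assms(1), of v u] v assms(3) zero_le_dist[of "\<alpha> 0" x]
      dist_triangle[of x "\<alpha> u" "\<alpha> v"] by auto
qed

text \<open>Two Morse rays that are not asymptotic are joined by a geodesic line, a limit of the segments
  joining their points: the shortest connection from the basepoint to such a segment follows both rays,
  so its length is bounded.\<close>

lemma geodesic_line_exists:
  fixes \<alpha> \<beta> :: "real \<Rightarrow> 'a::heine_borel"
  assumes gs: "geodesic_space TYPE('a)"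
    and \<alpha>: "geodesic_ray p \<alpha>" "morse_set N (\<alpha> ` {0..})"
    and \<beta>: "geodesic_ray p \<beta>" "morse_set N (\<beta> ` {0..})"
    and na: "\<not> finite_hausdorff_dist (\<alpha> ` {0..}) (\<beta> ` {0..})"
  obtains \<gamma> where "geodesic UNIV \<gamma>" "finite_hausdorff_dist (\<gamma> ` {..0}) (\<alpha> ` {0..})"
    "finite_hausdorff_dist (\<gamma> ` {0..}) (\<beta> ` {0..})"
proof -
  have \<alpha>g: "geodesic {0..} \<alpha>" "\<alpha> 0 = p" and \<beta>g: "geodesic {0..} \<beta>" "\<beta> 0 = p"
    using \<alpha>(1) \<beta>(1) by (auto simp: geodesic_ray_def)
  define D where "D = N 3 2 + 1"
  have "\<exists>a b \<sigma>. a \<le> 0 \<and> 0 \<le> b \<and> geodesic {a..b} \<sigma> \<and> \<sigma> a = \<alpha> (real n) \<and> \<sigma> b = \<beta> (real n) \<and>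
    (\<forall>u\<in>{a..b}. dist p (\<sigma> 0) \<le> dist p (\<sigma> u))" for n :: nat
  proof -
    obtain a b \<sigma> where \<sigma>: "a \<le> b" "geodesic {a..b} \<sigma>" "\<sigma> a = \<alpha> (real n)" "\<sigma> b = \<beta> (real n)"
      using gs unfolding geodesic_space_def by meson
    have "continuous_on {a..b} \<sigma>"
      unfolding continuous_on_iff using geodesicD[OF \<sigma>(2)] by (auto simp: dist_real_def)
    then have "continuous_on {a..b} (\<lambda>u. dist p (\<sigma> u))" by (intro continuous_intros)
    then obtain c where c: "c \<in> {a..b}" "\<And>u. u \<in> {a..b} \<Longrightarrow> dist p (\<sigma> c) \<le> dist p (\<sigma> u)"
      using continuous_attains_inf[of "{a..b}" "\<lambda>u. dist p (\<sigma> u)"] \<sigma>(1) by auto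
    \<comment> \<open>A nearest point to \<open>p\<close> is moved to parameter \<open>0\<close>,
      which gives the segments a common base for taking limits.\<close>
    show ?thesis
      by (rule exI[of _ "a - c"], rule exI[of _ "b - c"], rule exI[of _ "\<lambda>u. \<sigma> (c + u)"])
        (use \<sigma> c in \<open>auto simp: geodesic_def\<close>)
  qed
  then obtain a b \<sigma> where ab: "\<And>n. a n \<le> 0 \<and> 0 \<le> b n" and \<sigma>: "\<And>n. geodesic {a n..b n} (\<sigma> n)"
    and \<sigma>ends: "\<And>n. \<sigma> n (a n) = \<alpha> (real n)" "\<And>n. \<sigma> n (b n) = \<beta> (real n)"
    and near: "\<And>n u. u \<in> {a n..b n} \<Longrightarrow> dist p (\<sigma> n 0) \<le> dist p (\<sigma> n u)"
    by metis
  have "\<exists>\<eta>. geodesic {0..dist p (\<sigma> n 0)} \<eta> \<and> \<eta> 0 = \<sigma> n 0 \<and> \<eta> (dist p (\<sigma> n 0)) = p" for n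
  proof -
    obtain s t \<eta> where \<eta>: "s \<le> t" "geodesic {s..t} \<eta>" "\<eta> s = \<sigma> n 0" "\<eta> t = p"
      using gs unfolding geodesic_space_def by meson
    have "t = s + dist p (\<sigma> n 0)" using geodesicD[OF \<eta>(2), of t s] \<eta> by auto
    then show ?thesis
      by (intro exI[of _ "\<lambda>u. \<eta> (s + u)"]) (use \<eta> in \<open>auto simp: geodesic_def\<close>)
  qed
  then obtain \<eta> where \<eta>: "\<And>n. geodesic {0..dist p (\<sigma> n 0)} (\<eta> n)" "\<And>n. \<eta> n 0 = \<sigma> n 0"
    "\<And>n. \<eta> n (dist p (\<sigma> n 0)) = p" by metis
  have \<alpha>near: "\<sigma> n ` {a n..0} \<subseteq> thick D (\<alpha> ` {0..})"
    "\<eta> n ` {0..dist p (\<sigma> n 0)} \<subseteq> thick D (\<alpha> ` {0..})" for n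
    unfolding D_def
    by (rule shortest_connection_near[OF \<alpha>(2), of "a n" "\<sigma> n" "dist p (\<sigma> n 0)" "\<eta> n"];
      use \<sigma>[of n] ab[of n] \<sigma>ends[of n] \<eta>[of n] near[of _ n] \<alpha>g in \<open>auto intro: geodesic_subset\<close>)+
  \<comment> \<open>The reversed second half starts on \<beta> and meets the same connection, so the
    connection is near both rays.\<close>
  have \<beta>near': "(\<lambda>u. \<sigma> n (-u)) ` {-b n..0} \<subseteq> thick D (\<beta> ` {0..})"
    "\<eta> n ` {0..dist p (\<sigma> n 0)} \<subseteq> thick D (\<beta> ` {0..})" for n
    unfolding D_def
    by (rule shortest_connection_near[OF \<beta>(2), of "- b n" "\<lambda>u. \<sigma> n (-u)" "dist p (\<sigma> n 0)" "\<eta> n"];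
      use geodesic_reverse[OF \<sigma>[of n]] ab[of n] \<sigma>ends[of n] \<eta>[of n] near[of _ n] \<beta>g
      in \<open>auto intro: geodesic_subset\<close>)+
  have \<beta>near: "\<sigma> n ` {0..b n} \<subseteq> thick D (\<beta> ` {0..})" for n
  proof (rule image_subsetI)
    fix u assume "u \<in> {0..b n}"
    then show "\<sigma> n u \<in> thick D (\<beta> ` {0..})"
      using subsetD[OF \<beta>near'(1)[of n] imageI[of "-u"]] by simp
  qed
  have "\<exists>R. \<forall>n. dist p (\<sigma> n 0) \<le> R"
  proof (rule ccontr)
    assume "\<not> ?thesis"
    then have unb: "\<exists>n. u \<le> dist p (\<sigma> n 0)" for u by (meson le_cases)
    \<comment> \<open>A long connection contains a point at distance \<open>u\<close> from
      \<open>p\<close>, which is then near both \<open>\<alpha> u\<close> and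
      \<open>\<beta> u\<close>. If this happened for all \<open>u\<close>, the rays would be
      asymptotic.\<close>
    have "dist (\<alpha> u) (\<beta> u) \<le> 4 * D" if u: "u \<ge> 0" for u
    proof -
      obtain n where n: "u \<le> dist p (\<sigma> n 0)" using unb by blast
      define x where "x = \<eta> n (dist p (\<sigma> n 0) - u)"
      have "dist p x = u"
        using geodesicD[OF \<eta>(1), of "dist p (\<sigma> n 0)" n "dist p (\<sigma> n 0) - u"] n u
        by (simp add: x_def \<eta>)
      moreover have "x \<in> thick D (\<alpha> ` {0..})" "x \<in> thick D (\<beta> ` {0..})"
        using \<alpha>near(2)[of n] \<beta>near'(2)[of n] n u by (auto simp: x_def)
      ultimately have "dist x (\<alpha> u) \<le> 2 * D" "dist x (\<beta> u) \<le> 2 * D"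
        using ray_near_parameter[OF \<alpha>g(1)] ray_near_parameter[OF \<beta>g(1)] \<alpha>g(2) \<beta>g(2) by simp_all
      then show ?thesis using dist_triangle[of "\<alpha> u" "\<beta> u" x] by (simp add: dist_commute)
    qed
    then show False using na finite_hausdorff_dist_rays_pointwise by blast
  qed
  then obtain R where R: "\<And>n. dist p (\<sigma> n 0) \<le> R" by blast
  \<comment> \<open>The feet stay within \<open>R\<close> of \<open>p\<close> while the endpoints
    escape, so both halves become infinitely long.\<close>
  have long: "real n - R \<le> - a n" "real n - R \<le> b n" for n
  proof -
    have "dist p (\<alpha> (real n)) = real n" "dist p (\<beta> (real n)) = real n"
      using geodesicD[OF \<alpha>g(1), of 0 "real n"] geodesicD[OF \<beta>g(1), of 0 "real n"] \<alpha>g \<beta>g by auto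
    moreover have "dist (\<sigma> n 0) (\<alpha> (real n)) = - a n" "dist (\<sigma> n 0) (\<beta> (real n)) = b n"
      using geodesicD[OF \<sigma>, of 0 n "a n"] geodesicD[OF \<sigma>, of 0 n "b n"] \<sigma>ends[of n] ab[of n] by auto
    ultimately show "real n - R \<le> - a n" "real n - R \<le> b n"
      using R[of n] dist_triangle[of p "\<alpha> (real n)" "\<sigma> n 0"] dist_triangle[of p "\<beta> (real n)" "\<sigma> n 0"]
      by linarith+
  qed
  have ev: "\<forall>\<^sub>F n in sequentially. u \<in> {a n..b n}" for u
  proof -
    have "\<forall>\<^sub>F n in sequentially. \<bar>u\<bar> + R \<le> real n"
      using filterlim_real_sequentially unfolding filterlim_at_top by blast
    then show ?thesis
    proof eventually_elim
      case (elim n)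
      then show ?case using long[of n] by auto
    qed
  qed
  have "bounded (range (\<lambda>n. \<sigma> n 0))" unfolding bounded_def using R by blast
  then obtain s G where s: "strict_mono (s :: nat \<Rightarrow> nat)" and G: "geodesic UNIV G"
    and conv: "\<And>u. (\<lambda>n. \<sigma> (s n) u) \<longlonglongrightarrow> G u"
    using geodesic_subsequence[of a b \<sigma> UNIV] \<sigma> ab ev by auto
  have ev': "\<forall>\<^sub>F n in sequentially. u \<in> {a (s n)..b (s n)}" for u
    by (rule eventually_subseq[OF s ev])
  have G\<beta>: "G ` {0..} \<subseteq> thick (D + 1) (\<beta> ` {0..})"
  proof (rule image_subsetI)
    fix u :: real assume u: "u \<in> {0..}"
    have "\<forall>\<^sub>F n in sequentially. \<sigma> (s n) u \<in> thick D (\<beta> ` {0..})"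
      using ev'[of u]
    proof eventually_elim
      case (elim n)
      then show ?case using subsetD[OF \<beta>near[of "s n"] imageI[of u]] u by simp
    qed
    then show "G u \<in> thick (D + 1) (\<beta> ` {0..})" by (rule thick_limit[OF conv])
  qed
  have G\<alpha>: "(\<lambda>u. G (-u)) ` {0..} \<subseteq> thick (D + 1) (\<alpha> ` {0..})"
  proof (rule image_subsetI)
    fix u :: real assume u: "u \<in> {0..}"
    have "\<forall>\<^sub>F n in sequentially. \<sigma> (s n) (-u) \<in> thick D (\<alpha> ` {0..})"
      using ev'[of "-u"]
    proof eventually_elim
      case (elim n)
      then show ?case using subsetD[OF \<alpha>near(1)[of "s n"] imageI[of "-u"]] u by simp
    qed
    then show "G (-u) \<in> thick (D + 1) (\<alpha> ` {0..})" by (rule thick_limit[OF conv])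
  qed
  have Gp: "quasi_geodesic 1 0 {0..} G" "quasi_geodesic 1 0 {0..} (\<lambda>u. G (-u))"
    using G by (auto intro!: geodesic_quasi_geodesic simp: geodesic_def)
  have img: "(\<lambda>u. G (-u)) ` {0..} = G ` {..0}"
    using image_image[of G uminus "{0::real..}"] by simp
  show ?thesis
  proof (rule that[OF G])
    show "finite_hausdorff_dist (G ` {0..}) (\<beta> ` {0..})"
      by (rule finite_hausdorff_distI[OF G\<beta> ray_near_quasi_ray[OF \<beta>g(1) Gp(1) order_refl G\<beta>]])
    show "finite_hausdorff_dist (G ` {..0}) (\<alpha> ` {0..})"
      using finite_hausdorff_distI[OF G\<alpha> ray_near_quasi_ray[OF \<alpha>g(1) Gp(2) order_refl G\<alpha>]]
      by (simp add: img)
  qed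
qed

section \<open>Boundary points and ideal triangles\<close>

lemma morse_set_mono:
  assumes "morse_set N S" "\<And>L e. 1 \<le> L \<Longrightarrow> 0 \<le> e \<Longrightarrow> N L e \<le> N' L e"
  shows "morse_set N' S"
  unfolding morse_set_def
proof (intro allI impI ballI, elim conjE)
  fix L e s t \<beta> u
  assume *: "s \<le> t" "quasi_geodesic L e {s..t} \<beta>" "\<beta> s \<in> S" "\<beta> t \<in> S" "u \<in> {s..t}"
  then have "infdist (\<beta> u) S \<le> N L e" using assms(1) unfolding morse_set_def by blast
  also have "\<dots> \<le> N' L e" using quasi_geodesic_shape[OF *(2)] by (intro assms)
  finally show "infdist (\<beta> u) S \<le> N' L e" .
qed

lemma ray_class_eq:
  assumes "b \<in> visual_boundary p" "\<gamma> \<in> b"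
  shows "b = {\<delta>. geodesic_ray p \<delta> \<and> finite_hausdorff_dist (\<delta> ` {0..}) (\<gamma> ` {0..})}"
proof -
  obtain \<alpha> where \<alpha>: "geodesic_ray p \<alpha>" "b = asymptotic p `` {\<alpha>}"
    using assms(1) unfolding visual_boundary_def by (auto elim: quotientE)
  have "\<gamma> \<in> asymptotic p `` {\<alpha>}" using assms(2) \<alpha> by simp
  then have "(\<alpha>, \<gamma>) \<in> asymptotic p" by simp
  then have "b = asymptotic p `` {\<gamma>}" using equiv_class_eq[OF equiv_asymptotic] \<alpha> by blast
  moreover have "geodesic_ray p \<gamma>" using \<open>(\<alpha>, \<gamma>) \<in> asymptotic p\<close> by (simp add: asymptotic_def)
  ultimately show ?thesis
    by (auto simp: asymptotic_def intro: finite_hausdorff_dist_sym)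
qed

lemma ray_class_in_visual_boundary:
  assumes "geodesic_ray p \<gamma>"
  shows "{\<delta>. geodesic_ray p \<delta> \<and> finite_hausdorff_dist (\<delta> ` {0..}) (\<gamma> ` {0..})} \<in> visual_boundary p"
proof -
  have "{\<delta>. geodesic_ray p \<delta> \<and> finite_hausdorff_dist (\<delta> ` {0..}) (\<gamma> ` {0..})} = asymptotic p `` {\<gamma>}"
    using assms by (auto simp: asymptotic_def intro: finite_hausdorff_dist_sym)
  then show ?thesis using assms by (auto simp: visual_boundary_def intro: quotientI)
qed

lemma visual_boundary_nonempty:
  assumes "b \<in> visual_boundary p" obtains \<gamma> where "\<gamma> \<in> b"
  using assms in_quotient_imp_non_empty[OF equiv_asymptotic] unfolding visual_boundary_def by blast

lemma visual_boundary_ray: "b \<in> visual_boundary p \<Longrightarrow> \<gamma> \<in> b \<Longrightarrow> geodesic_ray p \<gamma>"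
  using ray_class_eq by blast

lemma visual_boundary_asymptotic:
  "b \<in> visual_boundary p \<Longrightarrow> \<gamma> \<in> b \<Longrightarrow> \<delta> \<in> b \<Longrightarrow> finite_hausdorff_dist (\<gamma> ` {0..}) (\<delta> ` {0..})"
  using ray_class_eq by blast

lemma visual_boundary_eqI:
  assumes "b \<in> visual_boundary p" "c \<in> visual_boundary p" "\<beta> \<in> b" "\<gamma> \<in> c"
    "finite_hausdorff_dist (\<beta> ` {0..}) (\<gamma> ` {0..})"
  shows "b = c"
  using assms(5) unfolding ray_class_eq[OF assms(1,3)] ray_class_eq[OF assms(2,4)]
  by (blast intro: finite_hausdorff_dist_trans finite_hausdorff_dist_sym)

lemma morse_boundary_visual: "b \<in> morse_boundary p \<Longrightarrow> b \<in> visual_boundary p"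
  by (auto simp: morse_boundary_def morse_stratum_def)

section \<open>Ends of lines and tuples of boundary points\<close>

definition limits_to :: "(real \<Rightarrow> 'a::metric_space) \<Rightarrow> 'a boundary_point \<Rightarrow> bool" where
  "limits_to \<gamma> b \<longleftrightarrow> (\<exists>\<beta>\<in>b. finite_hausdorff_dist (\<gamma> ` {0..}) (\<beta> ` {0..}))"

lemma image_reverse: "(\<lambda>u::real. \<gamma> (-u)) ` {0..} = \<gamma> ` {..0}"
  using image_image[of \<gamma> uminus "{0::real..}"] by simp

lemma geodesic_between_ideal:
  "geodesic_between (Ideal a) (Ideal b) I \<gamma> \<longleftrightarrow>
     I = UNIV \<and> geodesic UNIV \<gamma> \<and> limits_to (\<lambda>u. \<gamma> (-u)) a \<and> limits_to \<gamma> b"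
  by (auto simp: limits_to_def image_reverse)

lemma limits_to_asymptotic:
  assumes "b \<in> visual_boundary p" "limits_to \<gamma> b" "limits_to \<delta> b"
  shows "finite_hausdorff_dist (\<gamma> ` {0..}) (\<delta> ` {0..})"
  using assms visual_boundary_asymptotic[OF assms(1)] unfolding limits_to_def
  by (blast intro: finite_hausdorff_dist_trans finite_hausdorff_dist_sym)

lemma limits_to_shift:
  assumes "geodesic UNIV \<gamma>"
  shows "limits_to (\<lambda>u. \<gamma> (s + u)) b \<longleftrightarrow> limits_to \<gamma> b"
    and "limits_to (\<lambda>u. \<gamma> (s - u)) b \<longleftrightarrow> limits_to (\<lambda>u. \<gamma> (-u)) b"
proof -
  have *: "limits_to \<alpha> b \<longleftrightarrow> limits_to \<beta> b" if "\<And>t. dist (\<alpha> t) (\<beta> t) \<le> \<bar>s\<bar>" for \<alpha> \<beta> :: "real \<Rightarrow> 'a"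
  proof -
    have "finite_hausdorff_dist (\<alpha> ` {0..}) (\<beta> ` {0..})"
      using that by (intro finite_hausdorff_dist_rays_pointwise)
    then show ?thesis unfolding limits_to_def
      by (meson finite_hausdorff_dist_sym finite_hausdorff_dist_trans)
  qed
  show "limits_to (\<lambda>u. \<gamma> (s + u)) b \<longleftrightarrow> limits_to \<gamma> b"
    "limits_to (\<lambda>u. \<gamma> (s - u)) b \<longleftrightarrow> limits_to (\<lambda>u. \<gamma> (-u)) b"
    using assms by (intro *; simp add: geodesicD)+
qed

lemma boundary_tuples_pair:
  assumes "xs \<in> boundary_tuples p n N" "a \<in> set xs" "b \<in> set xs" "a \<noteq> b"
  shows "[a, b] \<in> boundary_tuples p 2 N"
proof -
  have *: "set xs \<subseteq> morse_boundary p" "\<And>x y. x \<in> set xs \<Longrightarrow> y \<in> set xs \<Longrightarrow> x \<noteq> y \<Longrightarrow>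
      (\<forall>I \<gamma>. geodesic_between (Ideal x) (Ideal y) I \<gamma> \<longrightarrow> morse_geodesic N I \<gamma>)"
    using assms(1) unfolding boundary_tuples_def by blast+
  have "a \<in> morse_boundary p" "b \<in> morse_boundary p" using *(1) assms(2,3) by auto
  then show ?thesis
    unfolding boundary_tuples_def using *(2)[OF assms(2-4)] *(2)[OF assms(3,2)] assms(4)
    by (simp del: geodesic_between.simps)
qed

lemma boundary_tuples_pairD:
  assumes "[a, b] \<in> boundary_tuples p 2 N"
  shows "a \<noteq> b" "a \<in> morse_boundary p" "b \<in> morse_boundary p"
    "geodesic_between (Ideal a) (Ideal b) I \<gamma> \<Longrightarrow> morse_geodesic N I \<gamma>"
    "geodesic_between (Ideal b) (Ideal a) I \<gamma> \<Longrightarrow> morse_geodesic N I \<gamma>"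
proof -
  show ab: "a \<noteq> b" "a \<in> morse_boundary p" "b \<in> morse_boundary p"
    using assms by (auto simp: boundary_tuples_def)
  have *: "\<forall>x\<in>set [a, b]. \<forall>y\<in>set [a, b]. x \<noteq> y \<longrightarrow>
      (\<forall>I \<gamma>. geodesic_between (Ideal x) (Ideal y) I \<gamma> \<longrightarrow> morse_geodesic N I \<gamma>)"
    using assms unfolding boundary_tuples_def by blast
  show "geodesic_between (Ideal a) (Ideal b) I \<gamma> \<Longrightarrow> morse_geodesic N I \<gamma>"
    "geodesic_between (Ideal b) (Ideal a) I \<gamma> \<Longrightarrow> morse_geodesic N I \<gamma>"
    using *[rule_format, of a b I \<gamma>] *[rule_format, of b a I \<gamma>] ab(1)
    by (simp_all del: geodesic_between.simps)
qed

text \<open>The condition on tuples quantifies over all lines between two points and says nothing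
  unless a line exists. The gauges of the two rays are merged by a pointwise maximum.\<close>

lemma ideal_line_exists:
  fixes p :: "'a::heine_borel"
  assumes gs: "geodesic_space TYPE('a)" and ab: "a \<in> morse_boundary p" "b \<in> morse_boundary p" "a \<noteq> b"
  obtains \<gamma> where "geodesic_between (Ideal a) (Ideal b) UNIV \<gamma>"
proof -
  obtain M \<alpha> where \<alpha>: "morse_gauge M" "\<alpha> \<in> a" "morse_geodesic M {0..} \<alpha>"
    using ab(1) by (auto simp: morse_boundary_def morse_stratum_def)
  obtain N \<beta> where \<beta>: "morse_gauge N" "\<beta> \<in> b" "morse_geodesic N {0..} \<beta>"
    using ab(2) by (auto simp: morse_boundary_def morse_stratum_def)
  note vab = morse_boundary_visual[OF ab(1)] morse_boundary_visual[OF ab(2)]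
  let ?K = "\<lambda>L e. max (M L e) (N L e)"
  have "morse_set M (\<alpha> ` {0..})" "morse_set N (\<beta> ` {0..})"
    using morse_geodesic_morse_set[OF \<alpha>(3)] morse_geodesic_morse_set[OF \<beta>(3)] by auto
  then have K: "morse_set ?K (\<alpha> ` {0..})" "morse_set ?K (\<beta> ` {0..})"
    by (auto intro: morse_set_mono)
  have "\<not> finite_hausdorff_dist (\<alpha> ` {0..}) (\<beta> ` {0..})"
    using visual_boundary_eqI[OF vab \<alpha>(2) \<beta>(2)] ab(3) by blast
  from geodesic_line_exists[OF gs visual_boundary_ray[OF vab(1) \<alpha>(2)] K(1)
      visual_boundary_ray[OF vab(2) \<beta>(2)] K(2) this]
  obtain \<gamma> where "geodesic UNIV \<gamma>" "finite_hausdorff_dist (\<gamma> ` {..0}) (\<alpha> ` {0..})"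
    "finite_hausdorff_dist (\<gamma> ` {0..}) (\<beta> ` {0..})" by blast
  then have "geodesic_between (Ideal a) (Ideal b) UNIV \<gamma>" using \<alpha>(2) \<beta>(2) by auto
  then show ?thesis by (rule that)
qed

section \<open>Fellow travelling and centers of ideal triangles\<close>

definition fellow_bound :: "gauge_fun \<Rightarrow> real \<Rightarrow> real" where
  "fellow_bound N c = 2 * max c (N 3 (2 + 2 * c) + 1) + c"

text \<open>Appending to a geodesic and moving its start by \<open>c\<close> give the constants
  \<open>3\<close> and \<open>2 + 2 * c\<close>. A point \<open>\<delta> t\<close> is thus within
  \<open>C\<close> of some \<open>\<gamma> v\<close>; as the rays start within \<open>c\<close>,
  \<open>v\<close> and \<open>t\<close> differ by at most \<open>c + C\<close>, for a total of
  \<open>2 * C + c\<close>.\<close>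

lemma asymptotic_rays_fellow_travel:
  fixes \<gamma> \<delta> :: "real \<Rightarrow> 'a::metric_space"
  assumes gs: "geodesic_space TYPE('a)" and \<gamma>: "geodesic {0..} \<gamma>" "morse_set N (\<gamma> ` {0..})"
    and \<delta>: "geodesic {0..} \<delta>" and c: "dist (\<gamma> 0) (\<delta> 0) \<le> c"
    and fhd: "finite_hausdorff_dist (\<gamma> ` {0..}) (\<delta> ` {0..})" and t: "t \<ge> 0"
  shows "dist (\<gamma> t) (\<delta> t) \<le> fellow_bound N c"
proof -
  define C where "C = max c (N 3 (2 + 2 * c) + 1)"
  obtain r where r: "\<delta> ` {0..} \<subseteq> thick r (\<gamma> ` {0..})"
    using fhd by (auto simp: finite_hausdorff_dist_thick)
  have "\<delta> 0 \<in> thick c (\<gamma> ` {0..})" using c by (intro thickI[of "\<gamma> 0"]) (auto simp: dist_commute)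
  then have "\<delta> ` {0..} \<subseteq> thick C (\<gamma> ` {0..})"
    using quasi_ray_uniformly_near[OF gs \<gamma>(2) geodesic_quasi_geodesic[OF \<delta>] _ r] by (simp add: C_def)
  then have "\<delta> t \<in> thick C (\<gamma> ` {0..})" using t by auto
  then obtain v where v: "v \<ge> 0" "dist (\<delta> t) (\<gamma> v) \<le> C" by (auto simp: mem_thick)
  have "dist (\<delta> 0) (\<delta> t) = t" "dist (\<gamma> 0) (\<gamma> v) = v" "dist (\<gamma> t) (\<gamma> v) = \<bar>t - v\<bar>"
    using geodesicD[OF \<delta>, of 0 t] geodesicD[OF \<gamma>(1), of 0 v] geodesicD[OF \<gamma>(1), of t v] t v by auto
  moreover have "t \<le> c + (v + C)"
    using calculation c v dist_triangle[of "\<delta> 0" "\<delta> t" "\<gamma> 0"] dist_triangle[of "\<gamma> 0" "\<delta> t" "\<gamma> v"]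
    by (simp add: dist_commute)
  moreover have "v \<le> c + (t + C)"
    using calculation(1,2) c v dist_triangle[of "\<gamma> 0" "\<gamma> v" "\<delta> 0"] dist_triangle[of "\<delta> 0" "\<gamma> v" "\<delta> t"]
    by (simp add: dist_commute)
  ultimately have "dist (\<gamma> t) (\<gamma> v) \<le> c + C" by linarith
  then show ?thesis
    using v dist_triangle[of "\<gamma> t" "\<delta> t" "\<gamma> v"] by (simp add: fellow_bound_def C_def dist_commute)
qed

text \<open>\<gamma> runs towards \<open>b\<close> and \<delta> away from it, as consecutive sides
  of a triangle do. The subray of \<gamma> starting at \<open>s\<close> has the same gauge, by the
  convention on subgeodesics.\<close>

lemma line_ends_fellow_travel:
  fixes \<gamma> \<delta> :: "real \<Rightarrow> 'a::metric_space"
  assumes gs: "geodesic_space TYPE('a)" and b: "b \<in> visual_boundary p"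
    and \<gamma>: "morse_geodesic N UNIV \<gamma>" "limits_to \<gamma> b"
    and \<delta>: "geodesic UNIV \<delta>" "limits_to (\<lambda>u. \<delta> (-u)) b"
    and c: "dist (\<gamma> s) (\<delta> t) \<le> c" and u: "u \<ge> 0"
  shows "dist (\<gamma> (s + u)) (\<delta> (t - u)) \<le> fellow_bound N c"
proof (rule asymptotic_rays_fellow_travel[OF gs, of "\<lambda>u. \<gamma> (s + u)" N "\<lambda>u. \<delta> (t - u)"])
  have \<gamma>g: "geodesic UNIV \<gamma>" using \<gamma>(1) by (simp add: morse_geodesic_def)
  show "geodesic {0..} (\<lambda>u. \<gamma> (s + u))" "geodesic {0..} (\<lambda>u. \<delta> (t - u))"
    using \<gamma>g \<delta>(1) by (auto simp: geodesic_def)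
  have "(\<lambda>u. \<gamma> (s + u)) ` {0..} = \<gamma> ` {s..}"
    using image_image[of \<gamma> "(+) s" "{0..}"] by simp
  then show "morse_set N ((\<lambda>u. \<gamma> (s + u)) ` {0..})"
    using morse_geodesic_morse_set[OF \<gamma>(1), of "{s..}"] by simp
  show "finite_hausdorff_dist ((\<lambda>u. \<gamma> (s + u)) ` {0..}) ((\<lambda>u. \<delta> (t - u)) ` {0..})"
    by (rule limits_to_asymptotic[OF b]) (use \<gamma> \<delta> \<gamma>g limits_to_shift in blast)+
qed (use c u in auto)

text \<open>The argument around the triangle gives \<open>2 * T \<le> 6 * k + 3 * F\<close> with
  \<open>F = fellow_bound N (2 * k)\<close>, and the centers are at most \<open>2 * k + T\<close>
  apart; the factor 3/2 of \<open>F\<close> is rounded up to 2.\<close>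

definition center_bound :: "gauge_fun \<Rightarrow> real \<Rightarrow> real" where
  "center_bound N k = 2 * \<bar>fellow_bound N (2 * k)\<bar> + 5 * k"

text \<open>If \<open>x'\<close> lies \<open>T\<close> further than \<open>x\<close> towards \<open>b\<close> on the side from \<open>a\<close> to \<open>b\<close>, then going once around the
  triangle, by fellow travelling at each vertex, it also lies about \<open>T\<close> further towards \<open>a\<close> on that side.\<close>

lemma ideal_triangle_centers_close:
  fixes \<gamma>\<^sub>1 \<gamma>\<^sub>2 \<gamma>\<^sub>3 :: "real \<Rightarrow> 'a::metric_space"
  assumes gs: "geodesic_space TYPE('a)"
    and v: "a \<in> visual_boundary p" "b \<in> visual_boundary p" "c \<in> visual_boundary p"
    and \<gamma>: "geodesic_between (Ideal a) (Ideal b) UNIV \<gamma>\<^sub>1" "geodesic_between (Ideal b) (Ideal c) UNIV \<gamma>\<^sub>2"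
      "geodesic_between (Ideal c) (Ideal a) UNIV \<gamma>\<^sub>3"
    and M: "morse_geodesic N UNIV \<gamma>\<^sub>1" "morse_geodesic N UNIV \<gamma>\<^sub>2" "morse_geodesic N UNIV \<gamma>\<^sub>3"
    and x: "x \<in> thick k (range \<gamma>\<^sub>1)" "x \<in> thick k (range \<gamma>\<^sub>2)" "x \<in> thick k (range \<gamma>\<^sub>3)"
    and x': "x' \<in> thick k (range \<gamma>\<^sub>1)" "x' \<in> thick k (range \<gamma>\<^sub>2)" "x' \<in> thick k (range \<gamma>\<^sub>3)"
  shows "dist x x' \<le> center_bound N k"
proof -
  note g = \<gamma>[unfolded geodesic_between_ideal]
  have main: "dist x x' \<le> center_bound N k"
    if s: "dist x (\<gamma>\<^sub>1 s1) \<le> k" "dist x (\<gamma>\<^sub>2 s2) \<le> k" "dist x (\<gamma>\<^sub>3 s3) \<le> k"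
      and t: "dist x' (\<gamma>\<^sub>1 t1) \<le> k" "dist x' (\<gamma>\<^sub>2 t2) \<le> k" "dist x' (\<gamma>\<^sub>3 t3) \<le> k"
      and le: "s1 \<le> t1" for x x' s1 s2 s3 t1 t2 t3
  proof -
    define T where "T = t1 - s1"
    define F where "F = fellow_bound N (2 * k)"
    have T: "T \<ge> 0" using le by (simp add: T_def)
    have k2: "dist y z \<le> 2 * k" if "dist w y \<le> k" "dist w z \<le> k" for w y z :: 'a
      using that dist_triangle[of y z w] by (simp add: dist_commute)
    have "dist (\<gamma>\<^sub>1 (s1 + T)) (\<gamma>\<^sub>2 (s2 - T)) \<le> F" unfolding F_def
      by (rule line_ends_fellow_travel[OF gs v(2) M(1)]) (use g T k2[OF s(1,2)] in auto)
    then have "dist (\<gamma>\<^sub>2 t2) (\<gamma>\<^sub>2 (s2 - T)) \<le> 2 * k + F"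
      using k2[OF t(2,1)] dist_triangle[of "\<gamma>\<^sub>2 t2" "\<gamma>\<^sub>2 (s2 - T)" "\<gamma>\<^sub>1 t1"] by (simp add: T_def)
    then have 1: "\<bar>t2 - (s2 - T)\<bar> \<le> 2 * k + F" using g geodesicD[of UNIV \<gamma>\<^sub>2] by simp
    have "dist (\<gamma>\<^sub>2 (t2 + T)) (\<gamma>\<^sub>3 (t3 - T)) \<le> F" unfolding F_def
      by (rule line_ends_fellow_travel[OF gs v(3) M(2)]) (use g T k2[OF t(2,3)] in auto)
    moreover have "dist (\<gamma>\<^sub>2 s2) (\<gamma>\<^sub>2 (t2 + T)) \<le> 2 * k + F"
      using 1 g geodesicD[of UNIV \<gamma>\<^sub>2 s2 "t2 + T"] by simp
    ultimately have "dist (\<gamma>\<^sub>3 s3) (\<gamma>\<^sub>3 (t3 - T)) \<le> 4 * k + 2 * F"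
      using k2[OF s(3,2)] dist_triangle[of "\<gamma>\<^sub>3 s3" "\<gamma>\<^sub>3 (t3 - T)" "\<gamma>\<^sub>2 s2"]
        dist_triangle[of "\<gamma>\<^sub>2 s2" "\<gamma>\<^sub>3 (t3 - T)" "\<gamma>\<^sub>2 (t2 + T)"] by simp
    then have 2: "\<bar>s3 - (t3 - T)\<bar> \<le> 4 * k + 2 * F" using g geodesicD[of UNIV \<gamma>\<^sub>3] by simp
    have "dist (\<gamma>\<^sub>3 (s3 + T)) (\<gamma>\<^sub>1 (s1 - T)) \<le> F" unfolding F_def
      by (rule line_ends_fellow_travel[OF gs v(1) M(3)]) (use g T k2[OF s(3,1)] in auto)
    moreover have "dist (\<gamma>\<^sub>3 t3) (\<gamma>\<^sub>3 (s3 + T)) \<le> 4 * k + 2 * F"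
      using 2 g geodesicD[of UNIV \<gamma>\<^sub>3 t3 "s3 + T"] by simp
    ultimately have "dist (\<gamma>\<^sub>1 t1) (\<gamma>\<^sub>1 (s1 - T)) \<le> 6 * k + 3 * F"
      using k2[OF t(1,3)] dist_triangle[of "\<gamma>\<^sub>1 t1" "\<gamma>\<^sub>1 (s1 - T)" "\<gamma>\<^sub>3 t3"]
        dist_triangle[of "\<gamma>\<^sub>3 t3" "\<gamma>\<^sub>1 (s1 - T)" "\<gamma>\<^sub>3 (s3 + T)"] by simp
    \<comment> \<open>Back on the first side the displacement has changed direction:
      \<open>t1 = s1 + T\<close> is close to \<open>s1 - T\<close>.\<close>
    then have "2 * T \<le> 6 * k + 3 * F"
      using g geodesicD[of UNIV \<gamma>\<^sub>1 t1 "s1 - T"] T by (simp add: T_def)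
    moreover have "dist x x' \<le> 2 * k + T"
      using s(1) t(1) dist_triangle[of x x' "\<gamma>\<^sub>1 s1"] dist_triangle[of "\<gamma>\<^sub>1 s1" x' "\<gamma>\<^sub>1 t1"]
        g geodesicD[of UNIV \<gamma>\<^sub>1 s1 t1] le by (simp add: T_def dist_commute)
    ultimately show ?thesis using le unfolding center_bound_def F_def by linarith
  qed
  obtain s1 s2 s3 where s: "dist x (\<gamma>\<^sub>1 s1) \<le> k" "dist x (\<gamma>\<^sub>2 s2) \<le> k" "dist x (\<gamma>\<^sub>3 s3) \<le> k"
    using x by (auto simp: mem_thick)
  obtain t1 t2 t3 where t: "dist x' (\<gamma>\<^sub>1 t1) \<le> k" "dist x' (\<gamma>\<^sub>2 t2) \<le> k" "dist x' (\<gamma>\<^sub>3 t3) \<le> k"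
    using x' by (auto simp: mem_thick)
  show ?thesis
  proof (cases "s1 \<le> t1")
    case True
    then show ?thesis by (rule main[OF s t])
  next
    case False
    then show ?thesis using main[OF t s] by (simp add: dist_commute)
  qed
qed

section \<open>The map induced by a quasi-isometry\<close>

text \<open>Both maps share the constants, so exchanging \<open>f\<close> and \<open>g\<close> gives
  another instance and nothing has to be proved twice.\<close>

locale quasi_inverses =
  fixes f :: "'a::heine_borel \<Rightarrow> 'b::heine_borel" and g :: "'b \<Rightarrow> 'a"
    and L e D :: real
  assumes domain_geodesic: "geodesic_space TYPE('a)" and codomain_geodesic: "geodesic_space TYPE('b)"
    and qi_f: "qi_embedding_on L e UNIV f" and qi_g: "qi_embedding_on L e UNIV g"
    and gf: "dist (g (f x)) x \<le> D" and fg: "dist (f (g y)) y \<le> D"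
begin

lemma inverse_pair: "quasi_inverses g f L e D"
  by unfold_locales (rule domain_geodesic codomain_geodesic qi_f qi_g gf fg)+

lemma L_ge_1: "1 \<le> L" and e_nonneg: "0 \<le> e"
  using qi_embedding_onD(1,2)[OF qi_f] by auto

lemma thick_image: "A \<subseteq> thick r B \<Longrightarrow> f ` A \<subseteq> thick (L * r + e) (f ` B)"
proof
  fix y assume A: "A \<subseteq> thick r B" and "y \<in> f ` A"
  then obtain a b where ab: "y = f a" "b \<in> B" "dist a b \<le> r" by (auto simp: mem_thick subset_iff)
  have "dist (f a) (f b) \<le> L * dist a b + e" using qi_embedding_onD(4)[OF qi_f] by simp
  also have "\<dots> \<le> L * r + e" using ab L_ge_1 by (simp add: mult_left_mono)
  finally show "y \<in> thick (L * r + e) (f ` B)" using ab by (intro thickI[of "f b"]) auto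
qed

lemma hausdorff_image: "finite_hausdorff_dist A B \<Longrightarrow> finite_hausdorff_dist (f ` A) (f ` B)"
  unfolding finite_hausdorff_dist_thick using thick_image by blast

lemma hausdorff_gf: "finite_hausdorff_dist (g ` f ` A) A"
proof (rule finite_hausdorff_distI)
  show "g ` f ` A \<subseteq> thick D A" using gf by (auto intro: thickI)
  show "A \<subseteq> thick D (g ` f ` A)"
  proof
    fix x assume "x \<in> A"
    then show "x \<in> thick D (g ` f ` A)" using gf[of x] by (intro thickI[of "g (f x)"]) (auto simp: dist_commute)
  qed
qed

text \<open>A coarse adjunction. It turns the definition of the induced map, a condition on
  \<open>f\<close>-images in the target, into one on \<open>g\<close>-images in the domain, where
  the Morse property is known.\<close>

lemma hausdorff_transfer: "finite_hausdorff_dist (f ` A) B \<longleftrightarrow> finite_hausdorff_dist A (g ` B)"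
proof
  assume "finite_hausdorff_dist (f ` A) B"
  then have "finite_hausdorff_dist (g ` f ` A) (g ` B)"
    by (rule quasi_inverses.hausdorff_image[OF inverse_pair])
  then show "finite_hausdorff_dist A (g ` B)"
    using hausdorff_gf finite_hausdorff_dist_sym finite_hausdorff_dist_trans by blast
next
  assume "finite_hausdorff_dist A (g ` B)"
  then have "finite_hausdorff_dist (f ` A) (f ` g ` B)" by (rule hausdorff_image)
  then show "finite_hausdorff_dist (f ` A) B"
    using quasi_inverses.hausdorff_gf[OF inverse_pair] finite_hausdorff_dist_trans by blast
qed

lemma induced_map_iff:
  assumes "b \<in> visual_boundary p" "\<gamma> \<in> b"
  shows "\<delta> \<in> induced_map q f b \<longleftrightarrow>
    geodesic_ray q \<delta> \<and> finite_hausdorff_dist (\<delta> ` {0..}) (f ` \<gamma> ` {0..})"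
proof
  assume "\<delta> \<in> induced_map q f b"
  then obtain \<gamma>' where "geodesic_ray q \<delta>" "\<gamma>' \<in> b" "finite_hausdorff_dist (\<delta> ` {0..}) (f ` \<gamma>' ` {0..})"
    by (auto simp: induced_map_def)
  then show "geodesic_ray q \<delta> \<and> finite_hausdorff_dist (\<delta> ` {0..}) (f ` \<gamma> ` {0..})"
    using hausdorff_image[OF visual_boundary_asymptotic[OF assms(1) _ assms(2)]]
      finite_hausdorff_dist_trans by blast
qed (use assms in \<open>auto simp: induced_map_def\<close>)

lemma quasi_geodesic_image: "geodesic I \<delta> \<Longrightarrow> quasi_geodesic L e I (\<lambda>u. g (\<delta> u))"
  using geodesic_quasi_geodesic[of I \<delta>] qi_embedding_on_comp[of 1 0 I \<delta> L e g] qi_g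
  by (simp add: quasi_geodesic_def)

section \<open>Transport of rays\<close>

definition ray_const :: "'a \<Rightarrow> 'b \<Rightarrow> gauge_fun \<Rightarrow> real" where
  "ray_const p q N = (let c = dist (g q) p in
     L + 3 * max c (N (2 * L + 1) (L * (1 + e) + 1 + 2 * c) + 1) + e + c)"

lemma ray_const_nonneg: "0 \<le> ray_const p q N"
  using L_ge_1 e_nonneg by (auto simp: ray_const_def Let_def intro!: add_nonneg_nonneg max.coboundedI1)

text \<open>The arbitrary \<open>r\<close> is replaced by a constant depending only on the gauge,
  the quasi-isometry constants and \<open>c = dist (g q) p\<close>, the distance between the
  starting points. The constant is that of \<open>ray_near_quasi_ray\<close>, which also dominates
  the first inclusion.\<close>

lemma quasi_ray_close:
  assumes \<gamma>: "geodesic_ray p \<gamma>" "morse_set N (\<gamma> ` {0..})" and \<delta>: "geodesic_ray q \<delta>"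
    and near: "g ` \<delta> ` {0..} \<subseteq> thick r (\<gamma> ` {0..})"
  shows "g ` \<delta> ` {0..} \<subseteq> thick (ray_const p q N) (\<gamma> ` {0..})"
    and "\<gamma> ` {0..} \<subseteq> thick (ray_const p q N) (g ` \<delta> ` {0..})"
proof -
  define c where "c = dist (g q) p"
  define A where "A = max c (N (2 * L + 1) (L * (1 + e) + 1 + 2 * c) + 1)"
  have \<gamma>g: "geodesic {0..} \<gamma>" "\<gamma> 0 = p" and \<delta>g: "geodesic {0..} \<delta>" "\<delta> 0 = q"
    using \<gamma>(1) \<delta> by (auto simp: geodesic_ray_def)
  note qg = quasi_geodesic_image[OF \<delta>g(1)]
  have c0: "g (\<delta> 0) \<in> thick c (\<gamma> ` {0..})" "dist (g (\<delta> 0)) (\<gamma> 0) \<le> c"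
    using \<gamma>g \<delta>g by (auto simp: c_def intro!: thickI[of "\<gamma> 0"])
  have 1: "(\<lambda>u. g (\<delta> u)) ` {0..} \<subseteq> thick A (\<gamma> ` {0..})" unfolding A_def
    by (rule quasi_ray_uniformly_near[OF domain_geodesic \<gamma>(2) qg c0(1)])
      (use near in \<open>simp add: image_image\<close>)
  have 2: "\<gamma> ` {0..} \<subseteq> thick (ray_const p q N) ((\<lambda>u. g (\<delta> u)) ` {0..})"
    using ray_near_quasi_ray[OF \<gamma>g(1) qg c0(2) 1] by (simp add: ray_const_def Let_def A_def c_def)
  then show "\<gamma> ` {0..} \<subseteq> thick (ray_const p q N) (g ` \<delta> ` {0..})" by (simp add: image_image)
  have "0 \<le> A" "0 \<le> c" by (auto simp: A_def c_def intro: max.coboundedI1)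
  then have "A \<le> ray_const p q N"
    using L_ge_1 e_nonneg by (simp add: ray_const_def Let_def A_def[symmetric] c_def[symmetric])
  then show "g ` \<delta> ` {0..} \<subseteq> thick (ray_const p q N) (\<gamma> ` {0..})"
    using 1 thick_mono[OF _ subset_refl] by (fastforce simp: image_image)
qed

lemma asymptotic_ray_close:
  assumes "geodesic_ray p \<gamma>" "morse_set N (\<gamma> ` {0..})" "geodesic_ray q \<delta>"
    and "finite_hausdorff_dist (\<delta> ` {0..}) (f ` \<gamma> ` {0..})"
  shows "g ` \<delta> ` {0..} \<subseteq> thick (ray_const p q N) (\<gamma> ` {0..})"
    and "\<gamma> ` {0..} \<subseteq> thick (ray_const p q N) (g ` \<delta> ` {0..})"
proof -
  have "finite_hausdorff_dist (\<gamma> ` {0..}) (g ` \<delta> ` {0..})"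
    using assms(4) hausdorff_transfer finite_hausdorff_dist_sym by blast
  then obtain r where "g ` \<delta> ` {0..} \<subseteq> thick r (\<gamma> ` {0..})"
    by (auto simp: finite_hausdorff_dist_thick)
  from quasi_ray_close[OF assms(1-3) this]
  show "g ` \<delta> ` {0..} \<subseteq> thick (ray_const p q N) (\<gamma> ` {0..})"
    "\<gamma> ` {0..} \<subseteq> thick (ray_const p q N) (g ` \<delta> ` {0..})" .
qed

text \<open>The ray is a limit of segments from \<open>q\<close> to the points
  \<open>f (\<gamma> n)\<close>. The \<open>g\<close>-images of these segments have both ends near
  \<gamma>, so they stay uniformly near it, and this survives in the limit.\<close>

lemma transported_ray_exists:
  assumes \<gamma>: "geodesic_ray p \<gamma>" "morse_set N (\<gamma> ` {0..})"
  obtains \<delta> where "geodesic_ray q \<delta>" "finite_hausdorff_dist (\<delta> ` {0..}) (f ` \<gamma> ` {0..})"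
proof -
  have \<gamma>g: "geodesic {0..} \<gamma>" "\<gamma> 0 = p" using \<gamma>(1) by (auto simp: geodesic_ray_def)
  define l where "l = (\<lambda>n. dist q (f (\<gamma> (real n))))"
  have "\<exists>\<delta>. geodesic {0..l n} \<delta> \<and> \<delta> 0 = q \<and> \<delta> (l n) = f (\<gamma> (real n))" for n
  proof -
    obtain s t \<delta> where \<delta>: "s \<le> t" "geodesic {s..t} \<delta>" "\<delta> s = q" "\<delta> t = f (\<gamma> (real n))"
      using codomain_geodesic unfolding geodesic_space_def by meson
    have "t = s + l n" using geodesicD[OF \<delta>(2), of s t] \<delta> by (simp add: l_def)
    then show ?thesis
      by (intro exI[of _ "\<lambda>u. \<delta> (s + u)"]) (use \<delta> in \<open>auto simp: geodesic_def\<close>)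
  qed
  then obtain \<delta> where \<delta>: "\<And>n. geodesic {0..l n} (\<delta> n)" "\<And>n. \<delta> n 0 = q"
    "\<And>n. \<delta> n (l n) = f (\<gamma> (real n))" by metis
  have l0: "0 \<le> l n" for n by (simp add: l_def)
  \<comment> \<open>The lower bound for \<open>f\<close> makes the segments arbitrarily long, so the
    limit is a full ray.\<close>
  have ev: "\<forall>\<^sub>F n in sequentially. u \<in> {0..l n}" if u: "u \<in> {0..}" for u
  proof -
    have "\<forall>\<^sub>F n in sequentially. L * (u + dist q (f p) + e) \<le> real n"
      using filterlim_real_sequentially unfolding filterlim_at_top by blast
    then show ?thesis
    proof eventually_elim
      case (elim n)
      have "real n = dist p (\<gamma> (real n))" using geodesicD[OF \<gamma>g(1), of 0 "real n"] \<gamma>g by simp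
      also have "\<dots> \<le> L * (dist (f p) (f (\<gamma> (real n))) + e)" using qi_embedding_onD(3)[OF qi_f] by simp
      finally have "L * (u + dist q (f p) + e) \<le> L * (dist (f p) (f (\<gamma> (real n))) + e)"
        using elim by linarith
      then have "u + dist q (f p) \<le> dist (f p) (f (\<gamma> (real n)))" using L_ge_1 by simp
      then show ?case
        using u dist_triangle[of "f p" "f (\<gamma> (real n))" q] by (simp add: l_def dist_commute)
    qed
  qed
  have "bounded (range (\<lambda>n. \<delta> n 0))" by (simp add: \<delta>)
  then obtain s G where s: "strict_mono (s :: nat \<Rightarrow> nat)" and G: "geodesic {0..} G"
    and conv: "\<And>u. u \<in> {0..} \<Longrightarrow> (\<lambda>n. \<delta> (s n) u) \<longlonglongrightarrow> G u"
    using geodesic_subsequence[of "\<lambda>_. 0" l \<delta> "{0..}"] \<delta>(1) l0 ev by auto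
  have "G 0 = q" using LIMSEQ_unique[OF conv[of 0], of q] \<delta>(2) by simp
  with G have Gray: "geodesic_ray q G" by (simp add: geodesic_ray_def)
  \<comment> \<open>\<open>g q\<close> is compared with the start \<open>p\<close> of \<gamma>, and
    \<open>g (f (\<gamma> n))\<close> with \<open>\<gamma> n\<close>.\<close>
  define c where "c = max (dist (g q) p) D"
  define C where "C = max c (N L (e + 2 * c) + 1)"
  have near: "g (\<delta> n u) \<in> thick C (\<gamma> ` {0..})" if "u \<in> {0..l n}" for n u
    unfolding C_def
  proof (rule morse_set_near_ends[OF \<gamma>(2) quasi_geodesic_image[OF \<delta>(1)] _ _ that])
    show "g (\<delta> n 0) \<in> thick c (\<gamma> ` {0..})" by (rule thickI[OF imageI[of 0]]) (auto simp: \<delta> \<gamma>g(2) c_def)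
    show "g (\<delta> n (l n)) \<in> thick c (\<gamma> ` {0..})"
      by (rule thickI[of "\<gamma> (real n)"]) (auto simp: \<delta> c_def gf le_max_iff_disj)
  qed
  have "g ` G ` {0..} \<subseteq> thick (C + (L + e)) (\<gamma> ` {0..})"
  proof (rule subsetI, elim imageE, hypsubst)
    fix u :: real assume u: "u \<in> {0..}"
    have "\<forall>\<^sub>F n in sequentially. dist (\<delta> (s n) u) (G u) < 1" using tendstoD[OF conv[OF u], of 1] by simp
    with eventually_subseq[OF s ev[OF u]]
    have "\<forall>\<^sub>F n in sequentially. u \<in> {0..l (s n)} \<and> dist (\<delta> (s n) u) (G u) < 1"
      by (rule eventually_conj)
    then obtain n where n: "u \<in> {0..l (s n)}" "dist (\<delta> (s n) u) (G u) < 1"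
      using eventually_happens'[OF sequentially_bot] by blast
    have "dist (g (G u)) (g (\<delta> (s n) u)) \<le> L * dist (G u) (\<delta> (s n) u) + e"
      using qi_embedding_onD(4)[OF qi_g] by simp
    also have "\<dots> \<le> L + e" using n(2) L_ge_1 mult_left_mono[of "dist (G u) (\<delta> (s n) u)" 1 L]
      by (simp add: dist_commute)
    finally show "g (G u) \<in> thick (C + (L + e)) (\<gamma> ` {0..})" by (rule thick_close[OF near[OF n(1)]])
  qed
  from quasi_ray_close[OF \<gamma> Gray this]
  have "finite_hausdorff_dist (\<gamma> ` {0..}) (g ` G ` {0..})" by (intro finite_hausdorff_distI)
  then have "finite_hausdorff_dist (G ` {0..}) (f ` \<gamma> ` {0..})"
    using hausdorff_transfer finite_hausdorff_dist_sym by blast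
  with Gray show ?thesis by (rule that)
qed

text \<open>The induced map takes a set of rays as its value; once one transported ray exists, this
  set is its whole asymptotism class.\<close>

lemma induced_map_class:
  assumes b: "b \<in> morse_boundary p"
  obtains \<gamma> \<delta> where "\<gamma> \<in> b" "\<delta> \<in> induced_map q f b" "induced_map q f b \<in> visual_boundary q"
proof -
  obtain N \<gamma> where \<gamma>: "\<gamma> \<in> b" "morse_geodesic N {0..} \<gamma>"
    using b by (auto simp: morse_boundary_def morse_stratum_def)
  note vb = morse_boundary_visual[OF b]
  obtain \<delta> where \<delta>: "geodesic_ray q \<delta>" "finite_hausdorff_dist (\<delta> ` {0..}) (f ` \<gamma> ` {0..})"
    using transported_ray_exists[OF visual_boundary_ray[OF vb \<gamma>(1)]] morse_geodesic_morse_set[OF \<gamma>(2)]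
    by (metis closed_interval_simps(2) order_refl)
  have "induced_map q f b = {\<delta>'. geodesic_ray q \<delta>' \<and> finite_hausdorff_dist (\<delta>' ` {0..}) (\<delta> ` {0..})}"
    using induced_map_iff[OF vb \<gamma>(1)] \<delta>(2) finite_hausdorff_dist_sym finite_hausdorff_dist_trans by blast
  then have "induced_map q f b \<in> visual_boundary q"
    using ray_class_in_visual_boundary[OF \<delta>(1)] by simp
  moreover have "\<delta> \<in> induced_map q f b" using induced_map_iff[OF vb \<gamma>(1)] \<delta> by blast
  ultimately show ?thesis using that \<gamma>(1) by blast
qed

definition image_gauge :: "'a \<Rightarrow> 'b \<Rightarrow> gauge_fun \<Rightarrow> gauge_fun" where
  "image_gauge p q N = segment_gauge (transfer_gauge L e (ray_const p q N) N)"

lemma morse_gauge_image_gauge: "morse_gauge (image_gauge p q N)"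
  unfolding image_gauge_def using L_ge_1 e_nonneg ray_const_nonneg
  by (intro morse_gauge_segment_gauge morse_gauge_transfer_gauge) auto

text \<open>The gauge serves every ray of the image class, since the closeness constant depends on
  \<delta> only through its starting point \<open>q\<close>.\<close>

lemma induced_map_stratum:
  assumes N: "morse_gauge N" and b: "b \<in> morse_stratum p N"
    and \<delta>: "\<delta> \<in> induced_map q f b"
  shows "morse_geodesic (image_gauge p q N) {0..} \<delta>"
proof -
  obtain \<gamma> where \<gamma>: "\<gamma> \<in> b" "morse_geodesic N {0..} \<gamma>" and vb: "b \<in> visual_boundary p"
    using b by (auto simp: morse_stratum_def)
  have S: "morse_set N (\<gamma> ` {0..})" using morse_geodesic_morse_set[OF \<gamma>(2)] by simp
  have d: "geodesic_ray q \<delta>" "finite_hausdorff_dist (\<delta> ` {0..}) (f ` \<gamma> ` {0..})"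
    using \<delta> induced_map_iff[OF vb \<gamma>(1)] by auto
  note close = asymptotic_ray_close[OF visual_boundary_ray[OF vb \<gamma>(1)] S d]
  have "morse_set (transfer_gauge L e (ray_const p q N) N) (\<delta> ` {0..})"
    by (rule morse_set_qi_transfer[OF S qi_g ray_const_nonneg close])
  then show ?thesis
    unfolding image_gauge_def using d(1) L_ge_1 e_nonneg ray_const_nonneg
    by (intro morse_geodesicI morse_gauge_transfer_gauge) (auto simp: geodesic_ray_def)
qed

lemma induced_map_in_stratum:
  assumes N: "morse_gauge N" and b: "b \<in> morse_stratum p N"
  shows "induced_map q f b \<in> morse_stratum q (image_gauge p q N)"
proof -
  have "b \<in> morse_boundary p" using assms by (auto simp: morse_boundary_def)
  then obtain \<delta> where "\<delta> \<in> induced_map q f b" "induced_map q f b \<in> visual_boundary q"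
    by (rule induced_map_class)
  then show ?thesis using induced_map_stratum[OF assms] by (auto simp: morse_stratum_def)
qed

lemma induced_map_in_boundary:
  assumes "b \<in> morse_boundary p" shows "induced_map q f b \<in> morse_boundary q"
proof -
  obtain N where "morse_gauge N" "b \<in> morse_stratum p N"
    using assms by (auto simp: morse_boundary_def)
  from induced_map_in_stratum[OF this, of q] morse_gauge_image_gauge[of p q N] show ?thesis
    unfolding morse_boundary_def by blast
qed

lemma induced_map_inverse:
  assumes b: "b \<in> morse_boundary p"
  shows "induced_map p g (induced_map q f b) = b"
proof -
  obtain \<gamma> \<delta> where \<gamma>: "\<gamma> \<in> b" and \<delta>: "\<delta> \<in> induced_map q f b" "induced_map q f b \<in> visual_boundary q"
    using induced_map_class[OF b] by blast
  have "finite_hausdorff_dist (\<delta> ` {0..}) (f ` \<gamma> ` {0..})"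
    using induced_map_iff[OF morse_boundary_visual[OF b] \<gamma>] \<delta> by blast
  then have *: "finite_hausdorff_dist (\<gamma> ` {0..}) (g ` \<delta> ` {0..})"
    using hausdorff_transfer finite_hausdorff_dist_sym by blast
  have "induced_map p g (induced_map q f b) =
      {\<gamma>'. geodesic_ray p \<gamma>' \<and> finite_hausdorff_dist (\<gamma>' ` {0..}) (g ` \<delta> ` {0..})}"
    using quasi_inverses.induced_map_iff[OF inverse_pair \<delta>(2,1)] by blast
  also have "\<dots> = {\<gamma>'. geodesic_ray p \<gamma>' \<and> finite_hausdorff_dist (\<gamma>' ` {0..}) (\<gamma> ` {0..})}"
    using * finite_hausdorff_dist_sym finite_hausdorff_dist_trans by blast
  also have "\<dots> = b" using ray_class_eq[OF morse_boundary_visual[OF b] \<gamma>] by simp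
  finally show ?thesis .
qed

lemma induced_map_inj: "inj_on (induced_map q f) (morse_boundary p)"
  using induced_map_inverse by (rule inj_on_inverseI)

lemma inv_into_induced_map:
  assumes "c \<in> morse_boundary q"
  shows "inv_into (morse_boundary p) (induced_map q f) c = induced_map p g c"
proof (rule inv_into_f_eq[OF induced_map_inj])
  show "induced_map p g c \<in> morse_boundary p"
    by (rule quasi_inverses.induced_map_in_boundary[OF inverse_pair assms])
  show "induced_map q f (induced_map p g c) = c"
    by (rule quasi_inverses.induced_map_inverse[OF inverse_pair assms])
qed

end

section \<open>Lines, centers and cross-ratios\<close>

lemma line_bound_nonneg:
  assumes "morse_gauge N" "1 \<le> L" "0 \<le> e" shows "0 \<le> line_bound N L e"
proof -
  define L' e' where "L' = 2 * L + 1" and "e' = L * (1 + e) + 1"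
  have "1 \<le> L'" "0 \<le> e'" using assms by (auto simp: L'_def e'_def)
  then have "1 \<le> 2 * L' + 1" "0 \<le> L' * (1 + e') + 1" by auto
  then have "0 \<le> N (2 * L' + 1) (L' * (1 + e') + 1)" using assms(1) by (simp add: morse_gauge_def)
  then show ?thesis by (simp add: line_bound_def Let_def L'_def e'_def)
qed

lemma ideal_triangleD:
  assumes "geodesic_triangle (Ideal a) (Ideal b) (Ideal c) \<sigma>\<^sub>1 \<sigma>\<^sub>2 \<sigma>\<^sub>3"
  shows "geodesic_between (Ideal a) (Ideal b) UNIV (snd \<sigma>\<^sub>1)" "side_image \<sigma>\<^sub>1 = range (snd \<sigma>\<^sub>1)"
    "geodesic_between (Ideal b) (Ideal c) UNIV (snd \<sigma>\<^sub>2)" "side_image \<sigma>\<^sub>2 = range (snd \<sigma>\<^sub>2)"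
    "geodesic_between (Ideal c) (Ideal a) UNIV (snd \<sigma>\<^sub>3)" "side_image \<sigma>\<^sub>3 = range (snd \<sigma>\<^sub>3)"
  using assms unfolding geodesic_triangle_def geodesic_between_ideal side_image_def by auto

lemma centersE:
  assumes "x \<in> centers k a b c"
  obtains \<gamma>\<^sub>1 \<gamma>\<^sub>2 \<gamma>\<^sub>3 where "geodesic_between (Ideal a) (Ideal b) UNIV \<gamma>\<^sub>1"
    "geodesic_between (Ideal b) (Ideal c) UNIV \<gamma>\<^sub>2" "geodesic_between (Ideal c) (Ideal a) UNIV \<gamma>\<^sub>3"
    "x \<in> thick (k + 1) (range \<gamma>\<^sub>1)" "x \<in> thick (k + 1) (range \<gamma>\<^sub>2)" "x \<in> thick (k + 1) (range \<gamma>\<^sub>3)"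
proof -
  obtain \<sigma>\<^sub>1 \<sigma>\<^sub>2 \<sigma>\<^sub>3 where \<sigma>: "geodesic_triangle (Ideal a) (Ideal b) (Ideal c) \<sigma>\<^sub>1 \<sigma>\<^sub>2 \<sigma>\<^sub>3"
    and k: "\<forall>\<sigma>\<in>{\<sigma>\<^sub>1, \<sigma>\<^sub>2, \<sigma>\<^sub>3}. infdist x (side_image \<sigma>) \<le> k"
    using assms by (auto simp: centers_def)
  note T = ideal_triangleD[OF \<sigma>]
  have "x \<in> thick (k + 1) (side_image \<sigma>\<^sub>1)" "x \<in> thick (k + 1) (side_image \<sigma>\<^sub>2)"
    "x \<in> thick (k + 1) (side_image \<sigma>\<^sub>3)"
    using k T(2,4,6) by (auto intro!: thick_infdist[of x _ k])
  then show ?thesis using that[OF T(1,3,5)] T(2,4,6) by simp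
qed

text \<open>The sides exist by \<open>ideal_line_exists\<close> and are Morse by the condition on
  pairs. The point given by \<open>K\<close> on the first side is already a center.\<close>

lemma centers_nonempty:
  fixes p :: "'a::heine_borel"
  assumes gs: "geodesic_space TYPE('a)" and K: "center_constants p K" and N: "morse_gauge N"
    and abc: "[a, b] \<in> boundary_tuples p 2 N" "[b, c] \<in> boundary_tuples p 2 N" "[c, a] \<in> boundary_tuples p 2 N"
  shows "centers (K N) a b c \<noteq> {}"
proof -
  note P = boundary_tuples_pairD[OF abc(1)] boundary_tuples_pairD[OF abc(2)] boundary_tuples_pairD[OF abc(3)]
  obtain \<gamma>\<^sub>1 \<gamma>\<^sub>2 \<gamma>\<^sub>3 where \<gamma>: "geodesic_between (Ideal a) (Ideal b) UNIV \<gamma>\<^sub>1"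
    "geodesic_between (Ideal b) (Ideal c) UNIV \<gamma>\<^sub>2" "geodesic_between (Ideal c) (Ideal a) UNIV \<gamma>\<^sub>3"
    using ideal_line_exists[OF gs P(2,3,1)] ideal_line_exists[OF gs P(7,8,6)]
      ideal_line_exists[OF gs P(12,13,11)] by metis
  define \<sigma> where "\<sigma> = (\<lambda>\<gamma>. (UNIV, \<gamma>) :: 'a side)"
  have T: "geodesic_triangle (Ideal a) (Ideal b) (Ideal c) (\<sigma> \<gamma>\<^sub>1) (\<sigma> \<gamma>\<^sub>2) (\<sigma> \<gamma>\<^sub>3)"
    using \<gamma> by (simp add: geodesic_triangle_def \<sigma>_def del: geodesic_between.simps)
  have V: "Ideal a \<in> vertices p" "Ideal b \<in> vertices p" "Ideal c \<in> vertices p"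
    using P by (auto simp: vertices_def)
  have M: "\<forall>\<tau>\<in>{\<sigma> \<gamma>\<^sub>1, \<sigma> \<gamma>\<^sub>2, \<sigma> \<gamma>\<^sub>3}. morse_geodesic N (fst \<tau>) (snd \<tau>)"
    using P(4)[OF \<gamma>(1)] P(9)[OF \<gamma>(2)] P(14)[OF \<gamma>(3)] by (simp add: \<sigma>_def)
  obtain x y z where xyz: "x \<in> side_image (\<sigma> \<gamma>\<^sub>1)" "y \<in> side_image (\<sigma> \<gamma>\<^sub>2)" "z \<in> side_image (\<sigma> \<gamma>\<^sub>3)"
    "dist x y \<le> K N" "dist x z \<le> K N"
    using K[unfolded center_constants_def, rule_format, OF N, THEN conjunct2, rule_format,
        OF V conjI[OF T M]] by blast
  have "0 \<le> K N" using xyz(4) order_trans[OF zero_le_dist] by blast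
  then have "\<forall>\<tau>\<in>{\<sigma> \<gamma>\<^sub>1, \<sigma> \<gamma>\<^sub>2, \<sigma> \<gamma>\<^sub>3}. infdist x (side_image \<tau>) \<le> K N"
    using xyz by (auto intro: infdist_le2)
  then have "x \<in> centers (K N) a b c" using T unfolding centers_def by blast
  then show ?thesis by blast
qed

lemma thick_Un: "A \<subseteq> thick r C \<Longrightarrow> B \<subseteq> thick s D \<Longrightarrow> A \<union> B \<subseteq> thick (max r s) (C \<union> D)"
  using thick_mono[of r "max r s" C "C \<union> D"] thick_mono[of s "max r s" D "C \<union> D"] by auto

context quasi_inverses
begin

section \<open>Transport of lines\<close>

lemma limits_to_induced:
  assumes b: "b \<in> visual_boundary p" and "limits_to \<delta> (induced_map q f b)" "limits_to \<gamma> b"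
  shows "finite_hausdorff_dist ((\<lambda>u. g (\<delta> u)) ` {0..}) (\<gamma> ` {0..})"
proof -
  obtain \<delta>' \<gamma>' where *: "\<delta>' \<in> induced_map q f b" "finite_hausdorff_dist (\<delta> ` {0..}) (\<delta>' ` {0..})"
    "\<gamma>' \<in> b" "finite_hausdorff_dist (\<gamma> ` {0..}) (\<gamma>' ` {0..})"
    using assms(2,3) by (auto simp: limits_to_def)
  have "finite_hausdorff_dist (\<delta>' ` {0..}) (f ` \<gamma>' ` {0..})"
    using induced_map_iff[OF b *(3)] *(1) by blast
  then have "finite_hausdorff_dist (f ` \<gamma>' ` {0..}) (\<delta> ` {0..})"
    using *(2) finite_hausdorff_dist_sym finite_hausdorff_dist_trans by blast
  then have "finite_hausdorff_dist (\<gamma>' ` {0..}) (g ` \<delta> ` {0..})" by (simp add: hausdorff_transfer)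
  then have "finite_hausdorff_dist (g ` \<delta> ` {0..}) (\<gamma> ` {0..})"
    using *(4) finite_hausdorff_dist_sym finite_hausdorff_dist_trans by blast
  then show ?thesis by (simp add: image_image)
qed

definition line_const :: "gauge_fun \<Rightarrow> real" where
  "line_const N = L + 3 * line_bound N L e + e"

lemma line_const_nonneg: "morse_gauge N \<Longrightarrow> 0 \<le> line_const N"
  using line_bound_nonneg[OF _ L_ge_1 e_nonneg] L_ge_1 e_nonneg by (simp add: line_const_def)

text \<open>The common ends give only some finite distance between corresponding halves;
  \<open>quasi_line_uniformly_near\<close> makes it uniform and \<open>line_near_quasi_line\<close>
  supplies the converse. Unlike \<open>ray_const\<close>, the bound involves no basepoints.\<close>

lemma line_close:
  assumes N: "morse_gauge N" and ab: "a \<in> visual_boundary p" "b \<in> visual_boundary p"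
    and \<gamma>: "geodesic_between (Ideal a) (Ideal b) UNIV \<gamma>" "morse_geodesic N UNIV \<gamma>"
    and \<delta>: "geodesic_between (Ideal (induced_map q f a)) (Ideal (induced_map q f b)) UNIV \<delta>"
  shows "g ` range \<delta> \<subseteq> thick (line_const N) (range \<gamma>)" "range \<gamma> \<subseteq> thick (line_const N) (g ` range \<delta>)"
proof -
  let ?\<beta> = "\<lambda>u. g (\<delta> u)"
  note G = \<gamma>(1)[unfolded geodesic_between_ideal] \<delta>[unfolded geodesic_between_ideal]
  have S: "morse_set N (range \<gamma>)" using morse_geodesic_morse_set[OF \<gamma>(2), of UNIV] by simp
  have qg: "quasi_geodesic L e UNIV ?\<beta>" using G by (intro quasi_geodesic_image) blast
  have "finite_hausdorff_dist (?\<beta> ` {0..}) (\<gamma> ` {0..})"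
    by (rule limits_to_induced[OF ab(2)]) (use G in blast)+
  then obtain r where r: "?\<beta> ` {0..} \<subseteq> thick r (\<gamma> ` {0..})" by (auto simp: finite_hausdorff_dist_thick)
  have "finite_hausdorff_dist ((\<lambda>u. ?\<beta> (-u)) ` {0..}) ((\<lambda>u. \<gamma> (-u)) ` {0..})"
    by (rule limits_to_induced[OF ab(1)]) (use G in blast)+
  then have "finite_hausdorff_dist (?\<beta> ` {..0}) (\<gamma> ` {..0})" 
    by (simp only: image_reverse[of ?\<beta>] image_reverse[of \<gamma>])
  then obtain s where s: "?\<beta> ` {..0} \<subseteq> thick s (\<gamma> ` {..0})" by (auto simp: finite_hausdorff_dist_thick)
  define t where "t = max r s"
  have rs: "?\<beta> ` {0..} \<subseteq> thick t (\<gamma> ` {0..})" "?\<beta> ` {..0} \<subseteq> thick t (\<gamma> ` {..0})"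
    using r s thick_mono[of r t "\<gamma> ` {0..}" "\<gamma> ` {0..}"] thick_mono[of s t "\<gamma> ` {..0}" "\<gamma> ` {..0}"]
    by (auto simp: t_def)
  have U: "(UNIV :: real set) = {0..} \<union> {..0}" by auto
  have "range ?\<beta> \<subseteq> thick t (range \<gamma>)"
    using thick_Un[OF rs] unfolding image_Un[symmetric] U[symmetric] by simp
  note 1 = quasi_line_uniformly_near[OF domain_geodesic S qg this]
  have \<gamma>g: "geodesic UNIV \<gamma>" using G by blast
  have "range \<gamma> \<subseteq> thick (line_const N) (range ?\<beta>)"
    using line_near_quasi_line[OF \<gamma>g qg 1 rs] by (simp add: line_const_def)
  then show "range \<gamma> \<subseteq> thick (line_const N) (g ` range \<delta>)" by (simp add: image_image)
  have "line_bound N L e \<le> line_const N"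
    using line_bound_nonneg[OF N L_ge_1 e_nonneg] L_ge_1 e_nonneg by (simp add: line_const_def)
  from thick_mono[OF this subset_refl] 1
  show "g ` range \<delta> \<subseteq> thick (line_const N) (range \<gamma>)" by (auto simp: image_image)
qed

definition line_gauge :: "gauge_fun \<Rightarrow> gauge_fun" where
  "line_gauge N = segment_gauge (transfer_gauge L e (line_const N) N)"

lemma induced_line_morse:
  assumes N: "morse_gauge N" and ab: "[a, b] \<in> boundary_tuples p 2 N"
    and \<delta>: "geodesic_between (Ideal (induced_map q f a)) (Ideal (induced_map q f b)) I \<delta>"
  shows "morse_geodesic (line_gauge N) I \<delta>"
proof -
  note P = boundary_tuples_pairD[OF ab]
  have I: "I = UNIV" and \<delta>g: "geodesic UNIV \<delta>" using \<delta> by auto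
  obtain \<gamma> where \<gamma>: "geodesic_between (Ideal a) (Ideal b) UNIV \<gamma>"
    by (rule ideal_line_exists[OF domain_geodesic P(2,3,1)])
  have M: "morse_geodesic N UNIV \<gamma>" by (rule P(4)[OF \<gamma>])
  have S: "morse_set N (range \<gamma>)" using morse_geodesic_morse_set[OF M, of UNIV] by simp
  have "morse_set (transfer_gauge L e (line_const N) N) (range \<delta>)"
    using morse_set_qi_transfer[OF S qi_g line_const_nonneg[OF N]
        line_close[OF N morse_boundary_visual[OF P(2)] morse_boundary_visual[OF P(3)] \<gamma> M \<delta>[unfolded I]]] .
  then show ?thesis
    unfolding line_gauge_def I using \<delta>g L_ge_1 e_nonneg line_const_nonneg[OF N]
    by (intro morse_geodesicI morse_gauge_transfer_gauge) auto
qed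

lemma induced_map_two_stable: "two_stable p q (induced_map q f)"
  unfolding two_stable_def
proof (intro allI impI)
  fix N assume N: "morse_gauge N"
  have "map (induced_map q f) xs \<in> boundary_tuples q 2 (line_gauge N)" if xs: "xs \<in> boundary_tuples p 2 N" for xs
  proof -
    obtain a b where ab: "xs = [a, b]"
      using xs by (auto simp: boundary_tuples_def length_Suc_conv eval_nat_numeral)
    note P = boundary_tuples_pairD[OF xs[unfolded ab]]
    have ba: "[b, a] \<in> boundary_tuples p 2 N"
      by (rule boundary_tuples_pair[OF xs]) (use ab P(1) in auto)
    have "induced_map q f a \<noteq> induced_map q f b" using inj_onD[OF induced_map_inj _ P(2,3)] P(1) by blast
    moreover have "induced_map q f a \<in> morse_boundary q" "induced_map q f b \<in> morse_boundary q"
      using P(2,3) by (auto intro: induced_map_in_boundary)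
    ultimately show ?thesis
      using induced_line_morse[OF N xs[unfolded ab]] induced_line_morse[OF N ba]
      unfolding boundary_tuples_def ab by (simp del: geodesic_between.simps)
  qed
  moreover have "morse_gauge (line_gauge N)"
    unfolding line_gauge_def using L_ge_1 e_nonneg line_const_nonneg[OF N]
    by (intro morse_gauge_segment_gauge morse_gauge_transfer_gauge) auto
  ultimately show "\<exists>N'. morse_gauge N' \<and>
      map (induced_map q f) ` boundary_tuples p 2 N \<subseteq> boundary_tuples q 2 N'" by blast
qed

section \<open>Comparison of centers and cross-ratios\<close>

definition center_const :: "gauge_fun \<Rightarrow> real \<Rightarrow> real \<Rightarrow> real" where
  "center_const N k k' = center_bound N (max (L * (k' + 1) + e + line_const N) (k + 1))"

text \<open>The sides seen by \<open>y\<close> are carried by \<open>g\<close> to within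
  \<open>line_const N\<close> of the sides seen by \<open>x\<close>. So \<open>g y\<close> and
  \<open>x\<close> are both coarse centers of one and the same triangle, where
  \<open>ideal_triangle_centers_close\<close> applies.\<close>

lemma centers_close:
  assumes N: "morse_gauge N"
    and abc: "[a, b] \<in> boundary_tuples p 2 N" "[b, c] \<in> boundary_tuples p 2 N" "[c, a] \<in> boundary_tuples p 2 N"
    and x: "x \<in> centers k a b c"
    and y: "y \<in> centers k' (induced_map q f a) (induced_map q f b) (induced_map q f c)"
  shows "dist (g y) x \<le> center_const N k k'"
proof -
  note P = boundary_tuples_pairD[OF abc(1)] boundary_tuples_pairD[OF abc(2)] boundary_tuples_pairD[OF abc(3)]
  note v = morse_boundary_visual[OF P(2)] morse_boundary_visual[OF P(7)] morse_boundary_visual[OF P(12)]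
  obtain \<gamma>\<^sub>1 \<gamma>\<^sub>2 \<gamma>\<^sub>3 where \<gamma>: "geodesic_between (Ideal a) (Ideal b) UNIV \<gamma>\<^sub>1"
    "geodesic_between (Ideal b) (Ideal c) UNIV \<gamma>\<^sub>2" "geodesic_between (Ideal c) (Ideal a) UNIV \<gamma>\<^sub>3"
    "x \<in> thick (k + 1) (range \<gamma>\<^sub>1)" "x \<in> thick (k + 1) (range \<gamma>\<^sub>2)" "x \<in> thick (k + 1) (range \<gamma>\<^sub>3)"
    by (rule centersE[OF x])
  obtain \<delta>\<^sub>1 \<delta>\<^sub>2 \<delta>\<^sub>3 where \<delta>:
    "geodesic_between (Ideal (induced_map q f a)) (Ideal (induced_map q f b)) UNIV \<delta>\<^sub>1"
    "geodesic_between (Ideal (induced_map q f b)) (Ideal (induced_map q f c)) UNIV \<delta>\<^sub>2"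
    "geodesic_between (Ideal (induced_map q f c)) (Ideal (induced_map q f a)) UNIV \<delta>\<^sub>3"
    "y \<in> thick (k' + 1) (range \<delta>\<^sub>1)" "y \<in> thick (k' + 1) (range \<delta>\<^sub>2)" "y \<in> thick (k' + 1) (range \<delta>\<^sub>3)"
    by (rule centersE[OF y])
  have M: "morse_geodesic N UNIV \<gamma>\<^sub>1" "morse_geodesic N UNIV \<gamma>\<^sub>2" "morse_geodesic N UNIV \<gamma>\<^sub>3"
    using P(4)[OF \<gamma>(1)] P(9)[OF \<gamma>(2)] P(14)[OF \<gamma>(3)] by simp_all
  define m where "m = max (L * (k' + 1) + e + line_const N) (k + 1)"
  have gy: "g y \<in> thick m (range \<gamma>)"
    if "y \<in> thick (k' + 1) (range \<delta>)" "g ` range \<delta> \<subseteq> thick (line_const N) (range \<gamma>)" for \<gamma> \<delta>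
  proof -
    have "{y} \<subseteq> thick (k' + 1) (range \<delta>)" using that(1) by simp
    then have "g ` {y} \<subseteq> thick (L * (k' + 1) + e) (g ` range \<delta>)"
      by (rule quasi_inverses.thick_image[OF inverse_pair])
    then have "g y \<in> thick (L * (k' + 1) + e + line_const N) (range \<gamma>)"
      using thick_trans[OF that(2)] by auto
    then show ?thesis using thick_mono[of "L * (k' + 1) + e + line_const N" m "range \<gamma>" "range \<gamma>"]
      by (auto simp: m_def)
  qed
  have xm: "x \<in> thick m (range \<gamma>)" if "x \<in> thick (k + 1) (range \<gamma>)" for \<gamma> :: "real \<Rightarrow> 'a"
    using that thick_mono[of "k + 1" m "range \<gamma>" "range \<gamma>"] by (auto simp: m_def)
  show ?thesis
    unfolding center_const_def m_def[symmetric]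
    by (rule ideal_triangle_centers_close[OF domain_geodesic v \<gamma>(1-3) M
          gy[OF \<delta>(4) line_close(1)[OF N v(1,2) \<gamma>(1) M(1) \<delta>(1)]]
          gy[OF \<delta>(5) line_close(1)[OF N v(2,3) \<gamma>(2) M(2) \<delta>(2)]]
          gy[OF \<delta>(6) line_close(1)[OF N v(3,1) \<gamma>(3) M(3) \<delta>(3)]]
          xm[OF \<gamma>(4)] xm[OF \<gamma>(5)] xm[OF \<gamma>(6)]])
qed

end

lemma induced_map_id:
  fixes p :: "'a::metric_space"
  assumes b: "b \<in> morse_boundary p" shows "induced_map p id b = b"
proof -
  note vb = morse_boundary_visual[OF b]
  obtain \<gamma> where \<gamma>: "\<gamma> \<in> b" by (rule visual_boundary_nonempty[OF vb])
  have "(\<exists>\<gamma>'\<in>b. finite_hausdorff_dist (\<delta> ` {0..}) (\<gamma>' ` {0..})) \<longleftrightarrow>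
      finite_hausdorff_dist (\<delta> ` {0..}) (\<gamma> ` {0..})" for \<delta> :: "real \<Rightarrow> 'a"
    using \<gamma> visual_boundary_asymptotic[OF vb _ \<gamma>] finite_hausdorff_dist_trans by blast
  then have "induced_map p id b =
      {\<delta>. geodesic_ray p \<delta> \<and> finite_hausdorff_dist (\<delta> ` {0..}) (\<gamma> ` {0..})}"
    by (simp add: induced_map_def)
  then show ?thesis by (simp only: ray_class_eq[OF vb \<gamma>, symmetric])
qed

text \<open>Two centers of a triple may come from different triangles. Comparing triangles with the
  same vertices is the case of the identity in \<open>centers_close\<close>.\<close>

lemma centers_bounded:
  fixes p :: "'a::heine_borel"
  assumes gs: "geodesic_space TYPE('a)" and N: "morse_gauge N"
    and abc: "[a, b] \<in> boundary_tuples p 2 N" "[b, c] \<in> boundary_tuples p 2 N" "[c, a] \<in> boundary_tuples p 2 N"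
  shows "bounded (centers k a b c)"
proof -
  interpret I: quasi_inverses "id :: 'a \<Rightarrow> 'a" id 1 0 0
    by unfold_locales (auto simp: gs qi_embedding_on_def)
  have mb: "a \<in> morse_boundary p" "b \<in> morse_boundary p" "c \<in> morse_boundary p"
    using boundary_tuples_pairD(2,3)[OF abc(1)] boundary_tuples_pairD(3)[OF abc(2)] by auto
  have "dist y x \<le> I.center_const N k k" if "x \<in> centers k a b c" "y \<in> centers k a b c" for x y
    using I.centers_close[OF N abc that(1), where k' = k and y = y and q = p] that(2)
    by (simp add: induced_map_id mb)
  then show ?thesis unfolding bounded_two_points by blast
qed

text \<open>Nonnegativity of \<open>d\<close> covers the empty set, whose diameter is
  \<open>0\<close> by definition.\<close>

lemma diameter_le_dist:
  assumes "0 \<le> d" "\<And>x y. x \<in> S \<Longrightarrow> y \<in> S \<Longrightarrow> dist x y \<le> d"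
  shows "diameter S \<le> d"
  unfolding diameter_def using assms by (auto intro!: cSUP_least)

context quasi_inverses
begin

text \<open>For centers \<open>y\<close> and \<open>z\<close> in the target, \<open>g y\<close> and
  \<open>g z\<close> are within \<open>B\<close> of centers in the domain, hence at most
  \<open>2 * B\<close> plus the diameter of \<open>U\<close> apart. The lower bound for
  \<open>g\<close> turns this into the affine function \<psi>, which is strictly increasing as
  \<open>L \<ge> 1\<close>.\<close>

lemma induced_map_quasi_moebius:
  assumes K: "center_constants p K"
  shows "quasi_moebius p q K (induced_map q f)"
  unfolding quasi_moebius_def
proof (intro conjI allI impI)
  show "two_stable p q (induced_map q f)" by (rule induced_map_two_stable)
  let ?h = "induced_map q f"
  fix N N' assume "morse_gauge N \<and> morse_gauge N' \<and> map ?h ` boundary_tuples p 2 N \<subseteq> boundary_tuples q 2 N'"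
  then have N: "morse_gauge N" by blast
  define B where "B = \<bar>center_const N (K N) (K N')\<bar>"
  define \<psi> where "\<psi> = (\<lambda>t. L * (2 * B + t + e))"
  have "cross_ratio K N' (?h a) (?h b) (?h c) (?h d) \<le> \<psi> (cross_ratio K N a b c d)"
    if t: "[a, b, c, d] \<in> boundary_tuples p 4 N" for a b c d
  proof -
    have dis: "distinct [a, b, c, d]" using t by (auto simp: boundary_tuples_def)
    have pr: "[x, y] \<in> boundary_tuples p 2 N" if "x \<noteq> y" "{x, y} \<subseteq> {a, b, c, d}" for x y
      by (rule boundary_tuples_pair[OF t]) (use that in auto)
    have abc: "[a, b] \<in> boundary_tuples p 2 N" "[b, c] \<in> boundary_tuples p 2 N" "[c, a] \<in> boundary_tuples p 2 N"
      and adc: "[a, d] \<in> boundary_tuples p 2 N" "[d, c] \<in> boundary_tuples p 2 N"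
      using dis by (auto intro!: pr)
    define U where "U = centers (K N) a b c \<union> centers (K N) a d c"
    \<comment> \<open>Only for a bounded set does the diameter control distances.\<close>
    have U: "bounded U" unfolding U_def
      using centers_bounded[OF domain_geodesic N abc] centers_bounded[OF domain_geodesic N adc abc(3)] by simp
    have near: "\<exists>x\<in>U. dist (g y) x \<le> B"
      if y: "y \<in> centers (K N') (?h a) (?h b) (?h c) \<union> centers (K N') (?h a) (?h d) (?h c)" for y
    proof -
      \<comment> \<open>Both triples of the domain have centers, so there is a point to compare with
        whichever triple \<open>y\<close> belongs to.\<close>
      obtain x x' where x: "x \<in> centers (K N) a b c" "x' \<in> centers (K N) a d c"
        using centers_nonempty[OF domain_geodesic K N abc]
          centers_nonempty[OF domain_geodesic K N adc abc(3)] by blast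
      from y show ?thesis
      proof
        assume "y \<in> centers (K N') (?h a) (?h b) (?h c)"
        then have "dist (g y) x \<le> B" using centers_close[OF N abc x(1)] unfolding B_def by force
        then show ?thesis using x by (auto simp: U_def)
      next
        assume "y \<in> centers (K N') (?h a) (?h d) (?h c)"
        then have "dist (g y) x' \<le> B" using centers_close[OF N adc abc(3) x(2)] unfolding B_def by force
        then show ?thesis using x by (auto simp: U_def)
      qed
    qed
    have \<psi>0: "0 \<le> \<psi> (diameter U)"
      using L_ge_1 e_nonneg diameter_ge_0[OF U] by (simp add: \<psi>_def B_def)
    show ?thesis
      unfolding cross_ratio_def U_def[symmetric]
    proof (rule diameter_le_dist[OF \<psi>0])
      fix y z
      assume "y \<in> centers (K N') (?h a) (?h b) (?h c) \<union> centers (K N') (?h a) (?h d) (?h c)"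
        and "z \<in> centers (K N') (?h a) (?h b) (?h c) \<union> centers (K N') (?h a) (?h d) (?h c)"
      then obtain y' z' where *: "y' \<in> U" "dist (g y) y' \<le> B" "z' \<in> U" "dist (g z) z' \<le> B"
        using near by blast
      have "dist y' z' \<le> diameter U" by (rule diameter_bounded_bound[OF U *(1,3)])
      then have "dist (g y) (g z) \<le> 2 * B + diameter U"
        using * dist_triangle[of "g y" "g z" y'] dist_triangle[of y' "g z" z'] by (simp add: dist_commute)
      then have "L * (dist (g y) (g z) + e) \<le> \<psi> (diameter U)"
        unfolding \<psi>_def using L_ge_1 by (intro mult_left_mono) auto
      then show "dist y z \<le> \<psi> (diameter U)" using qi_embedding_onD(3)[OF qi_g, of y z] by simp
    qed
  qed
  moreover have "continuous_on {0..} \<psi>" unfolding \<psi>_def by (intro continuous_intros)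
  moreover have "strict_mono_on {0..} \<psi>" using L_ge_1 by (auto simp: \<psi>_def strict_mono_on_def)
  moreover have "\<psi> ` {0..} \<subseteq> {0..}" using L_ge_1 e_nonneg by (auto simp: \<psi>_def B_def)
  ultimately show "\<exists>\<psi>. continuous_on {0..} \<psi> \<and> strict_mono_on {0..} \<psi> \<and> \<psi> ` {0..} \<subseteq> {0..} \<and>
      (\<forall>a b c d. [a, b, c, d] \<in> boundary_tuples p 4 N \<longrightarrow>
        cross_ratio K N' (?h a) (?h b) (?h c) (?h d) \<le> \<psi> (cross_ratio K N a b c d))"
    by blast
qed

end

section \<open>Topology of the Morse boundary\<close>

text \<open>An arbitrary gauge may be irregular in its second argument; replacing it by this larger step function,
  which is right-continuous there, makes the strata closed under limits of rays.\<close>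

definition step_gauge :: "gauge_fun \<Rightarrow> gauge_fun" where
  "step_gauge N L e = N L (of_int \<lfloor>e\<rfloor> + 1)"

lemma morse_gauge_step_gauge: "morse_gauge N \<Longrightarrow> morse_gauge (step_gauge N)"
  by (auto simp: morse_gauge_def step_gauge_def)

lemma morse_set_step_gauge:
  assumes "morse_set N S" shows "morse_set (step_gauge N) S"
  unfolding morse_set_def
proof (intro allI impI ballI, elim conjE)
  fix L e s t \<beta> u
  assume *: "s \<le> t" "quasi_geodesic L e {s..t} \<beta>" "\<beta> s \<in> S" "\<beta> t \<in> S" "u \<in> {s..t}"
  have "e \<le> of_int \<lfloor>e\<rfloor> + 1" by linarith
  then have "quasi_geodesic L (of_int \<lfloor>e\<rfloor> + 1) {s..t} \<beta>"
    using *(2) by (auto simp: quasi_geodesic_def intro: qi_embedding_on_weaken)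
  then show "infdist (\<beta> u) S \<le> step_gauge N L e"
    using * assms unfolding step_gauge_def morse_set_def by blast
qed

section \<open>Strata are closed under limits of rays\<close>

lemma morse_geodesic_iff:
  "morse_geodesic N I \<gamma> \<longleftrightarrow>
     geodesic I \<gamma> \<and> (\<forall>J. closed_interval J \<and> J \<subseteq> I \<longrightarrow> morse_set N (\<gamma> ` J))"
  unfolding morse_geodesic_def
  using geodesic_subset morse_quasi_geodesic_geodesic by blast

lemma morse_stratum_step_gauge: "morse_stratum p N \<subseteq> morse_stratum p (step_gauge N)"
  unfolding morse_stratum_def morse_geodesic_iff using morse_set_step_gauge by blast

text \<open>The ends of \<beta> are moved from the limit to \<open>\<alpha> n\<close>. This raises
  the additive constant slightly but leaves its integer part unchanged, so \<open>step_gauge\<close>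
  gives the same bound for every large \<open>n\<close>. Almost nearest points on
  \<open>\<alpha> n\<close> stay in a compact part of \<open>J\<close> and subconverge.\<close>

lemma morse_set_limit:
  fixes \<alpha> :: "nat \<Rightarrow> real \<Rightarrow> 'a::metric_space"
  assumes N: "morse_gauge N" and J: "closed J" and \<alpha>: "\<And>n. geodesic J (\<alpha> n)"
    and S: "\<And>n. morse_set (step_gauge N) (\<alpha> n ` J)"
    and conv: "\<And>t. t \<in> J \<Longrightarrow> (\<lambda>n. \<alpha> n t) \<longlonglongrightarrow> G t"
  shows "morse_set (step_gauge N) (G ` J)"
  unfolding morse_set_def
proof (intro allI impI ballI, elim conjE)
  fix L e s t \<beta> u
  assume st: "s \<le> t" and \<beta>: "quasi_geodesic L e {s..t} \<beta>"
    and ends: "\<beta> s \<in> G ` J" "\<beta> t \<in> G ` J" and u: "u \<in> {s..t}"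
  define R where "R = step_gauge N L e"
  have R: "0 \<le> R"
    using morse_gauge_step_gauge[OF N] quasi_geodesic_shape[OF \<beta>] by (simp add: R_def morse_gauge_def)
  show "infdist (\<beta> u) (G ` J) \<le> step_gauge N L e"
  proof (cases "u = s \<or> u = t")
    case True
    then show ?thesis using ends R by (auto simp: R_def)
  next
    case False
    obtain r0 r1 where r: "r0 \<in> J" "\<beta> s = G r0" "r1 \<in> J" "\<beta> t = G r1" using ends by auto
    \<comment> \<open>One third of the distance from \<open>e\<close> to the next integer, so that
      \<open>e + 2 * \<epsilon>\<close> has the same floor.\<close>
    define \<epsilon> where "\<epsilon> = (of_int \<lfloor>e\<rfloor> + 1 - e) / 3"
    have e: "of_int \<lfloor>e\<rfloor> \<le> e" "e < of_int \<lfloor>e\<rfloor> + 1" by linarith+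
    then have \<epsilon>: "0 < \<epsilon>" by (simp add: \<epsilon>_def)
    have "3 * \<epsilon> = of_int \<lfloor>e\<rfloor> + 1 - e" by (simp add: \<epsilon>_def)
    then have fl: "\<lfloor>e + 2 * \<epsilon>\<rfloor> = \<lfloor>e\<rfloor>" unfolding floor_eq_iff using e \<epsilon> by linarith
    have near: "\<forall>\<^sub>F n in sequentially. dist (\<alpha> n r0) (G r0) < \<epsilon> \<and> dist (\<alpha> n r1) (G r1) < \<epsilon>"
      using tendstoD[OF conv[OF r(1)] \<epsilon>] tendstoD[OF conv[OF r(3)] \<epsilon>] by (rule eventually_conj)
    have inf: "infdist (\<beta> u) (\<alpha> n ` J) \<le> R"
      if n: "dist (\<alpha> n r0) (G r0) < \<epsilon> \<and> dist (\<alpha> n r1) (G r1) < \<epsilon>" for n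
    proof -
      define \<beta>' where "\<beta>' = \<beta>(s := \<alpha> n r0, t := \<alpha> n r1)"
      have "qi_embedding_on L (e + 2 * \<epsilon>) {s..t} \<beta>'"
        by (rule qi_embedding_on_perturb[of L e _ \<beta>])
          (use \<beta> \<epsilon> n r False u in \<open>auto simp: \<beta>'_def quasi_geodesic_def dist_commute less_imp_le\<close>)
      then have "quasi_geodesic L (e + 2 * \<epsilon>) {s..t} \<beta>'" using st by (simp add: quasi_geodesic_def)
      moreover have "\<beta>' s \<in> \<alpha> n ` J" "\<beta>' t \<in> \<alpha> n ` J" using r by (auto simp: \<beta>'_def)
      ultimately have "infdist (\<beta>' u) (\<alpha> n ` J) \<le> step_gauge N L (e + 2 * \<epsilon>)"
        using S[of n] st u unfolding morse_set_def by blast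
      then show ?thesis using False fl by (simp add: R_def step_gauge_def \<beta>'_def)
    qed
    have "infdist (\<beta> u) (G ` J) \<le> R + 2 * \<eta>" if \<eta>: "0 < \<eta>" for \<eta>
    proof -
      obtain n0 where n0: "\<And>n. n0 \<le> n \<Longrightarrow> dist (\<alpha> n r0) (G r0) < \<epsilon> \<and> dist (\<alpha> n r1) (G r1) < \<epsilon>"
        using near by (auto simp: eventually_sequentially)
      have "\<exists>v\<in>J. dist (\<beta> u) (\<alpha> (n + n0) v) \<le> R + \<eta>" for n
      proof -
        have "\<beta> u \<in> thick (R + \<eta>) (\<alpha> (n + n0) ` J)"
          by (rule thick_infdist[OF inf[OF n0]]) (use r \<eta> in auto)
        then show ?thesis by (auto simp: mem_thick)
      qed
      then obtain v where v: "\<And>n. v n \<in> J" "\<And>n. dist (\<beta> u) (\<alpha> (n + n0) (v n)) \<le> R + \<eta>" by metis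
      \<comment> \<open>The points \<open>\<alpha> (n + n0) (v n)\<close> are within a fixed
        distance of \<open>G r0\<close>, and the geodesics turn this into a bound for the
        parameters.\<close>
      define B where "B = R + \<eta> + dist (\<beta> u) (G r0) + \<epsilon>"
      have "\<bar>v n - r0\<bar> \<le> B" for n
      proof -
        have "\<bar>v n - r0\<bar> = dist (\<alpha> (n + n0) (v n)) (\<alpha> (n + n0) r0)"
          using geodesicD[OF \<alpha> v(1) r(1)] by simp
        then show ?thesis
          using v(2)[of n] n0[of "n + n0"] dist_triangle[of "\<alpha> (n + n0) (v n)" "\<alpha> (n + n0) r0" "\<beta> u"]
            dist_triangle[of "\<beta> u" "\<alpha> (n + n0) r0" "G r0"] by (simp add: B_def dist_commute)
      qed
      then have vB: "v n \<in> J \<inter> cball r0 B" for n using v(1)[of n] by (simp add: dist_real_def abs_minus_commute)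
      have "compact (J \<inter> cball r0 B)" using J by (simp add: closed_Int_compact)
      then obtain w r' where w: "w \<in> J \<inter> cball r0 B" "strict_mono (r' :: nat \<Rightarrow> nat)" "(v \<circ> r') \<longlonglongrightarrow> w"
        using vB unfolding compact_def by blast
      have wJ: "w \<in> J" using w(1) by simp
      have sub: "strict_mono (\<lambda>n. r' n + n0)" using w(2) by (simp add: strict_mono_def)
      have "(\<lambda>n. \<alpha> (r' n + n0) w) \<longlonglongrightarrow> G w"
        using LIMSEQ_subseq_LIMSEQ[OF conv[OF wJ] sub] by (simp add: o_def)
      then have "\<forall>\<^sub>F n in sequentially. dist (\<alpha> (r' n + n0) w) (G w) < \<eta> / 2"
        using \<eta> by (intro tendstoD) auto
      moreover have "\<forall>\<^sub>F n in sequentially. dist (v (r' n)) w < \<eta> / 2"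
        using tendstoD[OF w(3), of "\<eta> / 2"] \<eta> by simp
      ultimately have "\<forall>\<^sub>F n in sequentially. dist (\<alpha> (r' n + n0) w) (G w) < \<eta> / 2 \<and> dist (v (r' n)) w < \<eta> / 2"
        by (rule eventually_conj)
      then obtain n where n: "dist (\<alpha> (r' n + n0) w) (G w) < \<eta> / 2" "dist (v (r' n)) w < \<eta> / 2"
        using eventually_happens'[OF sequentially_bot] by blast
      have "dist (\<alpha> (r' n + n0) (v (r' n))) (\<alpha> (r' n + n0) w) < \<eta> / 2"
        using geodesicD[OF \<alpha> v(1) wJ] n(2) by (simp add: dist_real_def)
      then have "dist (\<beta> u) (G w) \<le> R + 2 * \<eta>"
        using v(2)[of "r' n"] n(1) dist_triangle[of "\<beta> u" "G w" "\<alpha> (r' n + n0) (v (r' n))"]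
          dist_triangle[of "\<alpha> (r' n + n0) (v (r' n))" "G w" "\<alpha> (r' n + n0) w"] by simp
      then show ?thesis using wJ by (intro infdist_le2) auto
    qed
    note le = this
    show ?thesis
    proof (rule field_le_epsilon)
      fix \<delta> :: real assume "0 < \<delta>"
      then show "infdist (\<beta> u) (G ` J) \<le> step_gauge N L e + \<delta>" using le[of "\<delta> / 2"] by (simp add: R_def)
    qed
  qed
qed

lemma visual_boundary_fellow_travel:
  fixes p :: "'a::heine_borel"
  assumes gs: "geodesic_space TYPE('a)" and b: "b \<in> visual_boundary p"
    and \<alpha>: "\<alpha> \<in> b" "morse_geodesic N {0..} \<alpha>" and \<beta>: "\<beta> \<in> b" and t: "t \<ge> 0"
  shows "dist (\<alpha> t) (\<beta> t) \<le> fellow_bound N 0"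
proof (rule asymptotic_rays_fellow_travel[OF gs])
  show "geodesic {0..} \<alpha>" "geodesic {0..} \<beta>" "dist (\<alpha> 0) (\<beta> 0) \<le> 0"
    using visual_boundary_ray[OF b \<alpha>(1)] visual_boundary_ray[OF b \<beta>] by (auto simp: geodesic_ray_def)
  show "morse_set N (\<alpha> ` {0..})" using morse_geodesic_morse_set[OF \<alpha>(2)] by simp
  show "finite_hausdorff_dist (\<alpha> ` {0..}) (\<beta> ` {0..})" by (rule visual_boundary_asymptotic[OF b \<alpha>(1) \<beta>])
qed (rule t)

lemma rays_converge_toE:
  assumes "rays_converge_to \<beta> b" "strict_mono r"
  obtains s \<gamma> where "strict_mono (s :: nat \<Rightarrow> nat)" "\<gamma> \<in> b"
    "\<And>C. compact C \<Longrightarrow> C \<subseteq> {0..} \<Longrightarrow> uniform_limit C (\<lambda>n. \<beta> (r (s n))) \<gamma> sequentially"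
  using assms unfolding rays_converge_to_def by meson

text \<open>The converging representatives \<beta> need not be Morse themselves. Morse
  representatives fellow travel with them uniformly, so a subsequential limit of the latter lies in
  \<open>b\<close>, and it is Morse by \<open>morse_set_limit\<close>.\<close>

lemma stratum_limit:
  fixes p :: "'a::heine_borel"
  assumes gs: "geodesic_space TYPE('a)" and N: "morse_gauge N"
    and bs: "\<And>n. bs n \<in> morse_stratum p (step_gauge N)" "\<And>n. \<beta> n \<in> bs n"
    and b: "b \<in> visual_boundary p" and lim: "rays_converge_to \<beta> b"
  shows "b \<in> morse_stratum p (step_gauge N)"
proof -
  obtain s \<gamma> where s: "strict_mono (s :: nat \<Rightarrow> nat)" and \<gamma>: "\<gamma> \<in> b"
    and unif: "\<And>C. compact C \<Longrightarrow> C \<subseteq> {0..} \<Longrightarrow> uniform_limit C (\<lambda>n. \<beta> (s n)) \<gamma> sequentially"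
    using rays_converge_toE[OF lim strict_mono_id] by auto
  have vbs: "bs n \<in> visual_boundary p" for n using bs(1) by (simp add: morse_stratum_def)
  have "\<forall>n. \<exists>\<alpha>. \<alpha> \<in> bs n \<and> morse_geodesic (step_gauge N) {0..} \<alpha>"
    using bs(1) unfolding morse_stratum_def by blast
  then obtain \<alpha> where \<alpha>: "\<And>n. \<alpha> n \<in> bs n" "\<And>n. morse_geodesic (step_gauge N) {0..} (\<alpha> n)"
    by metis
  have \<alpha>g: "geodesic {0..} (\<alpha> n)" "\<alpha> n 0 = p" for n
    using visual_boundary_ray[OF vbs \<alpha>(1)] by (auto simp: geodesic_ray_def)
  have ev: "\<forall>\<^sub>F n in sequentially. u \<in> {0..real n}" if "u \<in> {0..}" for u
  proof -
    have "\<forall>\<^sub>F n in sequentially. u \<le> real n"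
      using filterlim_real_sequentially unfolding filterlim_at_top by blast
    then show ?thesis by eventually_elim (use that in auto)
  qed
  have bd: "bounded (range (\<lambda>n. \<alpha> (s n) 0))" by (simp add: \<alpha>g)
  have seg: "geodesic {0..real n} (\<alpha> (s n))" for n by (rule geodesic_subset[OF \<alpha>g(1)]) auto
  have "\<exists>s' G. strict_mono (s' :: nat \<Rightarrow> nat) \<and> geodesic {0..} G \<and> (\<forall>u\<in>{0..}. (\<lambda>n. \<alpha> (s (s' n)) u) \<longlonglongrightarrow> G u)"
    by (rule geodesic_subsequence[of "\<lambda>_. 0" real "\<lambda>n. \<alpha> (s n)" "{0..}"]) (use seg bd ev in auto)
  then obtain s' G where s': "strict_mono (s' :: nat \<Rightarrow> nat)" and G: "geodesic {0..} G"
    and conv: "\<And>u. u \<in> {0..} \<Longrightarrow> (\<lambda>n. \<alpha> (s (s' n)) u) \<longlonglongrightarrow> G u"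
    by blast
  have "dist (G t) (\<gamma> t) \<le> fellow_bound (step_gauge N) 0" if t: "t \<ge> 0" for t
  proof (rule tendsto_upperbound)
    have "(\<lambda>n. \<beta> (s n) t) \<longlonglongrightarrow> \<gamma> t"
      by (rule tendsto_uniform_limitI[OF unif[of "{t}"]]) (use t in auto)
    then have "(\<lambda>n. \<beta> (s (s' n)) t) \<longlonglongrightarrow> \<gamma> t" using LIMSEQ_subseq_LIMSEQ[OF _ s'] by (auto simp: o_def)
    then show "(\<lambda>n. dist (\<alpha> (s (s' n)) t) (\<beta> (s (s' n)) t)) \<longlonglongrightarrow> dist (G t) (\<gamma> t)"
      using conv t by (intro tendsto_dist) auto
    show "\<forall>\<^sub>F n in sequentially. dist (\<alpha> (s (s' n)) t) (\<beta> (s (s' n)) t) \<le> fellow_bound (step_gauge N) 0"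
      by (intro always_eventually allI visual_boundary_fellow_travel[OF gs vbs \<alpha> bs(2) t])
  qed simp
  then have "finite_hausdorff_dist (G ` {0..}) (\<gamma> ` {0..})" by (rule finite_hausdorff_dist_rays_pointwise)
  moreover have "G 0 = p" using LIMSEQ_unique[OF conv[of 0], of p] \<alpha>g(2) by simp
  ultimately have "G \<in> b" using ray_class_eq[OF b \<gamma>] G by (auto simp: geodesic_ray_def)
  moreover have "morse_geodesic (step_gauge N) {0..} G"
    unfolding morse_geodesic_iff
  proof (intro conjI allI impI)
    fix J assume J: "closed_interval J \<and> J \<subseteq> {0::real..}"
    then have "closed J" by (simp add: closed_interval_def)
    then show "morse_set (step_gauge N) (G ` J)"
    proof (rule morse_set_limit[OF N])
      show "geodesic J (\<alpha> (s (s' n)))" for n using geodesic_subset[OF \<alpha>g(1)] J by blast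
      show "morse_set (step_gauge N) (\<alpha> (s (s' n)) ` J)" for n
        using morse_geodesic_morse_set[OF \<alpha>(2)] J by blast
      show "(\<lambda>n. \<alpha> (s (s' n)) t) \<longlonglongrightarrow> G t" if "t \<in> J" for t using conv J that by blast
    qed
  qed (rule G)
  ultimately show ?thesis using b by (auto simp: morse_stratum_def)
qed

section \<open>Continuity of the induced map\<close>

context quasi_inverses
begin

text \<open>Arzela-Ascoli gives a limit ray of the images along any subsequence; the point is that
  its class is the expected one. The \<open>g\<close>-images of the \<open>\<delta> n\<close> are
  uniformly near the \<open>\<beta> n\<close>, which converge to a ray of \<open>b\<close>.\<close>

lemma induced_rays_converge:
  assumes N: "morse_gauge N" and bs: "\<And>n. bs n \<in> morse_stratum p N" "\<And>n. \<beta> n \<in> bs n"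
    and b: "b \<in> morse_boundary p" and lim: "rays_converge_to \<beta> b"
    and \<delta>: "\<And>n. \<delta> n \<in> induced_map q f (bs n)"
  shows "rays_converge_to \<delta> (induced_map q f b)"
  unfolding rays_converge_to_def
proof (intro allI impI)
  fix r :: "nat \<Rightarrow> nat" assume r: "strict_mono r"
  obtain s \<gamma> where s: "strict_mono (s :: nat \<Rightarrow> nat)" and \<gamma>: "\<gamma> \<in> b"
    and unif: "\<And>C. compact C \<Longrightarrow> C \<subseteq> {0..} \<Longrightarrow> uniform_limit C (\<lambda>n. \<beta> (r (s n))) \<gamma> sequentially"
    using rays_converge_toE[OF lim r] by auto
  note vb = morse_boundary_visual[OF b]
  have vbs: "bs n \<in> visual_boundary p" for n using bs(1) by (simp add: morse_stratum_def)
  have "\<forall>n. \<exists>\<alpha>. \<alpha> \<in> bs n \<and> morse_geodesic N {0..} \<alpha>"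
    using bs(1) unfolding morse_stratum_def by blast
  then obtain \<alpha> where \<alpha>: "\<And>n. \<alpha> n \<in> bs n" "\<And>n. morse_geodesic N {0..} (\<alpha> n)"
    by metis
  have \<delta>r: "geodesic_ray q (\<delta> n)" "finite_hausdorff_dist (\<delta> n ` {0..}) (f ` \<alpha> n ` {0..})" for n
    using \<delta>[of n] induced_map_iff[OF vbs \<alpha>(1)] by auto
  have \<delta>g: "geodesic {0..} (\<delta> n)" "\<delta> n 0 = q" for n using \<delta>r(1)[of n] by (auto simp: geodesic_ray_def)
  \<comment> \<open>Rays are extended by their starting point to negative parameters, as the
    compactness lemma works on the whole line.\<close>
  define F where "F = (\<lambda>n u. \<delta> (r (s n)) (max 0 u))"
  have lip: "dist (F n x) (F n y) \<le> \<bar>x - y\<bar>" for n x y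
    unfolding F_def by (subst geodesicD[OF \<delta>g(1)]) auto
  have bd: "bounded (range (\<lambda>n. F n 0))" by (simp add: F_def \<delta>g)
  obtain s' G where s': "strict_mono (s' :: nat \<Rightarrow> nat)"
    and unifF: "\<And>C. compact C \<Longrightarrow> uniform_limit C (\<lambda>n. F (s' n)) G sequentially"
    and convF: "\<And>x. (\<lambda>n. F (s' n) x) \<longlonglongrightarrow> G x"
    by (rule lipschitz_subsequence[OF lip bd]) (rule that)
  have conv: "(\<lambda>n. \<delta> (r (s (s' n))) u) \<longlonglongrightarrow> G u" if "u \<ge> 0" for u
    using convF[of u] that by (simp add: F_def)
  have G: "geodesic {0..} G"
    unfolding geodesic_def
  proof (intro conjI ballI)
    fix u v :: real assume uv: "u \<in> {0..}" "v \<in> {0..}"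
    have "(\<lambda>n. dist (\<delta> (r (s (s' n))) u) (\<delta> (r (s (s' n))) v)) \<longlonglongrightarrow> dist (G u) (G v)"
      using uv conv by (intro tendsto_dist) auto
    then show "dist (G u) (G v) = \<bar>u - v\<bar>"
      using uv by (simp add: geodesicD[OF \<delta>g(1)] LIMSEQ_const_iff)
  qed simp
  have "G 0 = q" using LIMSEQ_unique[OF conv[of 0], of q] \<delta>g(2) by simp
  with G have Gray: "geodesic_ray q G" by (simp add: geodesic_ray_def)
  define C where "C = ray_const p q N + fellow_bound N 0"
  have near\<beta>: "g (\<delta> n u) \<in> thick C (\<beta> n ` {0..})" if u: "u \<ge> 0" for n u
  proof -
    have S: "morse_set N (\<alpha> n ` {0..})" using morse_geodesic_morse_set[OF \<alpha>(2)] by simp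
    have "g (\<delta> n u) \<in> thick (ray_const p q N) (\<alpha> n ` {0..})"
      using asymptotic_ray_close(1)[OF visual_boundary_ray[OF vbs \<alpha>(1)] S \<delta>r] u by auto
    moreover have "\<alpha> n ` {0..} \<subseteq> thick (fellow_bound N 0) (\<beta> n ` {0..})"
      using visual_boundary_fellow_travel[OF domain_geodesic vbs \<alpha> bs(2)] by (auto intro: thickI)
    ultimately show ?thesis using thick_trans unfolding C_def by blast
  qed
  have near\<gamma>: "g ` G ` {0..} \<subseteq> thick (C + 1 + (L + e)) (\<gamma> ` {0..})"
  proof (rule subsetI, elim imageE, hypsubst)
    fix u :: real assume "u \<in> {0..}"
    then have u: "0 \<le> u" by simp
    \<comment> \<open>The point of \<open>\<beta> n\<close> near \<open>g (\<delta> n u)\<close> has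
      parameter at most \<open>W\<close> for all \<open>n\<close>, so uniform convergence on
      \<open>{0..W}\<close> is enough.\<close>
    define W where "W = dist p (g q) + L * u + e + C"
    have "uniform_limit {0..W} (\<lambda>n. \<beta> (r (s n))) \<gamma> sequentially" by (rule unif) auto
    then have "\<forall>\<^sub>F n in sequentially. \<forall>w\<in>{0..W}. dist (\<beta> (r (s n)) w) (\<gamma> w) < 1"
      by (rule uniform_limitD) simp
    from eventually_subseq[OF s' this] tendstoD[OF conv[OF u], of 1]
    have "\<forall>\<^sub>F n in sequentially. (\<forall>w\<in>{0..W}. dist (\<beta> (r (s (s' n))) w) (\<gamma> w) < 1) \<and>
        dist (\<delta> (r (s (s' n))) u) (G u) < 1"
      by (intro eventually_conj) auto
    then obtain m where m: "\<forall>w\<in>{0..W}. dist (\<beta> (r (s (s' m))) w) (\<gamma> w) < 1"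
      "dist (\<delta> (r (s (s' m))) u) (G u) < 1"
      using eventually_happens'[OF sequentially_bot] by blast
    define n where "n = r (s (s' m))"
    obtain w where w: "w \<ge> 0" "dist (g (\<delta> n u)) (\<beta> n w) \<le> C"
      using near\<beta>[OF u, of n] by (auto simp: mem_thick)
    have "geodesic_ray p (\<beta> n)" by (rule visual_boundary_ray[OF vbs bs(2)])
    then have "w = dist p (\<beta> n w)" using geodesicD[of "{0..}" "\<beta> n" 0 w] w(1) by (simp add: geodesic_ray_def)
    also have "\<dots> \<le> dist p (g q) + dist (g q) (g (\<delta> n u)) + C"
      using w(2) dist_triangle[of p "\<beta> n w" "g (\<delta> n u)"] dist_triangle[of p "g (\<delta> n u)" "g q"] by simp
    also have "dist (g q) (g (\<delta> n u)) \<le> L * dist q (\<delta> n u) + e" using qi_embedding_onD(4)[OF qi_g] by simp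
    also have "dist q (\<delta> n u) = u" using geodesicD[OF \<delta>g(1), of 0 u n] \<delta>g(2) u by simp
    finally have "w \<in> {0..W}" using w(1) by (simp add: W_def)
    then have "dist (\<beta> n w) (\<gamma> w) < 1" using m(1) by (simp add: n_def)
    then have 1: "g (\<delta> n u) \<in> thick (C + 1) (\<gamma> ` {0..})"
      using w dist_triangle[of "g (\<delta> n u)" "\<gamma> w" "\<beta> n w"] by (intro thickI[of "\<gamma> w"]) auto
    have "dist (g (G u)) (g (\<delta> n u)) \<le> L * dist (G u) (\<delta> n u) + e"
      using qi_embedding_onD(4)[OF qi_g] by simp
    also have "\<dots> \<le> L + e" using m(2) L_ge_1 mult_left_mono[of "dist (G u) (\<delta> n u)" 1 L]
      by (simp add: n_def dist_commute)
    finally show "g (G u) \<in> thick (C + 1 + (L + e)) (\<gamma> ` {0..})" by (rule thick_close[OF 1])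
  qed
  \<comment> \<open>The limit \<gamma> need not be \<open>M\<close>-Morse, so a Morse representative
    of \<open>b\<close> takes its place, at some finite distance \<open>R\<close>.\<close>
  obtain M \<gamma>0 where \<gamma>0: "\<gamma>0 \<in> b" "morse_geodesic M {0..} \<gamma>0"
    using b by (auto simp: morse_boundary_def morse_stratum_def)
  obtain R where "\<gamma> ` {0..} \<subseteq> thick R (\<gamma>0 ` {0..})"
    using visual_boundary_asymptotic[OF vb \<gamma> \<gamma>0(1)] by (auto simp: finite_hausdorff_dist_thick)
  then have "g ` G ` {0..} \<subseteq> thick (C + 1 + (L + e) + R) (\<gamma>0 ` {0..})"
    using near\<gamma> thick_trans by blast
  note close = quasi_ray_close[OF visual_boundary_ray[OF vb \<gamma>0(1)] _ Gray this]
  have "finite_hausdorff_dist (\<gamma>0 ` {0..}) (g ` G ` {0..})"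
    by (rule finite_hausdorff_distI[OF close(2) close(1)]; rule morse_geodesic_morse_set[OF \<gamma>0(2)]) auto
  then have "finite_hausdorff_dist (G ` {0..}) (f ` \<gamma>0 ` {0..})"
    using hausdorff_transfer finite_hausdorff_dist_sym by blast
  then have "G \<in> induced_map q f b" using induced_map_iff[OF vb \<gamma>0(1)] Gray by blast
  moreover have "uniform_limit C (\<lambda>n. \<delta> (r ((s \<circ> s') n))) G sequentially"
    if C: "compact C \<and> C \<subseteq> {0..}" for C
  proof -
    have "uniform_limit C (\<lambda>n. F (s' n)) G sequentially" using unifF C by blast
    then show ?thesis
      by (rule uniform_limit_cong'[THEN iffD1, rotated 2]) (use C in \<open>auto simp: F_def max_def\<close>)
  qed
  moreover have "strict_mono (s \<circ> s')" using s s' by (rule strict_mono_o)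
  ultimately show "\<exists>s \<gamma>. strict_mono (s :: nat \<Rightarrow> nat) \<and> \<gamma> \<in> induced_map q f b \<and>
      (\<forall>C. compact C \<and> C \<subseteq> {0..} \<longrightarrow> uniform_limit C (\<lambda>n. \<delta> (r (s n))) \<gamma> sequentially)"
    by blast
qed

text \<open>A limit of points of the stratum remains in it thanks to the step gauge; in particular
  it is a Morse point, so its image is a boundary point and convergence of images applies.\<close>

lemma visual_closed_vimage:
  assumes N: "morse_gauge N" and V: "visual_closed q V"
  shows "visual_closed p {b \<in> morse_stratum p (step_gauge N). induced_map q f b \<in> V}"
  unfolding visual_closed_def
proof (intro conjI allI impI)
  show "{b \<in> morse_stratum p (step_gauge N). induced_map q f b \<in> V} \<subseteq> visual_boundary p"
    by (auto simp: morse_stratum_def)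
next
  fix bs \<beta> b
  assume A: "(\<forall>n. bs n \<in> {b \<in> morse_stratum p (step_gauge N). induced_map q f b \<in> V} \<and> \<beta> n \<in> bs n) \<and>
    b \<in> visual_boundary p \<and> rays_converge_to \<beta> b"
  then have bs: "\<And>n. bs n \<in> morse_stratum p (step_gauge N)" "\<And>n. \<beta> n \<in> bs n"
    and V': "\<And>n. induced_map q f (bs n) \<in> V" and b: "b \<in> visual_boundary p" "rays_converge_to \<beta> b"
    by auto
  note N1 = morse_gauge_step_gauge[OF N]
  have bst: "b \<in> morse_stratum p (step_gauge N)" by (rule stratum_limit[OF domain_geodesic N bs b])
  then have bm: "b \<in> morse_boundary p" using N1 by (auto simp: morse_boundary_def)
  have "\<exists>\<delta>. \<delta> \<in> induced_map q f (bs n)" for n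
  proof -
    have "induced_map q f (bs n) \<in> visual_boundary q" using V V'[of n] unfolding visual_closed_def by blast
    then show ?thesis by (rule visual_boundary_nonempty) blast
  qed
  then obtain \<delta> where \<delta>: "\<And>n. \<delta> n \<in> induced_map q f (bs n)" by metis
  have "induced_map q f b \<in> V"
    by (rule visual_closedD[OF V V' \<delta> morse_boundary_visual[OF induced_map_in_boundary[OF bm]]
          induced_rays_converge[OF N1 bs bm b(2) \<delta>]])
  with bst show "b \<in> {b \<in> morse_stratum p (step_gauge N). induced_map q f b \<in> V}" by simp
qed

end

lemma openin_visual_topology:
  "openin (visual_topology p) U \<longleftrightarrow> U \<subseteq> visual_boundary p \<and> visual_closed p (visual_boundary p - U)"
  unfolding visual_topology_def topology_inverse'[OF istopology_visual] ..

lemma openin_morse_topology: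
  "openin (morse_topology p) U \<longleftrightarrow> U \<subseteq> morse_boundary p \<and>
     (\<forall>N. morse_gauge N \<longrightarrow>
        openin (subtopology (visual_topology p) (morse_stratum p N)) (U \<inter> morse_stratum p N))"
  unfolding morse_topology_def topology_inverse'[OF istopology_morse] ..

context quasi_inverses
begin

text \<open>The stratum of \<open>N1\<close> is mapped into that of \<open>N2\<close>, where
  \<open>U\<close> coincides with an open set \<open>V\<close> of the visual boundary. The points of
  the \<open>N1\<close>-stratum sent outside \<open>V\<close> form a closed set \<open>B\<close>,
  and on the smaller \<open>N\<close>-stratum its complement is the required preimage.\<close>

lemma induced_map_continuous:
  "continuous_map (morse_topology p) (morse_topology q) (induced_map q f)"
  unfolding continuous_map_def topspace_morse
proof (intro conjI allI impI)
  show "induced_map q f \<in> morse_boundary p \<rightarrow> morse_boundary q" by (auto intro: induced_map_in_boundary)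
  let ?h = "induced_map q f"
  fix U assume U: "openin (morse_topology q) U"
  show "openin (morse_topology p) {x \<in> morse_boundary p. ?h x \<in> U}"
    unfolding openin_morse_topology
  proof (intro conjI allI impI)
    fix N assume N: "morse_gauge N"
    define N1 where "N1 = step_gauge N"
    define N2 where "N2 = image_gauge p q N1"
    have N1: "morse_gauge N1" using N by (simp add: N1_def morse_gauge_step_gauge)
    have N2: "morse_gauge N2" by (simp add: N2_def morse_gauge_image_gauge)
    have "openin (subtopology (visual_topology q) (morse_stratum q N2)) (U \<inter> morse_stratum q N2)"
      using U N2 by (simp add: openin_morse_topology)
    then obtain V where V: "openin (visual_topology q) V" "U \<inter> morse_stratum q N2 = V \<inter> morse_stratum q N2"
      by (auto simp: openin_subtopology)
    define B where "B = {b \<in> morse_stratum p N1. ?h b \<in> visual_boundary q - V}"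
    have B: "visual_closed p B"
      unfolding B_def N1_def using V(1) N by (intro visual_closed_vimage) (simp_all add: openin_visual_topology)
    then have "B \<subseteq> visual_boundary p" by (simp add: visual_closed_def)
    then have "visual_boundary p - (visual_boundary p - B) = B" by blast
    then have W: "openin (visual_topology p) (visual_boundary p - B)"
      using B by (simp add: openin_visual_topology)
    have "x \<in> morse_boundary p \<and> ?h x \<in> U \<longleftrightarrow> x \<in> visual_boundary p - B" if x: "x \<in> morse_stratum p N" for x
    proof -
      have x1: "x \<in> morse_stratum p N1" using x morse_stratum_step_gauge unfolding N1_def by blast
      have "?h x \<in> morse_stratum q N2" unfolding N2_def by (rule induced_map_in_stratum[OF N1 x1])
      then have "?h x \<in> U \<longleftrightarrow> ?h x \<in> V" "?h x \<in> visual_boundary q"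
        using V(2) unfolding morse_stratum_def by blast+
      moreover have "x \<in> morse_boundary p" using x N by (auto simp: morse_boundary_def)
      ultimately show ?thesis using x1 morse_boundary_visual by (auto simp: B_def)
    qed
    then have "{x \<in> morse_boundary p. ?h x \<in> U} \<inter> morse_stratum p N = (visual_boundary p - B) \<inter> morse_stratum p N"
      by blast
    then show "openin (subtopology (visual_topology p) (morse_stratum p N))
        ({x \<in> morse_boundary p. ?h x \<in> U} \<inter> morse_stratum p N)"
      unfolding openin_subtopology using W by blast
  qed blast
qed

end

lemma quasi_isometry_quasi_inverses:
  fixes f :: "'a::heine_borel \<Rightarrow> 'b::heine_borel"
  assumes "geodesic_space TYPE('a)" "geodesic_space TYPE('b)" "quasi_isometry f"
  obtains g L e D where "quasi_inverses f g L e D"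
proof -
  obtain L e g D where f: "qi_embedding_on L e UNIV f" and D: "D \<ge> 0"
    and gf: "\<And>x. dist (g (f x)) x \<le> D" and fg: "\<And>y. dist (f (g y)) y \<le> D"
    using assms(3) unfolding quasi_isometry_def by blast
  note F = qi_embedding_onD[OF f]
  \<comment> \<open>Since \<open>f (g x)\<close> is within \<open>D\<close> of \<open>x\<close>,
    \<open>dist (g x) (g y) \<le> L * (dist x y + 2 * D + e)\<close>. This error also dominates the
    one in the lower bound and the error of \<open>f\<close>, so both maps get the same
    constants.\<close>
  define e' where "e' = L * (e + 2 * D)"
  have ee: "e + 2 * D \<le> e'" "0 \<le> e'" "e' \<le> L * e'"
    using F(1,2) D mult_right_mono[of 1 L "e + 2 * D"] mult_right_mono[of 1 L e'] by (auto simp: e'_def)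
  have close: "\<bar>dist (f (g x)) (f (g y)) - dist x y\<bar> \<le> 2 * D" for x y
    using fg[of x] fg[of y] dist_triangle[of "f (g x)" "f (g y)" x] dist_triangle[of x "f (g y)" y]
      dist_triangle[of x y "f (g x)"] dist_triangle[of "f (g x)" y "f (g y)"] by (simp add: dist_commute)
  have "qi_embedding_on L e' UNIV g"
  proof (rule qi_embedding_onI[OF F(1) ee(2)])
    fix x y
    have "dist x y \<le> L * dist (g x) (g y) + e + 2 * D"
      using F(4)[of "g x" "g y"] close[of x y] by simp
    then show "dist x y \<le> L * (dist (g x) (g y) + e')" using ee by (simp add: distrib_left)
    have "L * (dist (f (g x)) (f (g y)) + e) \<le> L * (dist x y + 2 * D + e)"
      using close[of x y] F(1) by (intro mult_left_mono) auto
    then show "dist (g x) (g y) \<le> L * dist x y + e'"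
      using F(3)[of "g x" "g y"] by (simp add: e'_def algebra_simps)
  qed
  moreover have "qi_embedding_on L e' UNIV f" by (rule qi_embedding_on_weaken[OF f]) (use ee D in auto)
  ultimately have "quasi_inverses f g L e' D" using assms gf fg by unfold_locales
  then show ?thesis by (rule that)
qed

section \<open>Replacing the map induced by \<open>g\<close> by the inverse function\<close>

lemma boundary_tuples_subset: "xs \<in> boundary_tuples p n N \<Longrightarrow> set xs \<subseteq> morse_boundary p"
  by (simp add: boundary_tuples_def)

text \<open>\<open>inv_into\<close> agrees with the map induced by \<open>g\<close> on the Morse
  boundary only; all entries of tuples lie there, so stability and cross-ratio inequalities carry
  over.\<close>

lemma map_boundary_tuples_cong:
  assumes "\<And>b. b \<in> morse_boundary p \<Longrightarrow> h b = h' b"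
  shows "map h ` boundary_tuples p n N = map h' ` boundary_tuples p n N"
proof (rule image_cong[OF refl], rule map_cong[OF refl])
  fix xs b assume "xs \<in> boundary_tuples p n N" "b \<in> set xs"
  then show "h b = h' b" using boundary_tuples_subset assms by blast
qed

lemma two_stable_cong:
  assumes "\<And>b. b \<in> morse_boundary p \<Longrightarrow> h b = h' b"
  shows "two_stable p q h \<longleftrightarrow> two_stable p q h'"
  unfolding two_stable_def using map_boundary_tuples_cong[of p h h' 2, OF assms] by simp

lemma quasi_moebius_cong:
  assumes eq: "\<And>b. b \<in> morse_boundary p \<Longrightarrow> h b = h' b"
  shows "quasi_moebius p q K h \<longleftrightarrow> quasi_moebius p q K h'"
proof -
  have "cross_ratio K N' (h a) (h b) (h c) (h d) = cross_ratio K N' (h' a) (h' b) (h' c) (h' d)"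
    if "[a, b, c, d] \<in> boundary_tuples p 4 N" for a b c d N N'
    using boundary_tuples_subset[OF that] by (simp add: eq)
  then show ?thesis
    unfolding quasi_moebius_def
    using two_stable_cong[of p h h', OF eq] map_boundary_tuples_cong[of p h h' 2, OF eq]
    by (simp cong: conj_cong imp_cong)
qed

theorem theorem4p1:
  fixes f :: "'a::heine_borel \<Rightarrow> 'b::heine_borel" and p :: 'a and q :: 'b
    and K :: "gauge_fun \<Rightarrow> real"
  assumes "geodesic_space TYPE('a)" and "geodesic_space TYPE('b)"
    and "center_constants p K" and "center_constants q K"
    and "quasi_isometry f"
  shows "homeomorphic_maps (morse_topology p) (morse_topology q)
      (induced_map q f) (inv_into (morse_boundary p) (induced_map q f)) \<and>
    two_stable p q (induced_map q f) \<and>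
    quasi_moebius p q K (induced_map q f) \<and>
    two_stable q p (inv_into (morse_boundary p) (induced_map q f)) \<and>
    quasi_moebius q p K (inv_into (morse_boundary p) (induced_map q f))"
proof -
  obtain g L e D where "quasi_inverses f g L e D"
    by (rule quasi_isometry_quasi_inverses[OF assms(1,2,5)])
  then interpret F: quasi_inverses f g L e D .
  interpret G: quasi_inverses g f L e D by (rule F.inverse_pair)
  let ?k = "inv_into (morse_boundary p) (induced_map q f)"
  have inv: "?k c = induced_map p g c" if "c \<in> morse_boundary q" for c
    by (rule F.inv_into_induced_map[OF that])
  have "continuous_map (morse_topology q) (morse_topology p) ?k"
    by (rule continuous_map_eq[OF G.induced_map_continuous]) (simp add: inv topspace_morse)
  then have "homeomorphic_maps (morse_topology p) (morse_topology q) (induced_map q f) ?k"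
    using F.induced_map_continuous
    by (simp add: homeomorphic_maps_def topspace_morse inv F.induced_map_in_boundary
        F.induced_map_inverse G.induced_map_inverse)
  moreover have "two_stable q p ?k" using G.induced_map_two_stable two_stable_cong[where h = ?k and h' = "induced_map p g", OF inv] by blast
  moreover have "quasi_moebius q p K ?k"
    using G.induced_map_quasi_moebius[OF assms(4)] quasi_moebius_cong[where h = ?k and h' = "induced_map p g", OF inv] by blast
  ultimately show ?thesis
    using F.induced_map_two_stable F.induced_map_quasi_moebius[OF assms(3)] by blast
qed

end
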